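(* For every $n\in\{2,4,6,8,24\}$ one has $\chi(\mathbb{E}^n)\le 7^{n/2}$.
   Context: For $A\subseteq \mathbb{E}^n$ (Euclidean $n$-space), $\chi(A)$ denotes the chromatic number of $A$: the least number of colors needed to color the points of $A$ so that any two points of $A$ at Euclidean distance exactly $1$ receive different colors. *)

theory Defs
  imports "HOL-Analysis.Analysis" "HOL-Library.Extended_Nat"
begin

definition unit_distance_coloring :: "'a::metric_space set \<Rightarrow> nat \<Rightarrow> ('a \<Rightarrow> nat) \<Rightarrow> bool" where
  "unit_distance_coloring A k c \<longleftrightarrow>
     c ` A \<subseteq> {..<k} \<and> (\<forall>x\<in>A. \<forall>y\<in>A. dist x y = 1 \<longrightarrow> c x \<noteq> c y)"

text \<open>The value is \<open>\<infinity>\<close> if no finite number of colors suffices (infimum of the empty set).\<close>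

definition chromatic_number :: "'a::metric_space set \<Rightarrow> enat" where
  "chromatic_number A = (INF k \<in> {k. \<exists>c. unit_distance_coloring A k c}. enat k)"

end

theory Submission
  imports Defs
begin

text \<open>
  Let \<open>L\<close> be a lattice with minimal squared norm \<open>\<mu>\<close> and a fixed point free isometry \<open>\<omega>\<close> of order three, so
  that \<open>L\<close> has rank \<open>n / 2\<close> over \<open>\<int>[\<omega>]\<close> and \<open>(2 - \<omega>) L\<close> has index \<open>7\<^sup>n\<^sup>/\<^sup>2\<close> in \<open>L\<close>. Colouring the Voronoi cells of
  \<open>L\<close> by the classes modulo \<open>(2 - \<omega>) L\<close> separates two cells of the same colour by at least
  \<open>3/2\<close> times the minimal length of \<open>L\<close>. Hence the colouring works, after scaling, once the squared covering radius is
  smaller than \<open>9/16 \<mu>\<close>. This holds for \<open>A\<^sub>2\<close>, \<open>D\<^sub>4\<close>, the dual of \<open>E\<^sub>6\<close>, \<open>E\<^sub>8\<close> and the Leech lattice.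

  The covering radius is bounded by a contraction argument. Given a point \<open>x\<close>, a lattice point near \<open>2 x\<close> yields a
  point \<open>v / 2\<close> of \<open>L / 2\<close> near \<open>x\<close>, and the short vectors \<open>w\<close> in the class of \<open>v\<close> modulo \<open>2 L\<close> yield
  the lattice points \<open>v / 2 \<plusminus> w / 2\<close>. For \<open>D\<^sub>4\<close>, \<open>E\<^sub>8\<close> and the Leech lattice, which are left modules over the Hurwitz
  quaternions, put \<open>T = 1 + i\<close>. Every nonzero class modulo \<open>T L\<close> contains an orthogonal frame of minimal vectors, and
  this forces every class modulo \<open>2 L\<close> to contain either a vector of norm at most \<open>2 \<mu> - 2\<close> or an
  orthogonal frame of vectors of norm \<open>2 \<mu>\<close>. The frames modulo \<open>T L\<close> are found by moving each of the
  \<open>(4\<^sup>n\<^sup>/\<^sup>4 - 1) / 3\<close> lines of \<open>L / T L\<close> to one of a few explicit ones with diagonal automorphisms.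
\<close>

section \<open>Colourings from lattices\<close>

lemma chromatic_number_le_isometry:
  fixes f :: "'a::metric_space \<Rightarrow> 'b::metric_space"
  assumes f: "\<And>x y. dist (f x) (f y) = dist x y"
    and c: "unit_distance_coloring (UNIV :: 'b set) k c"
  shows "chromatic_number (UNIV :: 'a set) \<le> enat k"
proof -
  have "unit_distance_coloring (UNIV :: 'a set) k (c \<circ> f)"
    using c unfolding unit_distance_coloring_def by (auto simp: f)
  then show ?thesis
    unfolding chromatic_number_def by (intro INF_lower) blast
qed

text \<open>Euclidean spaces of equal dimension are linearly isometric, so colourings of complex and
  quaternionic spaces serve for \<open>real ^ 'n\<close>.\<close>

lemma chromatic_number_le_DIM_eq:
  assumes "DIM('a::euclidean_space) = DIM('b::euclidean_space)"
    and "unit_distance_coloring (UNIV :: 'b set) k c"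
  shows "chromatic_number (UNIV :: 'a set) \<le> enat k"
proof -
  have "dim (UNIV :: 'a set) = dim (UNIV :: 'b set)"
    using assms(1) by simp
  then obtain f :: "'a \<Rightarrow> 'b" and g where f: "linear f" "\<And>x. norm (f x) = norm x"
    by (rule isometries_subspaces[OF subspace_UNIV subspace_UNIV]) auto
  have "dist (f x) (f y) = dist x y" for x y
    unfolding dist_norm by (simp flip: linear_diff[OF f(1)] add: f(2))
  then show ?thesis
    using assms(2) by (rule chromatic_number_le_isometry)
qed

section \<open>Subgroups, their classes modulo 7, and the colouring criterion\<close>

definition additive_subgroup :: "'a::ab_group_add set \<Rightarrow> bool" where
  "additive_subgroup L \<longleftrightarrow> 0 \<in> L \<and> (\<forall>x\<in>L. \<forall>y\<in>L. x - y \<in> L)"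

lemma additive_subgroupD:
  assumes "additive_subgroup L"
  shows "0 \<in> L" "\<And>x y. x \<in> L \<Longrightarrow> y \<in> L \<Longrightarrow> x - y \<in> L"
    "\<And>x. x \<in> L \<Longrightarrow> - x \<in> L" "\<And>x y. x \<in> L \<Longrightarrow> y \<in> L \<Longrightarrow> x + y \<in> L"
proof -
  show z: "0 \<in> L" and d: "\<And>x y. x \<in> L \<Longrightarrow> y \<in> L \<Longrightarrow> x - y \<in> L"
    using assms by (auto simp: additive_subgroup_def)
  show m: "- x \<in> L" if "x \<in> L" for x
    using d[OF z that] by simp
  show "x + y \<in> L" if "x \<in> L" "y \<in> L" for x y
    using d[OF that(1) m[OF that(2)]] by simp
qed

lemma additive_subgroup_sum:
  assumes "additive_subgroup L" "\<And>k. k \<in> S \<Longrightarrow> f k \<in> L"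
  shows "sum f S \<in> L"
  using assms(2)
  by (induction S rule: infinite_finite_induct) (auto intro: additive_subgroupD[OF assms(1)])

lemma additive_subgroup_scaleR_int:
  fixes x :: "'a::real_vector"
  assumes L: "additive_subgroup L" and "x \<in> L"
  shows "real_of_int a *\<^sub>R x \<in> L"
proof -
  have *: "real n *\<^sub>R x \<in> L" for n
    by (induction n) (auto simp: scaleR_left_distrib intro: additive_subgroupD[OF L] assms)
  show ?thesis
  proof (cases "a \<ge> 0")
    case True
    then show ?thesis using *[of "nat a"] by simp
  next
    case False
    then show ?thesis
      using additive_subgroupD(3)[OF L *[of "nat (- a)"]] by simp
  qed
qed

text \<open>With \<open>\<omega>\<^sup>2 + \<omega> + 1 = 0\<close>, the endomorphism \<open>\<phi> = 2 - \<omega>\<close> satisfies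
  \<open>\<phi> (3 + \<omega>) = 7\<close>, so modulo \<open>\<phi> L\<close> every \<open>a + b \<omega>\<close> becomes the residue \<open>a + 2 b\<close> modulo \<open>7\<close>.\<close>

lemma classes_mod_seven:
  fixes L :: "'a::euclidean_space set" and w :: "'a \<Rightarrow> 'a" and g :: "nat \<Rightarrow> 'a"
  assumes L: "additive_subgroup L" and w: "linear w" "\<And>x. w (w x) + w x + x = 0"
    and wL: "\<And>x. x \<in> L \<Longrightarrow> w x \<in> L"
    and gL: "\<And>k. k < m \<Longrightarrow> g k \<in> L"
    and gen: "\<And>l. l \<in> L \<Longrightarrow> \<exists>a b. l = (\<Sum>k<m. of_int (a k) *\<^sub>R g k + of_int (b k) *\<^sub>R w (g k))"
  shows "\<exists>c :: 'a \<Rightarrow> nat. c ` L \<subseteq> {..<7 ^ m} \<and>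
    (\<forall>l\<in>L. \<forall>l'\<in>L. c l = c l' \<longrightarrow> (\<exists>u\<in>L. l - l' = 2 *\<^sub>R u - w u))"
proof -
  obtain a b :: "'a \<Rightarrow> nat \<Rightarrow> int"
    where ab: "\<And>l. l \<in> L \<Longrightarrow> l = (\<Sum>k<m. of_int (a l k) *\<^sub>R g k + of_int (b l k) *\<^sub>R w (g k))"
    using gen by metis
  define F where "F = PiE {..<m} (\<lambda>_. {0..<7::int})"
  have "finite F" "card F = 7 ^ m"
    unfolding F_def by (auto simp: card_PiE intro: finite_PiE)
  then obtain h where h: "bij_betw h F {0..<7 ^ m :: nat}"
    using ex_bij_betw_finite_nat by metis
  define d where "d l = (\<lambda>k\<in>{..<m}. (a l k + 2 * b l k) mod 7)" for l
  have dF: "d l \<in> F" for l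
    unfolding d_def F_def by auto
  have "\<exists>u\<in>L. l - l' = 2 *\<^sub>R u - w u" if l: "l \<in> L" "l' \<in> L" and eq: "h (d l) = h (d l')" for l l'
  proof -
    have "d l = d l'"
      using h eq dF unfolding bij_betw_def inj_on_def by blast
    then have "(a l k + 2 * b l k) mod 7 = (a l' k + 2 * b l' k) mod 7" if "k < m" for k
      using that by (auto simp: d_def restrict_def dest!: fun_cong[of _ _ k])
    then have "\<exists>t. (a l k - a l' k) + 2 * (b l k - b l' k) = 7 * t" if "k < m" for k
      using that by (metis (no_types, lifting) mod_eq_dvd_iff dvdE add_diff_add right_diff_distrib)
    then obtain t where t: "\<And>k. k < m \<Longrightarrow> a l k - a l' k = 7 * t k - 2 * (b l k - b l' k)"
      by (metis add_diff_cancel_right')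
    \<comment> \<open>With \<open>\<beta> = b l k - b l' k\<close>, the coefficient
      \<open>7 t - 2 \<beta> + \<beta> \<omega>\<close> factors as
      \<open>(2 - \<omega>) ((3 + \<omega>) t - \<beta>)\<close>; \<open>s\<close> is the second
      factor applied to \<open>g\<close>.\<close>
    define s where "s k = (of_int (3 * t k - (b l k - b l' k)) *\<^sub>R g k + of_int (t k) *\<^sub>R w (g k))" for k
    define u where "u = (\<Sum>k<m. s k)"
    have "u \<in> L"
      unfolding u_def s_def
      by (intro additive_subgroup_sum L additive_subgroupD(4)[OF L] additive_subgroup_scaleR_int gL wL) auto
    have ww: "w (w x) = - w x - x" for x
      using w(2)[of x] by (simp add: eq_neg_iff_add_eq_0 algebra_simps)
    have "l - l' = (\<Sum>k<m. of_int (a l k - a l' k) *\<^sub>R g k + of_int (b l k - b l' k) *\<^sub>R w (g k))"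
      by (subst ab[OF l(1)], subst ab[OF l(2)], subst sum_subtractf[symmetric], rule sum.cong)
        (auto simp: algebra_simps)
    also have "\<dots> = (\<Sum>k<m. 2 *\<^sub>R s k - w (s k))"
    proof (rule sum.cong)
      fix k assume "k \<in> {..<m}"
      then have k: "a l k - a l' k = 7 * t k - 2 * (b l k - b l' k)" using t by auto
      show "of_int (a l k - a l' k) *\<^sub>R g k + of_int (b l k - b l' k) *\<^sub>R w (g k) = 2 *\<^sub>R s k - w (s k)"
        unfolding k s_def linear_add[OF w(1)] linear_scale[OF w(1)] ww
        by (rule euclidean_eqI) (simp add: inner_simps algebra_simps)
    qed simp
    also have "\<dots> = 2 *\<^sub>R u - w u"
      unfolding u_def by (simp add: sum_subtractf scaleR_right.sum linear_sum[OF w(1)])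
    finally show ?thesis using \<open>u \<in> L\<close> by blast
  qed
  moreover have "(\<lambda>l. h (d l)) ` L \<subseteq> {..<7 ^ m}"
    using h dF by (fastforce simp: bij_betw_def)
  ultimately show ?thesis by (intro exI[of _ "\<lambda>l. h (d l)"]) blast
qed

text \<open>Points are coloured by the class modulo \<open>\<phi> L\<close> of a nearest lattice point, after scaling by some
  \<open>s\<close> strictly between \<open>2 r\<close> and \<open>3/2\<close> times the minimal length. If \<open>p\<close> and \<open>q\<close> have nearest lattice
  points differing by \<open>\<phi> u\<close>, \<open>u \<noteq> 0\<close>, then the Voronoi inequalities for \<open>\<plusminus>u\<close> together with
  \<open>\<phi> u \<bullet> u = 5/2 (u \<bullet> u)\<close> give \<open>(p - q) \<bullet> u \<ge> 3/2 (u \<bullet> u)\<close>.\<close>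

theorem lattice_coloring:
  fixes L :: "'a::euclidean_space set" and w :: "'a \<Rightarrow> 'a" and g :: "nat \<Rightarrow> 'a"
  assumes L: "additive_subgroup L" and w: "linear w" "\<And>x. w (w x) + w x + x = 0"
    and normw: "\<And>x. norm (w x) = norm x"
    and wL: "\<And>x. x \<in> L \<Longrightarrow> w x \<in> L"
    and gL: "\<And>k. k < m \<Longrightarrow> g k \<in> L"
    and gen: "\<And>l. l \<in> L \<Longrightarrow> \<exists>a b. l = (\<Sum>k<m. of_int (a k) *\<^sub>R g k + of_int (b k) *\<^sub>R w (g k))"
    and min: "\<And>l. l \<in> L \<Longrightarrow> l \<noteq> 0 \<Longrightarrow> \<mu> \<le> l \<bullet> l" and "\<mu> > 0"
    and cov: "\<And>x. \<exists>l\<in>L. (x - l) \<bullet> (x - l) \<le> \<rho>" and \<rho>: "\<rho> < 9/16 * \<mu>"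
  shows "\<exists>c. unit_distance_coloring (UNIV :: 'a set) (7 ^ m) c"
proof -
  note Ld = additive_subgroupD[OF L]
  obtain c :: "'a \<Rightarrow> nat" where cL: "c ` L \<subseteq> {..<7 ^ m}"
    and c: "\<And>l l'. l \<in> L \<Longrightarrow> l' \<in> L \<Longrightarrow> c l = c l' \<Longrightarrow> \<exists>u\<in>L. l - l' = 2 *\<^sub>R u - w u"
    using classes_mod_seven[OF L w wL gL gen] by metis
  have "\<rho> \<ge> 0"
    using cov[of 0] by (meson inner_ge_zero order_trans)
  obtain s where s: "2 * sqrt \<rho> < s" "s < 3/2 * sqrt \<mu>"
  proof -
    have "sqrt (4 * \<rho>) < sqrt (9/4 * \<mu>)" using \<rho> by (intro real_sqrt_less_mono) auto
    then have "2 * sqrt \<rho> < 3/2 * sqrt \<mu>" by (simp add: real_sqrt_mult real_sqrt_divide)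
    then show thesis using dense that by blast
  qed
  have s0: "s > 0" using s(1) \<open>\<rho> \<ge> 0\<close> by (smt (verit) real_sqrt_ge_zero)
  have "closed L"
  proof (rule discrete_imp_closed[of "sqrt \<mu>"])
    show "0 < sqrt \<mu>" using \<open>\<mu> > 0\<close> by simp
    show "\<forall>x\<in>L. \<forall>y\<in>L. dist y x < sqrt \<mu> \<longrightarrow> y = x"
      using min Ld(2) by (metis dist_norm eq_iff_diff_eq_0 linorder_not_less norm_eq_sqrt_inner real_sqrt_le_iff)
  qed
  moreover have "L \<noteq> {}" using Ld(1) by auto
  ultimately have "\<exists>l\<in>L. \<forall>l'\<in>L. dist x l \<le> dist x l'" for x
    using distance_attains_inf by metis
  then obtain n where n: "\<And>x. n x \<in> L" "\<And>x l. l \<in> L \<Longrightarrow> norm (x - n x) \<le> norm (x - l)"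
    unfolding dist_norm by metis
  have nr: "norm (x - n x) \<le> sqrt \<rho>" for x
    using cov[of x] n(2)[of _ x] by (metis norm_eq_sqrt_inner order_trans real_sqrt_le_iff)
  have vor: "\<bar>(x - n x) \<bullet> u\<bar> \<le> u \<bullet> u / 2" if "u \<in> L" for x u
  proof -
    have "norm (x - n x) \<le> norm (x - n x - v)" if "v \<in> L" for v
      using n(2)[OF Ld(4)[OF n(1) that]] by (simp add: algebra_simps)
    then have "(x - n x) \<bullet> (x - n x) \<le> (x - n x - v) \<bullet> (x - n x - v)" if "v \<in> L" for v
      using that by (simp add: norm_eq_sqrt_inner)
    then have *: "(x - n x) \<bullet> v \<le> v \<bullet> v / 2" if "v \<in> L" for v
      using that by (fastforce simp: inner_diff_left inner_diff_right inner_commute)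
    show ?thesis using *[OF that] *[OF Ld(3)[OF that]] by (simp add: abs_le_iff)
  qed
  \<comment> \<open>Since \<open>w u + u = - w (w u)\<close> is as long as \<open>u\<close>,
    expanding its square determines the inner product.\<close>
  have wu: "w u \<bullet> u = - (u \<bullet> u) / 2" for u
  proof -
    have "w u + u = - w (w u)" using w(2)[of u] by (simp add: eq_neg_iff_add_eq_0 algebra_simps)
    then have "norm (w u + u) = norm u" by (simp add: normw)
    then have "(w u + u) \<bullet> (w u + u) = u \<bullet> u" by (simp add: norm_eq_sqrt_inner)
    moreover have "w u \<bullet> w u = u \<bullet> u" using normw[of u] by (simp add: norm_eq_sqrt_inner)
    ultimately show ?thesis by (simp add: inner_add_left inner_add_right inner_commute)
  qed
  have "c (n (s *\<^sub>R x)) \<noteq> c (n (s *\<^sub>R y))" if "dist x y = 1" for x y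
  proof
    define p q where "p = s *\<^sub>R x" and "q = s *\<^sub>R y"
    have pq: "norm (p - q) = s"
      using that s0 by (simp add: p_def q_def dist_norm flip: scaleR_diff_right)
    assume "c (n (s *\<^sub>R x)) = c (n (s *\<^sub>R y))"
    then obtain u where u: "u \<in> L" "n p - n q = 2 *\<^sub>R u - w u"
      using c[OF n(1) n(1)] unfolding p_def q_def by blast
    have dec: "p - q = (p - n p) - (q - n q) + (2 *\<^sub>R u - w u)"
      by (simp flip: u(2))
    show False
    \<comment> \<open>For \<open>u = 0\<close> both points lie in one cell, of diameter at most
      \<open>2 * sqrt \<rho>\<close>.\<close>
    proof (cases "u = 0")
      case True
      then have "p - q = (p - n p) - (q - n q)"
        using dec linear_0[OF w(1)] by simp
      then have "s \<le> sqrt \<rho> + sqrt \<rho>"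
        using pq nr norm_triangle_ineq4[of "p - n p" "q - n q"] by (smt (verit, ccfv_SIG))
      then show False using s(1) by simp
    next
      case False
      have "3/2 * (u \<bullet> u) \<le> (p - q) \<bullet> u"
        unfolding dec inner_add_left inner_diff_left[of "p - n p"] inner_diff_left[of "2 *\<^sub>R u"]
          inner_scaleR_left wu
        using abs_le_D2[OF vor[OF u(1), of p]] abs_le_D1[OF vor[OF u(1), of q]] by linarith
      also have "\<dots> \<le> s * norm u"
        using norm_cauchy_schwarz[of "p - q" u] pq by simp
      finally have "3/2 * norm u \<le> s"
        using False by (simp add: dot_square_norm power2_eq_square)
      moreover have "sqrt \<mu> \<le> norm u"
        using min[OF u(1) False] by (simp add: norm_eq_sqrt_inner)
      ultimately show False using s(2) by simp
    qed
  qed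
  then have "unit_distance_coloring (UNIV :: 'a set) (7 ^ m) (\<lambda>x. c (n (s *\<^sub>R x)))"
    unfolding unit_distance_coloring_def using cL n(1) by blast
  then show ?thesis by blast
qed

section \<open>Covering radius\<close>

text \<open>Linear independence of a basis extracted from \<open>Z\<close> rules out antipodal
  pairs, so the basis is orthogonal; the last two conclusions are its Fourier expansion and
  Parseval's identity.\<close>

lemma span_orthogonal_basis:
  fixes Z :: "'a::euclidean_space set"
  assumes sp: "span Z = UNIV" and c: "c > 0" "\<And>z. z \<in> Z \<Longrightarrow> z \<bullet> z = c"
    and orth: "\<And>x y. x \<in> Z \<Longrightarrow> y \<in> Z \<Longrightarrow> x \<noteq> y \<Longrightarrow> x \<noteq> - y \<Longrightarrow> x \<bullet> y = 0"
  obtains B where "B \<subseteq> Z" "finite B" "card B = DIM('a)"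
    "\<And>x. x = (\<Sum>b\<in>B. (x \<bullet> b / c) *\<^sub>R b)" "\<And>x. (\<Sum>b\<in>B. (x \<bullet> b)\<^sup>2) = c * (x \<bullet> x)"
proof -
  obtain B where B: "B \<subseteq> Z" "independent B" "Z \<subseteq> span B" "card B = dim Z"
    using basis_exists[of Z] by metis
  have fin: "finite B" using B(2) by (rule independent_imp_finite)
  have spB: "span B = UNIV"
    using B(3) sp by (metis span_mono span_span top.extremum_uniqueI)
  have orthB: "x \<bullet> y = 0" if xy: "x \<in> B" "y \<in> B" "x \<noteq> y" for x y
  proof (rule orth)
    show "x \<noteq> - y"
    proof
      assume "x = - y"
      then have "x \<in> span (B - {x})"
        using xy by (simp add: span_base span_neg)
      then show False using B(2) xy(1) dependent_def by blast
    qed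
  qed (use that B(1) in auto)
  have inner_B: "(\<Sum>b\<in>B. f b *\<^sub>R b) \<bullet> y = f y * c" if "y \<in> B" for f y
  proof -
    have "(\<Sum>b\<in>B. f b *\<^sub>R b) \<bullet> y = (\<Sum>b\<in>B. if b = y then f y * c else 0)"
      unfolding inner_sum_left using orthB[OF _ that] c(2) that B(1)
      by (intro sum.cong) (auto simp: subset_iff)
    then show ?thesis using fin that by simp
  qed
  have expand: "x = (\<Sum>b\<in>B. (x \<bullet> b / c) *\<^sub>R b)" for x
  proof -
    define y where "y = x - (\<Sum>b\<in>B. (x \<bullet> b / c) *\<^sub>R b)"
    have "orthogonal y b" if "b \<in> B" for b
      unfolding orthogonal_def y_def inner_diff_left inner_B[OF that] using c(1) by simp
    then have "orthogonal y y"
      by (intro orthogonal_to_span[of y B]) (simp_all add: spB)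
    then show ?thesis by (simp add: orthogonal_self y_def)
  qed
  have "(\<Sum>b\<in>B. (x \<bullet> b)\<^sup>2) = c * (x \<bullet> x)" for x
  proof -
    have "x \<bullet> x = (\<Sum>b\<in>B. (x \<bullet> b / c) *\<^sub>R b) \<bullet> x" using expand[of x] by simp
    also have "\<dots> = (\<Sum>b\<in>B. (x \<bullet> b)\<^sup>2) / c"
      unfolding inner_sum_left sum_divide_distrib
      by (intro sum.cong) (auto simp: power2_eq_square inner_commute)
    finally show ?thesis using c(1) by simp
  qed
  moreover have "card B = DIM('a)"
    using B(4) dim_span[of Z] sp by simp
  ultimately show thesis
    using that[of B] B(1) fin expand by blast
qed

text \<open>The vectors \<open>z - z'\<close> and \<open>z + z'\<close> have squared norms
  \<open>2 * c\<close> minus and plus twice the inner product, and neither falls below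
  \<open>2 * c\<close>. This turns minimal vectors of one class into orthogonal frames.\<close>

lemma inner_eq_0_in_coset:
  fixes M :: "'a::real_inner set"
  assumes "\<And>x. x \<in> M \<Longrightarrow> x \<noteq> 0 \<Longrightarrow> 2 * c \<le> x \<bullet> x"
    and "z \<bullet> z = c" "z' \<bullet> z' = c" "z - z' \<in> M" "z + z' \<in> M" "z \<noteq> z'" "z \<noteq> - z'"
  shows "z \<bullet> z' = 0"
  using assms(1)[OF assms(4)] assms(1)[OF assms(5)] assms(2,3,6,7)
  by (auto simp: inner_simps inner_commute eq_neg_iff_add_eq_0)

section \<open>Bounds \<open>q\<close> on the squared covering radius and their contraction\<close>

definition covers :: "'a::real_inner set \<Rightarrow> real \<Rightarrow> bool" where
  "covers L q \<longleftrightarrow> (\<forall>x. \<exists>l\<in>L. (x - l) \<bullet> (x - l) \<le> q)"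

lemma covers_mono: "covers L q \<Longrightarrow> q \<le> q' \<Longrightarrow> covers L q'"
  unfolding covers_def by (meson order_trans)

text \<open>Rounding down the coordinates in a basis taken from \<open>L\<close> gives a crude
  bound, which starts the contraction.\<close>

lemma covers_spanning_subgroup:
  fixes L :: "'a::euclidean_space set"
  assumes L: "additive_subgroup L" and sp: "span L = UNIV"
  obtains q where "covers L q"
proof -
  obtain B where B: "B \<subseteq> L" "independent B" "L \<subseteq> span B"
    using basis_exists[of L] by metis
  have fin: "finite B" using B(2) by (rule independent_imp_finite)
  define r where "r = (\<Sum>b\<in>B. norm b)"
  have "\<exists>l\<in>L. (x - l) \<bullet> (x - l) \<le> r\<^sup>2" for x
  proof -
    have "x \<in> span B"
      using B(3) sp by (metis UNIV_I span_mono span_span subsetD)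
    then obtain f where f: "x = (\<Sum>b\<in>B. f b *\<^sub>R b)"
      using span_finite[OF fin] by auto
    define l where "l = (\<Sum>b\<in>B. of_int \<lfloor>f b\<rfloor> *\<^sub>R b)"
    have "l \<in> L"
      unfolding l_def using B(1) by (intro additive_subgroup_sum L additive_subgroup_scaleR_int) auto
    have "x - l = (\<Sum>b\<in>B. frac (f b) *\<^sub>R b)"
      unfolding f l_def by (simp add: frac_def scaleR_left_diff_distrib sum_subtractf)
    then have "norm (x - l) \<le> (\<Sum>b\<in>B. norm (frac (f b) *\<^sub>R b))"
      by (simp only: norm_sum)
    also have "\<dots> \<le> r"
      unfolding r_def by (intro sum_mono) (simp add: mult_left_le_one_le frac_lt_1 less_imp_le)
    finally have "(norm (x - l))\<^sup>2 \<le> r\<^sup>2" by (intro power_mono) auto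
    then show ?thesis using \<open>l \<in> L\<close> by (auto simp: dot_square_norm)
  qed
  then show thesis using that[of "r\<^sup>2"] by (auto simp: covers_def)
qed

text \<open>The map sending \<open>q\<close> to \<open>q / 4 + c\<close> contracts towards its fixed
  point \<open>4 / 3 * c\<close>; as the limit need not be reached, the inequality is
  strict.\<close>

lemma covers_contraction:
  assumes "covers L q0" and step: "\<And>q. covers L q \<Longrightarrow> covers L (q / 4 + c)" and "q > 4 / 3 * c"
  shows "covers L q"
proof -
  have *: "covers L ((q0 - 4 / 3 * c) * (1 / 4) ^ n + 4 / 3 * c)" for n
  proof (induction n)
    case 0
    then show ?case using assms(1) by simp
  next
    case (Suc n)
    show ?case using step[OF Suc] by (simp add: field_simps)
  qed
  have "(\<lambda>n. (q0 - 4 / 3 * c) * (1 / 4) ^ n + 4 / 3 * c) \<longlonglongrightarrow> (q0 - 4 / 3 * c) * 0 + 4 / 3 * c"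
    by (intro tendsto_intros LIMSEQ_realpow_zero) auto
  then have "\<forall>\<^sub>F n in sequentially. (q0 - 4 / 3 * c) * (1 / 4) ^ n + 4 / 3 * c < q"
    using assms(3) by (intro order_tendstoD) auto
  then obtain n where "(q0 - 4 / 3 * c) * (1 / 4) ^ n + 4 / 3 * c < q"
    by (auto simp: eventually_sequentially)
  then show ?thesis using covers_mono[OF *[of n]] by simp
qed

text \<open>The point \<open>2 x\<close> is close to some \<open>v \<in> L\<close>, so \<open>x\<close> is close to \<open>v / 2\<close>, and every vector \<open>w\<close> of the
  class of \<open>v\<close> modulo \<open>2 L\<close> provides the two lattice points \<open>v / 2 \<plusminus> w / 2\<close>.\<close>

lemma half_lattice_step:
  fixes L :: "'a::real_inner set"
  assumes L: "additive_subgroup L" and cov: "covers L q"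
    and cls: "\<And>v e. v \<in> L \<Longrightarrow> e \<bullet> e \<le> q / 4 \<Longrightarrow>
      \<exists>w\<in>L. (\<exists>u\<in>L. v - w = 2 *\<^sub>R u) \<and> e \<bullet> e - \<bar>e \<bullet> w\<bar> + w \<bullet> w / 4 \<le> q'"
  shows "covers L q'"
  unfolding covers_def
proof
  fix x
  note L_closed = additive_subgroupD[OF L]
  obtain v where v: "v \<in> L" "(2 *\<^sub>R x - v) \<bullet> (2 *\<^sub>R x - v) \<le> q"
    using cov unfolding covers_def by blast
  define e where "e = x - (1/2) *\<^sub>R v"
  have e2: "2 *\<^sub>R e = 2 *\<^sub>R x - v"
    by (simp add: e_def scaleR_diff_right)
  have "4 * (e \<bullet> e) = (2 *\<^sub>R e) \<bullet> (2 *\<^sub>R e)" by simp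
  then have "e \<bullet> e \<le> q / 4" using v(2) unfolding e2 by simp
  from cls[OF v(1) this] obtain w u where wu: "w \<in> L" "u \<in> L" "v - w = 2 *\<^sub>R u"
    and le: "e \<bullet> e - \<bar>e \<bullet> w\<bar> + w \<bullet> w / 4 \<le> q'" by blast
  have v_eq: "v = 2 *\<^sub>R u + w" using wu(3) by (simp add: algebra_simps)
  have x1: "x - u = e + (1/2) *\<^sub>R w" and x2: "x - (u + w) = e - (1/2) *\<^sub>R w"
    unfolding e_def v_eq by (simp_all add: algebra_simps flip: scaleR_left_distrib)
  show "\<exists>l\<in>L. (x - l) \<bullet> (x - l) \<le> q'"
  proof (cases "e \<bullet> w \<ge> 0")
    case True
    then have "(x - (u + w)) \<bullet> (x - (u + w)) \<le> q'"
      unfolding x2 using le by (simp add: inner_simps inner_commute field_simps)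
    then show ?thesis using L_closed(4)[OF wu(2,1)] by blast
  next
    case False
    then have "(x - u) \<bullet> (x - u) \<le> q'"
      unfolding x1 using le by (simp add: inner_simps inner_commute field_simps)
    then show ?thesis using wu(2) by blast
  qed
qed

text \<open>Discarding the term \<open>\<bar>e \<bullet> w\<bar>\<close> in
  \<open>half_lattice_step\<close> leaves the contraction with \<open>c = \<beta> / 4\<close>, whose
  fixed point is \<open>\<beta> / 3\<close>.\<close>

lemma covers_of_short_classes:
  fixes L :: "'a::euclidean_space set"
  assumes L: "additive_subgroup L" "span L = UNIV"
    and cls: "\<And>v. v \<in> L \<Longrightarrow> \<exists>w\<in>L. (\<exists>u\<in>L. v - w = 2 *\<^sub>R u) \<and> w \<bullet> w \<le> \<beta>"
    and "q > \<beta> / 3"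
  shows "covers L q"
proof -
  obtain q0 where "covers L q0"
    using covers_spanning_subgroup[OF L] by blast
  moreover have "covers L (q / 4 + \<beta> / 4)" if "covers L q" for q
  proof (rule half_lattice_step[OF L(1) that])
    fix v e :: 'a
    assume "v \<in> L" and e: "e \<bullet> e \<le> q / 4"
    then obtain w u where w: "w \<in> L" "u \<in> L" "v - w = 2 *\<^sub>R u" "w \<bullet> w \<le> \<beta>"
      using cls by blast
    have "e \<bullet> e - \<bar>e \<bullet> w\<bar> + w \<bullet> w / 4 \<le> q / 4 + \<beta> / 4"
      using e w(4) by simp
    with w show "\<exists>w\<in>L. (\<exists>u\<in>L. v - w = 2 *\<^sub>R u) \<and> e \<bullet> e - \<bar>e \<bullet> w\<bar> + w \<bullet> w / 4 \<le> q / 4 + \<beta> / 4"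
      by blast
  qed
  ultimately show ?thesis
    using covers_contraction[of L q0 "\<beta> / 4" q] assms(4) by simp
qed

text \<open>\<open>T\<close> abstracts left multiplication by \<open>1 + i\<close>: it doubles
  squared norms, and the two parts of \<open>T2\<close> say that \<open>T (T L) = 2 L\<close>. The
  hypothesis \<open>frame\<close> concerns classes modulo \<open>T L\<close>; the goal is to control
  those modulo \<open>2 L\<close>.\<close>

locale frame_lattice =
  fixes L :: "'a::euclidean_space set" and T :: "'a \<Rightarrow> 'a" and \<mu> :: real
  assumes L: "additive_subgroup L" and span_L: "span L = UNIV"
    and T: "linear T" "\<And>x. T x \<bullet> T x = 2 * (x \<bullet> x)"
    and TL: "\<And>x. x \<in> L \<Longrightarrow> T x \<in> L"
    and T2: "\<And>x. x \<in> L \<Longrightarrow> \<exists>y\<in>L. 2 *\<^sub>R x = T (T y)" "\<And>x. x \<in> L \<Longrightarrow> \<exists>y\<in>L. T (T x) = 2 *\<^sub>R y"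
    and even_norm: "\<And>x. x \<in> L \<Longrightarrow> \<exists>k::int. x \<bullet> x = 2 * of_int k"
    and min_norm: "\<And>x. x \<in> L \<Longrightarrow> x \<noteq> 0 \<Longrightarrow> \<mu> \<le> x \<bullet> x"
    and frame: "\<And>v. v \<in> L \<Longrightarrow> v \<notin> T ` L \<Longrightarrow> span {w \<in> L. v - w \<in> T ` L \<and> w \<bullet> w = \<mu>} = UNIV"
    and \<mu>: "\<mu> = 2 \<or> \<mu> = 4 \<and> DIM('a) = 24"
    and dim_le: "DIM('a) \<le> 24"
begin

lemmas L_closed = additive_subgroupD[OF L]

lemma mu_pos: "\<mu> > 0"
  using \<mu> by auto

lemma integral_inner: "x \<in> L \<Longrightarrow> y \<in> L \<Longrightarrow> \<exists>k::int. x \<bullet> y = of_int k"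
proof -
  assume xy: "x \<in> L" "y \<in> L"
  obtain a b c :: int where "x \<bullet> x = 2 * of_int a" "y \<bullet> y = 2 * of_int b" "(x + y) \<bullet> (x + y) = 2 * of_int c"
    using even_norm xy L_closed(4) by metis
  then have "x \<bullet> y = of_int (c - a - b)"
    by (simp add: inner_simps inner_commute)
  then show ?thesis ..
qed

lemma T_inner: "T x \<bullet> T y = 2 * (x \<bullet> y)"
proof -
  have "T (x + y) \<bullet> T (x + y) = 2 * ((x + y) \<bullet> (x + y))" by (rule T)
  then show ?thesis
    unfolding linear_add[OF T(1)] using T(2)[of x] T(2)[of y]
    by (simp add: inner_simps inner_commute)
qed

lemma T_surj: "surj T"
proof -
  have "inj T"
    unfolding linear_injective_0[OF T(1)] using T(2) by (metis inner_eq_zero_iff mult_eq_0_iff zero_neq_numeral)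
  then show ?thesis using linear_injective_imp_surjective[OF T(1)] by blast
qed

lemma TL_subgroup: "additive_subgroup (T ` L)"
  unfolding additive_subgroup_def using L_closed linear_0[OF T(1)] linear_diff[OF T(1)]
  by (smt (verit, del_insts) imageE image_eqI)

lemma twoL_TL: "x \<in> L \<Longrightarrow> 2 *\<^sub>R x \<in> T ` L"
  using T2(1) TL by blast

text \<open>Nonzero vectors of \<open>T L\<close> have squared norm at least \<open>2 \<mu>\<close>,
  so minimal vectors of one class modulo \<open>T L\<close> are equal, antipodal or
  orthogonal.\<close>

lemma frame_orthogonal_basis:
  assumes "v \<in> L" "v \<notin> T ` L"
  obtains B where "B \<subseteq> {w \<in> L. v - w \<in> T ` L \<and> w \<bullet> w = \<mu>}" "finite B" "card B = DIM('a)"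
    "\<And>x. x = (\<Sum>b\<in>B. (x \<bullet> b / \<mu>) *\<^sub>R b)" "\<And>x. (\<Sum>b\<in>B. (x \<bullet> b)\<^sup>2) = \<mu> * (x \<bullet> x)"
proof (rule span_orthogonal_basis[OF frame[OF assms] mu_pos])
  note D = additive_subgroupD[OF TL_subgroup]
  fix x y assume xy: "x \<in> {w \<in> L. v - w \<in> T ` L \<and> w \<bullet> w = \<mu>}" "y \<in> {w \<in> L. v - w \<in> T ` L \<and> w \<bullet> w = \<mu>}"
    "x \<noteq> y" "x \<noteq> - y"
  show "x \<bullet> y = 0"
  proof (rule inner_eq_0_in_coset[of "T ` L" \<mu>])
    show "2 * \<mu> \<le> x \<bullet> x" if "x \<in> T ` L" "x \<noteq> 0" for x
      using that min_norm T(2) linear_0[OF T(1)] by fastforce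
    show m: "x - y \<in> T ` L" using D(2)[of "v - y" "v - x"] xy by simp
    show "x + y \<in> T ` L" using D(4)[OF m twoL_TL[of y]] xy by (simp add: scaleR_2)
  qed (use xy in simp_all)
qed (simp, (rule that; assumption))

text \<open>Let \<open>v = w + T u\<close> with \<open>w\<close> minimal. The vectors \<open>w \<plusminus> T b\<close>, \<open>b\<close> in the frame of \<open>u\<close>, lie in
  the class of \<open>v\<close> modulo \<open>2 L\<close>. The integers \<open>w \<bullet> T b\<close> have a common parity and their squares add up to
  \<open>2 \<mu>\<^sup>2\<close>. If none of them exceeds \<open>\<mu> / 2\<close> in absolute value, then exactly eight of them are nonzero, and the resulting
  eight vectors of norm \<open>2 \<mu>\<close> add up to \<open>4 w\<close>. As the possible \<open>w\<close> span the space, so do these vectors.\<close>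

lemma class_mod_two:
  assumes v: "v \<in> L"
  shows "(\<exists>w\<in>L. (\<exists>u\<in>L. v - w = 2 *\<^sub>R u) \<and> w \<bullet> w \<le> 2 * \<mu> - 2) \<or>
    span {z \<in> L. (\<exists>u\<in>L. v - z = 2 *\<^sub>R u) \<and> z \<bullet> z = 2 * \<mu>} = UNIV"
    (is "?short \<or> span ?Z = UNIV")
proof (cases "v \<in> T ` L")
  case True
  then obtain u where u: "u \<in> L" "v = T u" by blast
  show ?thesis
  proof (cases "u \<in> T ` L")
    case True
    then have ?short
      using u T2(2) L_closed(1) \<mu> by (intro bexI[of _ 0]) auto
    then show ?thesis ..
  next
    case False
    have "T ` {w \<in> L. u - w \<in> T ` L \<and> w \<bullet> w = \<mu>} \<subseteq> ?Z"
      using TL T2(2) u(2) by (auto simp: T simp flip: linear_diff[OF T(1)])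
    then have "span (T ` {w \<in> L. u - w \<in> T ` L \<and> w \<bullet> w = \<mu>}) \<subseteq> span ?Z"
      by (rule span_mono)
    then show ?thesis
      unfolding linear_span_image[OF T(1)] frame[OF u(1) False] using T_surj by auto
  qed
next
  case False
  show ?thesis
  proof (rule disjCI)
    assume "span ?Z \<noteq> UNIV"
    moreover have "span ?Z = UNIV" if "{w \<in> L. v - w \<in> T ` L \<and> w \<bullet> w = \<mu>} \<subseteq> span ?Z"
      using span_minimal[OF that subspace_span] unfolding frame[OF v False] by (rule top.extremum_uniqueI)
    ultimately have "\<not> {w \<in> L. v - w \<in> T ` L \<and> w \<bullet> w = \<mu>} \<subseteq> span ?Z"
      by argo
    then obtain w where w0: "w \<in> {w \<in> L. v - w \<in> T ` L \<and> w \<bullet> w = \<mu>}" "w \<notin> span ?Z"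
      by (meson subsetI)
    then have w: "w \<in> L" "w \<bullet> w = \<mu>" "w \<notin> span ?Z" by simp_all
    from w0(1) have "v - w \<in> T ` L" by simp
    then obtain u where u: "u \<in> L" "v - w = T u" by (rule imageE) simp
    show ?short
    proof (rule ccontr)
      assume short: "\<not> ?short"
      have uT: "u \<notin> T ` L"
      proof
        assume "u \<in> T ` L"
        then obtain u' where "u' \<in> L" "v - w = T (T u')" unfolding u(2) by (rule imageE) simp
        then have "\<exists>y\<in>L. v - w = 2 *\<^sub>R y" using T2(2)[of u'] by simp
        moreover have "w \<bullet> w \<le> 2 * \<mu> - 2" using w(2) \<mu> by argo
        ultimately show False using short w(1) by metis
      qed
      obtain B where B: "B \<subseteq> {w \<in> L. u - w \<in> T ` L \<and> w \<bullet> w = \<mu>}" "finite B" "card B = DIM('a)"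
        and expand: "\<And>x. x = (\<Sum>b\<in>B. (x \<bullet> b / \<mu>) *\<^sub>R b)" "\<And>x. (\<Sum>b\<in>B. (x \<bullet> b)\<^sup>2) = \<mu> * (x \<bullet> x)"
        using frame_orthogonal_basis[OF u(1) uT] by blast
      \<comment> \<open>\<open>w'\<close> need not lie in \<open>L\<close>; it turns products with
        \<open>T b\<close> into products with the orthogonal basis \<open>B\<close>.\<close>
      obtain w' where w': "w = T w'" using T_surj by blast
      have w'w: "w' \<bullet> w' = \<mu> / 2" using T(2)[of w'] w(2) w' by simp
      have "\<exists>k::int. w \<bullet> T b = of_int k" if "b \<in> B" for b
        using that B(1) w(1) TL integral_inner by blast
      then obtain k :: "'a \<Rightarrow> int" where k: "\<And>b. b \<in> B \<Longrightarrow> w \<bullet> T b = of_int (k b)" by metis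
      have kw': "w' \<bullet> b = of_int (k b) / 2" if "b \<in> B" for b
        using k[OF that] unfolding w' T_inner by simp
      have "(\<Sum>b\<in>B. (of_int (k b))\<^sup>2) = (\<Sum>b\<in>B. 4 * (w' \<bullet> b)\<^sup>2)"
        by (intro sum.cong) (auto simp: kw' power_divide)
      also have "\<dots> = 2 * \<mu>\<^sup>2"
        unfolding sum_distrib_left[symmetric] expand(2) w'w by (simp add: power2_eq_square)
      finally have ksum: "(\<Sum>b\<in>B. (of_int (k b))\<^sup>2) = 2 * \<mu>\<^sup>2" .
      have "T w' = (\<Sum>b\<in>B. (w' \<bullet> b / \<mu>) *\<^sub>R T b)"
        by (subst expand(1)[of w']) (simp add: linear_sum[OF T(1)] linear_scale[OF T(1)])
      then have wexp: "w = (\<Sum>b\<in>B. (of_int (k b) / (2 * \<mu>)) *\<^sub>R T b)"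
        unfolding w'[symmetric] by (simp add: kw' cong: sum.cong)
      have plus: "w + T b \<in> L" "\<exists>y\<in>L. v - (w + T b) = 2 *\<^sub>R y" if "b \<in> B" for b
      proof -
        have b: "b \<in> L" "u - b \<in> T ` L" using that B(1) by auto
        show "w + T b \<in> L" using b w(1) TL L_closed(4) by blast
        have "v - (w + T b) = T (u - b)" using u(2) by (simp add: linear_diff[OF T(1)] algebra_simps)
        then show "\<exists>y\<in>L. v - (w + T b) = 2 *\<^sub>R y" using b T2(2) by auto
      qed
      have minus: "w - T b \<in> L" "\<exists>y\<in>L. v - (w - T b) = 2 *\<^sub>R y" if "b \<in> B" for b
      proof -
        have b: "b \<in> L" using that B(1) by auto
        show "w - T b \<in> L" using b w(1) TL L_closed(2) by blast
        from plus(2)[OF that] obtain y where y: "y \<in> L" "v - (w + T b) = 2 *\<^sub>R y" ..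
        have "v - (w - T b) = v - (w + T b) + 2 *\<^sub>R T b" by (simp add: scaleR_2)
        also have "\<dots> = 2 *\<^sub>R (y + T b)" using y by (simp add: scaleR_add_right)
        finally show "\<exists>y\<in>L. v - (w - T b) = 2 *\<^sub>R y" using y(1) b TL L_closed(4) by blast
      qed
      have bb: "b \<bullet> b = \<mu>" if "b \<in> B" for b using that B(1) by auto
      \<comment> \<open>One of the vectors \<open>w + T b\<close>, \<open>w - T b\<close> has
        squared norm \<open>3 \<mu> - 2 \<bar>k b\<bar>\<close>, which must exceed
        \<open>2 \<mu> - 2\<close>.\<close>
      have k_lt: "\<bar>of_int (k b)\<bar> < (\<mu> + 2) / 2" if "b \<in> B" for b
      proof -
        have "\<not> (w + T b) \<bullet> (w + T b) \<le> 2 * \<mu> - 2" "\<not> (w - T b) \<bullet> (w - T b) \<le> 2 * \<mu> - 2"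
          using short plus[OF that] minus[OF that] by blast+
        then show ?thesis
          using k[OF that] w(2) bb[OF that] T(2)[of b] by (auto simp: inner_simps inner_commute abs_if)
      qed
      have k_parity: "even (k b - k c)" if "b \<in> B" "c \<in> B" for b c
      proof -
        have "b - c \<in> T ` L"
          using that B(1) additive_subgroupD(2)[OF TL_subgroup, of "u - c" "u - b"] by auto
        then obtain x where "x \<in> L" "b - c = T x" by (rule imageE) simp
        then obtain y where y: "y \<in> L" "T (b - c) = 2 *\<^sub>R y" using T2(2)[of x] by auto
        obtain j :: int where j: "w \<bullet> y = of_int j" using integral_inner w(1) y(1) by blast
        have "of_int (k b - k c) = w \<bullet> T (b - c)"
          using k that by (simp add: linear_diff[OF T(1)] inner_diff_right)
        also have "\<dots> = of_int (2 * j)" using y(2) j by simp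
        finally have "k b - k c = 2 * j" by (simp only: of_int_eq_iff)
        then show ?thesis by simp
      qed
      have k_val: "k b = 0 \<or> \<bar>of_int (k b)\<bar> = \<mu> / 2" if b: "b \<in> B" for b
        using \<mu>
      proof
        assume "\<mu> = 2"
        then have "of_int \<bar>k b\<bar> < (2::real)" using k_lt[OF b] by simp
        then have "k b = 0 \<or> \<bar>k b\<bar> = 1" by linarith
        then show ?thesis using \<open>\<mu> = 2\<close> by auto
      next
        assume m4: "\<mu> = 4 \<and> DIM('a) = 24"
        have k2: "\<bar>k c\<bar> \<le> 2" if "c \<in> B" for c
        proof -
          have "of_int \<bar>k c\<bar> < (3::real)" using k_lt[OF that] m4 by simp
          then show ?thesis by linarith
        qed
        \<comment> \<open>If one coordinate were odd, all 24 would be odd, hence 1 in absolute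
          value, and their squares would add up to 24 instead of 32.\<close>
        have "even (k b)"
        proof (rule ccontr)
          assume "odd (k b)"
          have "\<bar>k c\<bar> = 1" if "c \<in> B" for c
          proof -
            have "odd (k c)" using k_parity[OF b that] \<open>odd (k b)\<close> by simp
            then show ?thesis using k2[OF that] by presburger
          qed
          then have "(k c)\<^sup>2 = 1" if "c \<in> B" for c using that by (simp add: abs_square_eq_1)
          then have "(\<Sum>b\<in>B. (of_int (k b))\<^sup>2 :: real) = (\<Sum>b\<in>B. 1)"
            by (intro sum.cong refl) (metis of_int_1 of_int_power)
          then show False using ksum m4 B(3) by simp
        qed
        then have "k b = 0 \<or> \<bar>k b\<bar> = 2" using k2[OF b] by presburger
        then show ?thesis using m4 by auto
      qed
      define B' where "B' = {b \<in> B. k b \<noteq> 0}"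
      have "finite B'" using B(2) by (simp add: B'_def)
      have "2 * \<mu>\<^sup>2 = (\<Sum>b\<in>B'. (of_int (k b))\<^sup>2)"
        unfolding ksum[symmetric] B'_def by (rule sum.mono_neutral_right) (use B(2) in auto)
      also have "\<dots> = (\<Sum>b\<in>B'. (\<mu> / 2)\<^sup>2)"
        using k_val by (intro sum.cong refl) (metis (mono_tags, lifting) B'_def mem_Collect_eq power2_abs)
      also have "\<dots> = card B' * (\<mu>\<^sup>2 / 4)" by (simp add: power_divide)
      finally have cardB': "real (card B') = 8" using \<mu> by (auto simp: field_simps)
      \<comment> \<open>The factor \<open>k b * (2 / \<mu>)\<close> is the sign of
        \<open>k b\<close>, chosen such that the squared norm becomes
        \<open>3 \<mu> - \<mu> = 2 \<mu>\<close>.\<close>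
      define z where "z b = w - (of_int (k b) * (2 / \<mu>)) *\<^sub>R T b" for b
      have zZ: "z b \<in> ?Z" if "b \<in> B'" for b
      proof -
        have b: "b \<in> B" "k b \<noteq> 0" using that by (auto simp: B'_def)
        have mu0: "\<mu> > 0" using \<mu> by auto
        have "of_int (k b) = \<mu> / 2 \<or> of_int (k b) = - \<mu> / 2"
          using k_val[OF b(1)] b(2) by (auto simp: abs_if split: if_splits)
        then show ?thesis
        proof
          assume kb: "of_int (k b) = \<mu> / 2"
          then have "z b = w - T b" using mu0 by (simp add: z_def)
          then show ?thesis
            using minus[OF b(1)] k[OF b(1)] kb w(2) bb[OF b(1)] T(2)[of b]
            by (simp add: inner_simps inner_commute)
        next
          assume kb: "of_int (k b) = - \<mu> / 2"
          then have "z b = w + T b" using mu0 by (simp add: z_def)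
          then show ?thesis
            using plus[OF b(1)] k[OF b(1)] kb w(2) bb[OF b(1)] T(2)[of b]
            by (simp add: inner_simps inner_commute)
        qed
      qed
      have "(\<Sum>b\<in>B'. (of_int (k b) / (2 * \<mu>)) *\<^sub>R T b) = w"
        by (rule trans[OF sum.mono_neutral_left wexp[symmetric]]) (use B(2) in \<open>auto simp: B'_def\<close>)
      then have sB': "(\<Sum>b\<in>B'. (of_int (k b) * (2 / \<mu>)) *\<^sub>R T b) = 4 *\<^sub>R w"
        by (auto simp: scaleR_right.sum intro!: sum.cong)
      have "(\<Sum>b\<in>B'. z b) = 8 *\<^sub>R w - 4 *\<^sub>R w"
        unfolding z_def sum_subtractf sB' using cardB' by (simp add: sum_constant_scaleR)
      also have "\<dots> = 4 *\<^sub>R w" by (simp flip: scaleR_left_diff_distrib)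
      finally have "(1/4) *\<^sub>R (\<Sum>b\<in>B'. z b) = w" by simp
      moreover have "(1/4) *\<^sub>R (\<Sum>b\<in>B'. z b) \<in> span ?Z"
        by (intro span_scale span_sum span_base zZ)
      ultimately show False using w(3) by simp
    qed
  qed
qed

text \<open>The constant lies just below the required \<open>9/16\<close>. Contraction with
  representatives of squared norm at most \<open>2 \<mu>\<close> comes close to
  \<open>2/3 \<mu>\<close>, and one refined step that keeps the term
  \<open>\<bar>e \<bullet> w\<bar>\<close> suffices after that.\<close>

lemma covers_frame_lattice: "covers L (111/200 * \<mu>)"
proof -
  have mu: "2 \<le> \<mu>" "\<mu> \<le> 4" using \<mu> by auto
  \<comment> \<open>Averaging: by Parseval the squares \<open>(e \<bullet> z)\<^sup>2\<close> over
    an orthogonal frame sum to \<open>2 \<mu> (e \<bullet> e)\<close>, and the frame has at most 24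
    members.\<close>
  have spanning: "\<exists>z\<in>{z \<in> L. (\<exists>u\<in>L. v - z = 2 *\<^sub>R u) \<and> z \<bullet> z = 2 * \<mu>}. \<mu> * (e \<bullet> e) / 12 \<le> (e \<bullet> z)\<^sup>2"
    (is "\<exists>z\<in>?Z. _") if sp: "span {z \<in> L. (\<exists>u\<in>L. v - z = 2 *\<^sub>R u) \<and> z \<bullet> z = 2 * \<mu>} = UNIV" for v e
  proof (rule span_orthogonal_basis[OF sp, of "2 * \<mu>"])
    fix x y assume xy: "x \<in> ?Z" "y \<in> ?Z" "x \<noteq> y" "x \<noteq> - y"
    then obtain a b where ab: "a \<in> L" "b \<in> L" "v - x = 2 *\<^sub>R a" "v - y = 2 *\<^sub>R b" by blast
    have d: "x - y = 2 *\<^sub>R (b - a)" using ab by (simp add: scaleR_diff_right flip: ab(3,4))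
    have "x + y = (x - y) + 2 *\<^sub>R y" by (simp add: scaleR_2)
    then have s: "x + y = 2 *\<^sub>R (b - a + y)" unfolding d by (simp add: scaleR_add_right)
    have yL: "y \<in> L" using xy(2) by simp
    show "x \<bullet> y = 0"
    proof (rule inner_eq_0_in_coset[of "(\<lambda>x. 2 *\<^sub>R x) ` L" "2 * \<mu>"])
      show "2 * (2 * \<mu>) \<le> x \<bullet> x" if "x \<in> (\<lambda>x. 2 *\<^sub>R x) ` L" "x \<noteq> 0" for x
        using that min_norm by fastforce
      show "x - y \<in> (\<lambda>x. 2 *\<^sub>R x) ` L" unfolding d by (rule image_eqI[of _ "\<lambda>x. 2 *\<^sub>R x", OF refl]) (intro L_closed ab)
      show "x + y \<in> (\<lambda>x. 2 *\<^sub>R x) ` L" unfolding s by (rule image_eqI[of _ "\<lambda>x. 2 *\<^sub>R x", OF refl]) (intro L_closed ab yL)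
    qed (use xy in simp_all)
  next
    fix B assume B: "B \<subseteq> ?Z" "finite B" "card B = DIM('a)" "\<And>x. (\<Sum>b\<in>B. (x \<bullet> b)\<^sup>2) = 2 * \<mu> * (x \<bullet> x)"
    show ?thesis
    proof (rule ccontr)
      assume "\<not> ?thesis"
      then have lt: "(e \<bullet> b)\<^sup>2 < \<mu> * (e \<bullet> e) / 12" if "b \<in> B" for b
        using that B(1) by (meson linorder_not_less subsetD)
      have "B \<noteq> {}" using B(3) by auto
      then have "(\<Sum>b\<in>B. (e \<bullet> b)\<^sup>2) < (\<Sum>b\<in>B. \<mu> * (e \<bullet> e) / 12)"
        by (intro sum_strict_mono B(2) lt) auto
      also have "\<dots> = DIM('a) * (\<mu> * (e \<bullet> e) / 12)" using B(3) by simp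
      also have "\<dots> \<le> 24 * (\<mu> * (e \<bullet> e) / 12)"
        using dim_le mu by (intro mult_right_mono) auto
      finally show False unfolding B(4) by simp
    qed
  qed (use mu in simp_all)
  have cls: "\<exists>w\<in>L. (\<exists>u\<in>L. v - w = 2 *\<^sub>R u) \<and> w \<bullet> w \<le> 2 * \<mu>" if v: "v \<in> L" for v
    using class_mod_two[OF v]
  proof
    assume "span {z \<in> L. (\<exists>u\<in>L. v - z = 2 *\<^sub>R u) \<and> z \<bullet> z = 2 * \<mu>} = UNIV"
    from spanning[OF this, of 0] show ?thesis by auto
  next
    assume "\<exists>w\<in>L. (\<exists>u\<in>L. v - w = 2 *\<^sub>R u) \<and> w \<bullet> w \<le> 2 * \<mu> - 2"
    then obtain w where w: "w \<in> L" "\<exists>u\<in>L. v - w = 2 *\<^sub>R u" "w \<bullet> w \<le> 2 * \<mu> - 2" by blast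
    then have "w \<bullet> w \<le> 2 * \<mu>" by linarith
    with w show ?thesis by blast
  qed
  \<comment> \<open>\<open>27/40\<close> is slightly more than the fixed point
    \<open>2/3\<close>.\<close>
  have "covers L (27/40 * \<mu>)"
    using covers_of_short_classes[OF L span_L cls, of "27/40 * \<mu>"] mu by simp
  then show ?thesis
  proof (rule half_lattice_step[OF L])
    fix v e :: 'a
    assume v: "v \<in> L" and e: "e \<bullet> e \<le> 27/40 * \<mu> / 4"
    from class_mod_two[OF v]
    show "\<exists>w\<in>L. (\<exists>u\<in>L. v - w = 2 *\<^sub>R u) \<and> e \<bullet> e - \<bar>e \<bullet> w\<bar> + w \<bullet> w / 4 \<le> 111/200 * \<mu>"
    proof
      assume "\<exists>w\<in>L. (\<exists>u\<in>L. v - w = 2 *\<^sub>R u) \<and> w \<bullet> w \<le> 2 * \<mu> - 2"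
      then obtain w where w: "w \<in> L" "\<exists>u\<in>L. v - w = 2 *\<^sub>R u" "w \<bullet> w \<le> 2 * \<mu> - 2" by blast
      have "e \<bullet> e - \<bar>e \<bullet> w\<bar> + w \<bullet> w / 4 \<le> 111/200 * \<mu>"
        using e w(3) mu by linarith
      with w show ?thesis by blast
    next
      assume "span {z \<in> L. (\<exists>u\<in>L. v - z = 2 *\<^sub>R u) \<and> z \<bullet> z = 2 * \<mu>} = UNIV"
      from spanning[OF this, of e] obtain z
        where z0: "z \<in> {z \<in> L. (\<exists>u\<in>L. v - z = 2 *\<^sub>R u) \<and> z \<bullet> z = 2 * \<mu>}"
          and z4: "\<mu> * (e \<bullet> e) / 12 \<le> (e \<bullet> z)\<^sup>2" ..
      from z0 have z: "z \<in> L \<and> (\<exists>u\<in>L. v - z = 2 *\<^sub>R u) \<and> z \<bullet> z = 2 * \<mu>"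
        by (rule CollectD)
      define t where "t = e \<bullet> e"
      have "t - 11/200 * \<mu> \<le> \<bar>e \<bullet> z\<bar>"
      proof (rule ccontr)
        assume *: "\<not> ?thesis"
        then have "\<bar>e \<bullet> z\<bar>\<^sup>2 < (t - 11/200 * \<mu>)\<^sup>2" by (intro power_strict_mono) auto
        then have "\<mu> * t / 12 < (t - 11/200 * \<mu>)\<^sup>2" using z4 by (simp add: t_def)
        moreover have t: "11/200 * \<mu> \<le> t" "t \<le> 27/160 * \<mu>" using * e by (auto simp: t_def)
        \<comment> \<open>On the interval from \<open>11/200 \<mu>\<close> to
          \<open>27/160 \<mu>\<close> the square lies below its chord of slope
          \<open>91/800 \<mu>\<close>, and the chord lies below
          \<open>\<mu> * t / 12\<close>.\<close>
        then have "(t - 11/200 * \<mu>) * (t - 27/160 * \<mu>) \<le> 0" by (intro mult_nonneg_nonpos) auto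
        moreover have "\<mu> * (91/800 * (t - 11/200 * \<mu>)) \<le> \<mu> * (t / 12)"
          using t mu by (intro mult_left_mono) auto
        moreover have "(t - 11/200 * \<mu>)\<^sup>2 =
            (t - 11/200 * \<mu>) * (t - 27/160 * \<mu>) + \<mu> * (91/800 * (t - 11/200 * \<mu>))"
          by (simp add: power2_eq_square field_simps)
        ultimately show False by simp
      qed
      then have "e \<bullet> e - \<bar>e \<bullet> z\<bar> + z \<bullet> z / 4 \<le> 111/200 * \<mu>"
        using conjunct2[OF conjunct2[OF z]] by (simp add: t_def)
      with z show ?thesis by (intro bexI[of _ z]) auto
    qed
  qed
qed

end

section \<open>Eisenstein lattices in dimensions 2 and 6\<close>

definition \<omega> :: complex where "\<omega> = Complex (- 1 / 2) (sqrt 3 / 2)"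

lemma \<omega>_sq: "\<omega> * \<omega> = - \<omega> - 1"
  by (simp add: \<omega>_def complex_eq_iff field_simps)

lemma norm_\<omega>: "norm \<omega> = 1"
  by (simp add: \<omega>_def cmod_def power_divide)

definition eis :: "int \<Rightarrow> int \<Rightarrow> complex" where
  "eis a b = of_int a + of_int b * \<omega>"

definition eis_norm :: "int \<Rightarrow> int \<Rightarrow> int" where
  "eis_norm a b = a * a - a * b + b * b"

lemma eis_inner: "eis a b \<bullet> eis a b = of_int (eis_norm a b)"
  by (simp add: eis_def eis_norm_def \<omega>_def inner_complex_def field_simps)

lemma eis_diff: "eis a b - eis c d = eis (a - c) (b - d)"
  by (simp add: eis_def algebra_simps)

lemma eis_double: "eis (2 * a) (2 * b) = 2 *\<^sub>R eis a b"
  by (simp add: eis_def scaleR_conv_of_real algebra_simps)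

lemma \<omega>_eis: "\<omega> * eis a b = eis (- b) (a - b)"
proof -
  have "\<omega> * eis a b = of_int a * \<omega> + of_int b * (\<omega> * \<omega>)" by (simp add: eis_def algebra_simps)
  then show ?thesis unfolding \<omega>_sq by (simp add: eis_def algebra_simps)
qed

lemma eis_norm_nonneg: "0 \<le> eis_norm a b"
proof -
  \<comment> \<open>This sum of squares is \<open>2 * eis_norm a b\<close>.\<close>
  have "0 \<le> (a - b) * (a - b) + a * a + b * b" by simp
  then show ?thesis by (simp add: eis_norm_def algebra_simps)
qed

lemma eis_norm_eq_0: "eis_norm a b = 0 \<longleftrightarrow> a = 0 \<and> b = 0"
proof
  assume "eis_norm a b = 0"
  then have "(a - b)\<^sup>2 + a\<^sup>2 + b\<^sup>2 = 0" by (simp add: eis_norm_def power2_eq_square algebra_simps)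
  then show "a = 0 \<and> b = 0"
    by (smt (verit) zero_le_power2 power2_eq_iff_nonneg zero_eq_power2)
qed (simp add: eis_norm_def)

lemma eis_0: "eis 0 0 = 0"
  by (simp add: eis_def)

lemma complex_eis: "\<exists>x y :: real. z = x *\<^sub>R eis 1 0 + y *\<^sub>R eis 0 1"
  by (rule exI[of _ "Re z + Im z / sqrt 3"], rule exI[of _ "2 * Im z / sqrt 3"])
    (simp add: complex_eq_iff eis_def \<omega>_def)

text \<open>In the hexagonal lattice, reducing both coordinates modulo 2 leaves norm at most 1, so
  every \<open>q\<close> above \<open>1/3\<close> is a covering bound; \<open>1/2\<close> is still
  below \<open>9/16\<close>.\<close>

theorem complex_coloring: "\<exists>c. unit_distance_coloring (UNIV :: complex set) (7 ^ 1) c"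
proof -
  define L where "L = {eis a b | a b. True}"
  have L: "additive_subgroup L"
    unfolding additive_subgroup_def L_def using eis_0[symmetric] by (fastforce simp: eis_diff)
  have span: "span L = UNIV"
  proof -
    have "z \<in> span L" for z
    proof -
      obtain x y where "z = x *\<^sub>R eis 1 0 + y *\<^sub>R eis 0 1" using complex_eis by blast
      moreover have "eis 1 0 \<in> L" "eis 0 1 \<in> L" by (auto simp: L_def)
      ultimately show ?thesis by (simp add: span_add span_scale span_base)
    qed
    then show ?thesis by blast
  qed
  have "covers L (1 / 2)"
  proof (rule covers_of_short_classes[OF L span])
    fix v assume "v \<in> L"
    then obtain a b where v: "v = eis a b" by (auto simp: L_def)
    have "v - eis (a mod 2) (b mod 2) = 2 *\<^sub>R eis (a div 2) (b div 2)"
      unfolding v eis_diff minus_mod_eq_mult_div eis_double ..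
    moreover have "eis_norm (a mod 2) (b mod 2) \<le> 1"
    proof -
      have "a mod 2 = 0 \<or> a mod 2 = 1" "b mod 2 = 0 \<or> b mod 2 = 1" by presburger+
      then show ?thesis by (auto simp: eis_norm_def)
    qed
    ultimately show "\<exists>w\<in>L. (\<exists>u\<in>L. v - w = 2 *\<^sub>R u) \<and> w \<bullet> w \<le> 1"
      by (intro bexI[of _ "eis (a mod 2) (b mod 2)"]) (auto simp: L_def eis_inner)
  qed simp
  show ?thesis
  proof (rule lattice_coloring[of L "\<lambda>z. \<omega> * z" 1 "\<lambda>_. 1" 1 "1/2"])
    show "linear ((*) \<omega>)" by (rule linear_times)
    show "\<omega> * (\<omega> * x) + \<omega> * x + x = 0" for x
      unfolding mult.assoc[symmetric] \<omega>_sq by (simp add: algebra_simps)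
    show "norm (\<omega> * x) = norm x" for x by (simp add: norm_mult norm_\<omega>)
    show "\<omega> * x \<in> L" if "x \<in> L" for x using that unfolding L_def mem_Collect_eq by (metis \<omega>_eis)
    have "eis 1 0 = 1" by (simp add: eis_def)
    then show "1 \<in> L" unfolding L_def by (metis (mono_tags, lifting) mem_Collect_eq)
    show "\<exists>a b. l = (\<Sum>k<(1::nat). of_int (a k) *\<^sub>R 1 + of_int (b k) *\<^sub>R (\<omega> * 1))" if "l \<in> L" for l
    proof -
      from that obtain a b where "l = eis a b" by (auto simp: L_def)
      then have "l = (\<Sum>k<(1::nat). of_int a *\<^sub>R 1 + of_int b *\<^sub>R (\<omega> * 1))"
        by (simp add: eis_def scaleR_conv_of_real)
      then show ?thesis by (rule exI[where x = "\<lambda>_. a", OF exI[where x = "\<lambda>_. b"]])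
    qed
    show "1 \<le> l \<bullet> l" if "l \<in> L" "l \<noteq> 0" for l
    proof -
      from that obtain a b where l: "l = eis a b" by (auto simp: L_def)
      then have "eis_norm a b \<noteq> 0" using that eis_norm_eq_0 eis_0 by auto
      then show ?thesis unfolding l eis_inner using eis_norm_nonneg[of a b] by simp
    qed
    show "\<exists>l\<in>L. (x - l) \<bullet> (x - l) \<le> 1/2" for x
      using \<open>covers L (1/2)\<close> unfolding covers_def by blast
  qed (use L in simp_all)
qed

text \<open>\<open>\<theta> = 1 + 2 \<omega>\<close> divides \<open>a + b \<omega>\<close> iff \<open>3\<close> divides \<open>a + b\<close>, so the lattice below consists of the
  triples of Eisenstein integers whose sum is divisible by \<open>\<theta>\<close>; it is a scaled copy of the dual of \<open>E\<^sub>6\<close>.\<close>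

definition eis3 :: "int \<Rightarrow> int \<Rightarrow> int \<Rightarrow> int \<Rightarrow> int \<Rightarrow> int \<Rightarrow> complex \<times> complex \<times> complex" where
  "eis3 a b c d e f = (eis a b, eis c d, eis e f)"

definition E6_dual :: "(complex \<times> complex \<times> complex) set" where
  "E6_dual = {eis3 a b c d e f | a b c d e f. 3 dvd a + b + c + d + e + f}"

lemma eis3_inner:
  "eis3 a b c d e f \<bullet> eis3 a b c d e f = of_int (eis_norm a b + eis_norm c d + eis_norm e f)"
  by (simp add: eis3_def inner_prod_def eis_inner)

text \<open>The nonzero parity classes are represented by \<open>1\<close>, \<open>\<omega>\<close>
  and \<open>\<omega> * \<omega>\<close>, all congruent to 1 modulo \<open>1 + 2 \<omega>\<close>.
  This common residue allows sums to be corrected by signs alone.\<close>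

lemma eis_short_rep:
  obtains p q where "even (a - p)" "even (b - q)" "p = 0 \<and> q = 0 \<or> eis_norm p q = 1 \<and> 3 dvd p + q - 1"
proof -
  have "\<exists>p q. even (a - p) \<and> even (b - q) \<and> (p = 0 \<and> q = 0 \<or> eis_norm p q = 1 \<and> 3 dvd p + q - 1)"
  proof (cases "even a"; cases "even b")
    assume "even a" "even b"
    then show ?thesis by (intro exI[of _ 0]) auto
  next
    assume "even a" "odd b"
    then show ?thesis by (intro exI[of _ 0] exI[of _ 1]) (auto simp: eis_norm_def)
  next
    assume "odd a" "even b"
    then show ?thesis by (intro exI[of _ 1] exI[of _ 0]) (auto simp: eis_norm_def)
  next
    assume "odd a" "odd b"
    then show ?thesis by (intro exI[of _ "- 1"] exI[of _ "- 1"]) (auto simp: eis_norm_def)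
  qed
  then show thesis using that by blast
qed

lemma eis_norm_minus: "eis_norm (- p) (- q) = eis_norm p q"
  by (simp add: eis_norm_def)

text \<open>The pair on the left is the product of \<open>p + q \<omega>\<close> with
  \<open>\<theta> = 1 + 2 \<omega>\<close>, which has norm 3.\<close>

lemma eis_norm_\<theta>: "eis_norm (p - 2 * q) (2 * p - q) = 3 * eis_norm p q"
  by (simp add: eis_norm_def algebra_simps)

text \<open>Short representatives of the classes modulo \<open>2\<close>: units congruent to \<open>1\<close> modulo \<open>\<theta>\<close> are combined
  with signs so that their sum is divisible by \<open>\<theta>\<close>; a single unit is replaced by its product with
  \<open>\<theta> \<equiv> 1\<close> modulo \<open>2\<close>.\<close>

lemma E6_dual_short_rep:
  "\<exists>a' b' c' d' e' f'. even (a - a') \<and> even (b - b') \<and> even (c - c') \<and> even (d - d') \<and> even (e - e') \<and>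
    even (f - f') \<and> 3 dvd a' + b' + c' + d' + e' + f' \<and> eis_norm a' b' + eis_norm c' d' + eis_norm e' f' \<le> 3"
    (is "\<exists>a' b' c' d' e' f'. ?P a' b' c' d' e' f'")
proof -
  obtain p q where A: "even (a - p)" "even (b - q)" "p = 0 \<and> q = 0 \<or> eis_norm p q = 1 \<and> 3 dvd p + q - 1"
    by (rule eis_short_rep)
  obtain r s where B: "even (c - r)" "even (d - s)" "r = 0 \<and> s = 0 \<or> eis_norm r s = 1 \<and> 3 dvd r + s - 1"
    by (rule eis_short_rep)
  obtain t u where C: "even (e - t)" "even (f - u)" "t = 0 \<and> u = 0 \<or> eis_norm t u = 1 \<and> 3 dvd t + u - 1"
    by (rule eis_short_rep)
  note ev = A(1,2) B(1,2) C(1,2)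
  have z: "eis_norm 0 0 = 0" by (simp add: eis_norm_def)
  from A(3) B(3) C(3) show ?thesis
  proof (elim disjE)
    assume "p = 0 \<and> q = 0" "r = 0 \<and> s = 0" "t = 0 \<and> u = 0"
    then have "?P 0 0 0 0 0 0"
      using ev by (simp add: z)
    then show ?thesis by blast
  next
    assume "p = 0 \<and> q = 0" "r = 0 \<and> s = 0" "eis_norm t u = 1 \<and> 3 dvd t + u - 1"
    moreover from this have "3 dvd t - 2 * u + (2 * t - u)" by presburger
    ultimately have "?P 0 0 0 0 (t - 2 * u) (2 * t - u)"
      using ev by (simp add: z eis_norm_\<theta> eis_norm_minus)
    then show ?thesis by blast
  next
    assume "p = 0 \<and> q = 0" "eis_norm r s = 1 \<and> 3 dvd r + s - 1" "t = 0 \<and> u = 0"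
    moreover from this have "3 dvd r - 2 * s + (2 * r - s)" by presburger
    ultimately have "?P 0 0 (r - 2 * s) (2 * r - s) 0 0"
      using ev by (simp add: z eis_norm_\<theta> eis_norm_minus)
    then show ?thesis by blast
  next
    assume "eis_norm p q = 1 \<and> 3 dvd p + q - 1" "r = 0 \<and> s = 0" "t = 0 \<and> u = 0"
    moreover from this have "3 dvd p - 2 * q + (2 * p - q)" by presburger
    ultimately have "?P (p - 2 * q) (2 * p - q) 0 0 0 0"
      using ev by (simp add: z eis_norm_\<theta> eis_norm_minus)
    then show ?thesis by blast
  next
    assume "p = 0 \<and> q = 0" "eis_norm r s = 1 \<and> 3 dvd r + s - 1" "eis_norm t u = 1 \<and> 3 dvd t + u - 1"
    moreover from this have "3 dvd r + s - t - u" by presburger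
    ultimately have "?P 0 0 r s (- t) (- u)"
      using ev by (simp add: z eis_norm_\<theta> eis_norm_minus)
    then show ?thesis by blast
  next
    assume "eis_norm p q = 1 \<and> 3 dvd p + q - 1" "r = 0 \<and> s = 0" "eis_norm t u = 1 \<and> 3 dvd t + u - 1"
    moreover from this have "3 dvd p + q - t - u" by presburger
    ultimately have "?P p q 0 0 (- t) (- u)"
      using ev by (simp add: z eis_norm_\<theta> eis_norm_minus)
    then show ?thesis by blast
  next
    assume "eis_norm p q = 1 \<and> 3 dvd p + q - 1" "eis_norm r s = 1 \<and> 3 dvd r + s - 1" "t = 0 \<and> u = 0"
    moreover from this have "3 dvd p + q - r - s" by presburger
    ultimately have "?P p q (- r) (- s) 0 0"
      using ev by (simp add: z eis_norm_\<theta> eis_norm_minus)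
    then show ?thesis by blast
  next
    assume "eis_norm p q = 1 \<and> 3 dvd p + q - 1" "eis_norm r s = 1 \<and> 3 dvd r + s - 1" "eis_norm t u = 1 \<and> 3 dvd t + u - 1"
    moreover from this have "3 dvd p + q + r + s + t + u" by presburger
    ultimately have "?P p q r s t u"
      using ev by (simp add: z eis_norm_\<theta> eis_norm_minus)
    then show ?thesis by blast
  qed
qed

lemma eis3_diff: "eis3 a b c d e f - eis3 a' b' c' d' e' f' = eis3 (a - a') (b - b') (c - c') (d - d') (e - e') (f - f')"
  by (simp add: eis3_def eis_diff)

lemma eis3_double: "eis3 (2 * a) (2 * b) (2 * c) (2 * d) (2 * e) (2 * f) = 2 *\<^sub>R eis3 a b c d e f"
  by (simp add: eis3_def eis_double)

lemma E6_dualE: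
  assumes "v \<in> E6_dual"
  obtains a b c d e f where "v = eis3 a b c d e f" "3 dvd a + b + c + d + e + f"
  using assms unfolding E6_dual_def by blast

lemma E6_dualI: "3 dvd a + b + c + d + e + f \<Longrightarrow> eis3 a b c d e f \<in> E6_dual"
  unfolding E6_dual_def by blast

lemma E6_dual_subgroup: "additive_subgroup E6_dual"
  unfolding additive_subgroup_def
proof (intro conjI ballI)
  have "eis3 0 0 0 0 0 0 \<in> E6_dual" by (rule E6_dualI) simp
  then show "0 \<in> E6_dual" by (simp add: eis3_def eis_0 zero_prod_def)
  fix x y assume "x \<in> E6_dual" "y \<in> E6_dual"
  then obtain a b c d e f a' b' c' d' e' f' where xy: "x = eis3 a b c d e f" "y = eis3 a' b' c' d' e' f'"
    and dvd: "3 dvd a + b + c + d + e + f" "3 dvd a' + b' + c' + d' + e' + f'"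
    by (metis E6_dualE)
  have "3 dvd (a - a') + (b - b') + (c - c') + (d - d') + (e - e') + (f - f')"
    using dvd_diff[OF dvd] by (simp add: algebra_simps)
  then show "x - y \<in> E6_dual" unfolding xy eis3_diff by (rule E6_dualI)
qed

lemma E6_dual_span: "span E6_dual = UNIV"
proof -
  have "v \<in> span E6_dual" for v :: "complex \<times> complex \<times> complex"
  proof -
    obtain x y z where v: "v = (x, y, z)" by (cases v) auto
    obtain a b where x: "x = a *\<^sub>R eis 1 0 + b *\<^sub>R eis 0 1" using complex_eis by blast
    obtain c d where y: "y = c *\<^sub>R eis 1 0 + d *\<^sub>R eis 0 1" using complex_eis by blast
    obtain e f where z: "z = e *\<^sub>R eis 1 0 + f *\<^sub>R eis 0 1" using complex_eis by blast
    have "v = (a / 3) *\<^sub>R eis3 3 0 0 0 0 0 + (b / 3) *\<^sub>R eis3 0 3 0 0 0 0 + (c / 3) *\<^sub>R eis3 0 0 3 0 0 0 +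
        (d / 3) *\<^sub>R eis3 0 0 0 3 0 0 + (e / 3) *\<^sub>R eis3 0 0 0 0 3 0 + (f / 3) *\<^sub>R eis3 0 0 0 0 0 3"
      unfolding v x y z by (simp add: eis3_def eis_def scaleR_conv_of_real)
    also have "\<dots> \<in> span E6_dual"
      by (intro span_add span_scale span_base E6_dualI) simp_all
    finally show ?thesis .
  qed
  then show ?thesis by blast
qed

text \<open>A vector of norm 1 would have a single unit as its only nonzero entry, but
  \<open>(p + q) * (p + q)\<close> is congruent to \<open>eis_norm p q\<close> modulo 3, so its
  coordinate sum is not divisible by 3.\<close>

lemma E6_dual_min: "v \<in> E6_dual \<Longrightarrow> v \<noteq> 0 \<Longrightarrow> 2 \<le> v \<bullet> v"
proof (rule ccontr)
  assume "v \<in> E6_dual" "v \<noteq> 0" and lt: "\<not> 2 \<le> v \<bullet> v"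
  then obtain a b c d e f where v: "v = eis3 a b c d e f" and dvd: "3 dvd a + b + c + d + e + f"
    by (metis E6_dualE)
  have le: "eis_norm a b + eis_norm c d + eis_norm e f < 2"
    using lt unfolding v eis3_inner by simp
  note nn = eis_norm_nonneg[of a b] eis_norm_nonneg[of c d] eis_norm_nonneg[of e f]
  have "\<not> (eis_norm a b = 0 \<and> eis_norm c d = 0 \<and> eis_norm e f = 0)"
    using \<open>v \<noteq> 0\<close> unfolding v eis_norm_eq_0 by (auto simp: eis3_def eis_0 zero_prod_def)
  then have one: "eis_norm a b + eis_norm c d + eis_norm e f = 1" using le nn by linarith
  have no: "\<not> 3 dvd p + q" if "eis_norm p q = 1" for p q
  proof
    assume "3 dvd p + q"
    then have "3 dvd (p + q) * (p + q) - 3 * (p * q)" by (intro dvd_diff dvd_mult dvd_triv_left)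
    also have "(p + q) * (p + q) - 3 * (p * q) = eis_norm p q" by (simp add: eis_norm_def algebra_simps)
    finally show False using that by simp
  qed
  consider "eis_norm a b = 1" "eis_norm c d = 0" "eis_norm e f = 0"
    | "eis_norm a b = 0" "eis_norm c d = 1" "eis_norm e f = 0"
    | "eis_norm a b = 0" "eis_norm c d = 0" "eis_norm e f = 1"
    using one nn by linarith
  then show False
    by cases (use dvd no in \<open>auto simp: eis_norm_eq_0\<close>)
qed

text \<open>Representatives of norm at most 3 give every bound above 1, and \<open>11/10\<close> is
  below \<open>9/16 * 2\<close>.\<close>

lemma E6_dual_covers: "covers E6_dual (11 / 10)"
proof (rule covers_of_short_classes[OF E6_dual_subgroup E6_dual_span])
  fix v assume "v \<in> E6_dual"
  then obtain a b c d e f where v: "v = eis3 a b c d e f" and dvd: "3 dvd a + b + c + d + e + f"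
    by (metis E6_dualE)
  from E6_dual_short_rep[of a b c d e f] obtain a' b' c' d' e' f'
    where ev: "even (a - a')" "even (b - b')" "even (c - c')" "even (d - d')" "even (e - e')" "even (f - f')"
      and dvd': "3 dvd a' + b' + c' + d' + e' + f'"
      and le: "eis_norm a' b' + eis_norm c' d' + eis_norm e' f' \<le> 3" by metis
  obtain p q r s t u where p: "a - a' = 2 * p" "b - b' = 2 * q" "c - c' = 2 * r" "d - d' = 2 * s"
      "e - e' = 2 * t" "f - f' = 2 * u"
    using ev by (metis dvdE)
  \<comment> \<open>The halved difference stays in the lattice because 2 is invertible modulo
    3.\<close>
  have "(a + b + c + d + e + f) - (a' + b' + c' + d' + e' + f') = 2 * (p + q + r + s + t + u)"
    using p by simp
  then have "3 dvd 2 * (p + q + r + s + t + u)" using dvd_diff[OF dvd dvd'] by simp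
  then have dvd2: "3 dvd p + q + r + s + t + u" by presburger
  have "v - eis3 a' b' c' d' e' f' = 2 *\<^sub>R eis3 p q r s t u"
    unfolding v eis3_diff p eis3_double ..
  moreover have "eis3 a' b' c' d' e' f' \<bullet> eis3 a' b' c' d' e' f' \<le> 3"
    using le unfolding eis3_inner by (simp flip: of_int_add)
  ultimately show "\<exists>w\<in>E6_dual. (\<exists>u\<in>E6_dual. v - w = 2 *\<^sub>R u) \<and> w \<bullet> w \<le> 3"
    using E6_dualI[OF dvd'] E6_dualI[OF dvd2] by blast
qed simp

theorem complex3_coloring: "\<exists>c. unit_distance_coloring (UNIV :: (complex \<times> complex \<times> complex) set) (7 ^ 3) c"
proof -
  define w :: "complex \<times> complex \<times> complex \<Rightarrow> complex \<times> complex \<times> complex"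
    where "w = (\<lambda>(x, y, z). (\<omega> * x, \<omega> * y, \<omega> * z))"
  have w_eis: "w (eis3 a b c d e f) = eis3 (- b) (a - b) (- d) (c - d) (- f) (e - f)" for a b c d e f
    by (simp add: w_def eis3_def \<omega>_eis)
  \<comment> \<open>A basis over the Eisenstein integers: \<open>(1, -1, 0)\<close>,
    \<open>(0, 1, -1)\<close> and \<open>(0, 0, \<theta>)\<close>.\<close>
  define g where "g k = (if k = 0 then eis3 1 0 (- 1) 0 0 0 else if k = 1 then eis3 0 0 1 0 (- 1) 0
    else eis3 0 0 0 0 1 2)" for k :: nat
  show ?thesis
  proof (rule lattice_coloring[of E6_dual w 3 g 2 "11/10"])
    show "linear w"
      by (rule linearI) (auto simp: w_def algebra_simps)
    show "w (w x) + w x + x = 0" for x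
    proof -
      have "\<omega> * (\<omega> * y) + \<omega> * y + y = 0" for y
        unfolding mult.assoc[symmetric] \<omega>_sq by (simp add: algebra_simps)
      then show ?thesis by (cases x) (simp add: w_def zero_prod_def)
    qed
    show "norm (w x) = norm x" for x
      by (cases x) (simp add: w_def norm_Pair norm_mult norm_\<omega>)
    show "w x \<in> E6_dual" if "x \<in> E6_dual" for x
    proof -
      from that obtain a b c d e f where x: "x = eis3 a b c d e f" and dvd: "3 dvd a + b + c + d + e + f"
        by (metis E6_dualE)
      have "- b + (a - b) + - d + (c - d) + - f + (e - f) = (a + b + c + d + e + f) - 3 * (b + d + f)" by simp
      also have "3 dvd \<dots>" using dvd by (intro dvd_diff) auto
      finally show ?thesis unfolding x w_eis by (rule E6_dualI)
    qed
    show "g k \<in> E6_dual" for k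
      unfolding g_def by (auto intro!: E6_dualI)
    show "\<exists>\<alpha> \<beta>. l = (\<Sum>k<3. of_int (\<alpha> k) *\<^sub>R g k + of_int (\<beta> k) *\<^sub>R w (g k))" if "l \<in> E6_dual" for l
    proof -
      from that obtain a b c d e f where l: "l = eis3 a b c d e f" and dvd: "3 dvd a + b + c + d + e + f"
        by (metis E6_dualE)
      define p q where "p = a + c + e" and "q = b + d + f"
      have "3 dvd p + q" using dvd by (simp add: p_def q_def algebra_simps)
      then obtain j where j: "p = 3 * j - q" by (metis dvdE add_diff_cancel_right')
      then have e: "e = 3 * j - (b + d + f) - a - c" by (simp add: p_def q_def)
      \<comment> \<open>The first two coefficients are partial sums of the entries; the last,
        \<open>(q - j) + (q - 2 * j) \<omega>\<close>, is the quotient of the total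
        \<open>p + q \<omega>\<close> by \<open>\<theta>\<close>.\<close>
      define \<alpha> \<beta> where "\<alpha> k = (if k = 0 then a else if k = 1 then a + c else q - j)"
        and "\<beta> k = (if k = 0 then b else if k = 1 then b + d else q - 2 * j)" for k :: nat
      have sum3: "(\<Sum>k<3. F k) = F 0 + F 1 + F 2" for F :: "nat \<Rightarrow> complex \<times> complex \<times> complex"
        by (simp add: eval_nat_numeral)
      have "l = (\<Sum>k<3. of_int (\<alpha> k) *\<^sub>R g k + of_int (\<beta> k) *\<^sub>R w (g k))"
        unfolding sum3 l e \<alpha>_def \<beta>_def g_def q_def
        by (simp add: w_eis) (simp add: eis3_def eis_def scaleR_conv_of_real algebra_simps)
      then show ?thesis by blast
    qed
    show "\<exists>l\<in>E6_dual. (x - l) \<bullet> (x - l) \<le> 11/10" for x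
      using E6_dual_covers unfolding covers_def by blast
  qed (simp_all add: E6_dual_subgroup E6_dual_min)
qed

section \<open>Hurwitz quaternions\<close>

text \<open>\<open>Hz a b c d\<close> is \<open>a + b i + c j + d h\<close> with \<open>h = (1 + i + j + k) / 2\<close>.\<close>

datatype hz = Hz int int int int

instantiation hz :: ring_1
begin

fun plus_hz where "Hz a b c d + Hz p q r s = Hz (a + p) (b + q) (c + r) (d + s)"
fun minus_hz where "Hz a b c d - Hz p q r s = Hz (a - p) (b - q) (c - r) (d - s)"
fun uminus_hz where "- Hz a b c d = Hz (- a) (- b) (- c) (- d)"
definition "0 = Hz 0 0 0 0"
definition "1 = Hz 1 0 0 0"
fun times_hz where
  "Hz a b c d * Hz p q r s = Hz
    (a * p - b * q - b * r - b * s + c * q - c * r - d * r - d * s)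
    (a * q + b * p - b * r + c * q + c * s + d * q - d * r)
    (a * r - b * r - b * s + c * p + c * q + c * s + d * q)
    (a * s + 2 * b * r + b * s - 2 * c * q - c * s + d * p - d * q + d * r + d * s)"

instance
proof
  fix x y z :: hz
  show "x + y + z = x + (y + z)" "x + y = y + x" "0 + x = x" "- x + x = 0" "x - y = x + - y"
    by (cases x; cases y; cases z; simp add: zero_hz_def)+
  show "x * y * z = x * (y * z)"
    by (cases x; cases y; cases z; simp add: algebra_simps)
  show "(x + y) * z = x * z + y * z" "x * (y + z) = x * y + x * z" "1 * x = x" "x * 1 = x"
    by (cases x; cases y; cases z; simp add: one_hz_def algebra_simps)+
  show "(0::hz) \<noteq> 1" by (simp add: zero_hz_def one_hz_def)
qed

end

fun hcnj :: "hz \<Rightarrow> hz" where "hcnj (Hz a b c d) = Hz (a + d) (- b) (- c) (- d)"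
fun htrace :: "hz \<Rightarrow> int" where "htrace (Hz a b c d) = 2 * a + d"
fun hnorm :: "hz \<Rightarrow> int" where
  "hnorm (Hz a b c d) = a * a + b * b + c * c + d * d + a * d + b * d + c * d"

lemma of_int_hz: "of_int k = Hz k 0 0 0"
proof -
  have nat: "of_nat n = Hz (int n) 0 0 0" for n
    by (induction n) (auto simp: zero_hz_def one_hz_def)
  show ?thesis by (cases k rule: int_cases2) (auto simp: nat)
qed

lemma numeral_hz: "numeral k = Hz (numeral k) 0 0 0"
  using of_int_hz[of "numeral k"] by simp

lemma hcnj_mult: "hcnj (x * y) = hcnj y * hcnj x"
  by (cases x; cases y) (simp add: algebra_simps)

lemma hnorm_mult: "hnorm (x * y) = hnorm x * hnorm y"
  by (cases x; cases y) (simp add: algebra_simps)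

lemma hnorm_add: "hnorm (x + y) = hnorm x + hnorm y + htrace (x * hcnj y)"
  by (cases x; cases y) (simp add: algebra_simps)

lemma htrace_add: "htrace (x + y) = htrace x + htrace y"
  by (cases x; cases y) simp

lemma htrace_zero [simp]: "htrace 0 = 0"
  by (simp add: zero_hz_def)

lemma htrace_sum: "htrace (sum f S) = (\<Sum>k\<in>S. htrace (f k))"
  by (induction S rule: infinite_finite_induct) (auto simp: htrace_add)

text \<open>The four squares belong to the doubled coordinates with respect to
  \<open>1, i, j, k\<close>.\<close>

lemma four_hnorm: "4 * hnorm (Hz a b c d) = (2 * a + d)\<^sup>2 + (2 * b + d)\<^sup>2 + (2 * c + d)\<^sup>2 + d\<^sup>2"
  by (simp add: power2_eq_square algebra_simps)

lemma hnorm_nonneg: "hnorm x \<ge> 0"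
proof (cases x)
  case (Hz a b c d)
  have "0 \<le> 4 * hnorm x" unfolding Hz four_hnorm by simp
  then show ?thesis by simp
qed

lemma hnorm_eq_0: "hnorm x = 0 \<longleftrightarrow> x = 0"
proof (cases x)
  case (Hz a b c d)
  have "hnorm x = 0 \<longleftrightarrow> 4 * hnorm x = 0" by simp
  also have "\<dots> \<longleftrightarrow> 2 * a + d = 0 \<and> 2 * b + d = 0 \<and> 2 * c + d = 0 \<and> d = 0"
    unfolding Hz four_hnorm by (smt (verit) power2_less_0 zero_eq_power2)
  finally show ?thesis by (auto simp: Hz zero_hz_def)
qed

lemma hnorm_zero [simp]: "hnorm 0 = 0"
  by (simp add: hnorm_eq_0)

text \<open>These are \<open>i\<close>, the cube root of unity \<open>h - 1\<close>, and
  \<open>1 + i\<close>.\<close>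

abbreviation hi where "hi \<equiv> Hz 0 1 0 0"
abbreviation hw where "hw \<equiv> Hz (- 1) 0 0 1"
abbreviation ht where "ht \<equiv> Hz 1 1 0 0"

text \<open>The residue field of the Hurwitz integers modulo \<open>1 + i\<close>; \<open>Fw\<close> is the class of \<open>h\<close>.\<close>

datatype f4 = F0 | F1 | Fw | Fv

instantiation f4 :: comm_ring_1
begin

fun plus_f4 where
  "F0 + y = y" | "x + F0 = x" |
  "F1 + F1 = F0" | "F1 + Fw = Fv" | "F1 + Fv = Fw" |
  "Fw + F1 = Fv" | "Fw + Fw = F0" | "Fw + Fv = F1" |
  "Fv + F1 = Fw" | "Fv + Fw = F1" | "Fv + Fv = F0"
fun times_f4 where
  "F0 * y = F0" | "F1 * y = y" | "Fw * F0 = F0" | "Fv * F0 = F0" | "Fw * F1 = Fw" | "Fv * F1 = Fv" |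
  "Fw * Fw = Fv" | "Fw * Fv = F1" | "Fv * Fw = F1" | "Fv * Fv = Fw"
definition "- x = (x :: f4)"
definition "x - y = (x + y :: f4)"
definition "0 = F0"
definition "1 = F1"

instance
proof
  fix x y z :: f4
  show "x + y + z = x + (y + z)" "(x + y) * z = x * z + y * z" "x * y * z = x * (y * z)"
    by (cases x; cases y; cases z; simp)+
  show "x + y = y + x" "x * y = y * x" by (cases x; cases y; simp)+
  show "0 + x = x" "1 * x = x" "- x + x = 0"
    by (cases x; simp add: zero_f4_def one_f4_def uminus_f4_def)+
  show "x - y = x + - y" by (simp add: minus_f4_def uminus_f4_def)
  show "(0::f4) \<noteq> 1" by (simp add: zero_f4_def one_f4_def)
qed

end

lemma f4_integral: "(x::f4) * y = 0 \<Longrightarrow> x = 0 \<or> y = 0"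
  by (cases x; cases y) (auto simp: zero_f4_def)

lemma f4_add_self: "(x::f4) + x = 0"
  by (cases x) (auto simp: zero_f4_def)

lemma f4_add_eq_0: "(x::f4) + y = 0 \<longleftrightarrow> x = y"
  by (cases x; cases y) (auto simp: zero_f4_def)

text \<open>Modulo \<open>1 + i\<close> both \<open>i\<close> and \<open>j\<close> become 1, which
  leaves the parities of \<open>a + b + c\<close> and of \<open>d\<close>.\<close>

fun residue :: "hz \<Rightarrow> f4" where
  "residue (Hz a b c d) =
    (if even d then (if even (a + b + c) then F0 else F1) else (if even (a + b + c) then Fw else Fv))"

lemma residue_zero [simp]: "residue 0 = 0"
  by (simp add: zero_hz_def zero_f4_def)

lemma residue_add: "residue (x + y) = residue x + residue y"
proof (cases x; cases y)
  fix a b c d p q r s assume [simp]: "x = Hz a b c d" "y = Hz p q r s"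
  show ?thesis
    by (cases "even a"; cases "even b"; cases "even c"; cases "even d";
        cases "even p"; cases "even q"; cases "even r"; cases "even s"; simp)
qed

lemma residue_sum: "residue (sum f S) = (\<Sum>k\<in>S. residue (f k))"
  by (induction S rule: infinite_finite_induct) (auto simp: residue_add)

lemma residue_mult: "residue (x * y) = residue x * residue y"
proof (cases x; cases y)
  fix a b c d p q r s assume [simp]: "x = Hz a b c d" "y = Hz p q r s"
  show ?thesis
    by (cases "even a"; cases "even b"; cases "even c"; cases "even d";
        cases "even p"; cases "even q"; cases "even r"; cases "even s"; simp)
qed

lemma odd_hnorm_iff: "odd (hnorm x) \<longleftrightarrow> residue x \<noteq> 0"
proof (cases x)
  case [simp]: (Hz a b c d)
  show ?thesis
    by (cases "even a"; cases "even b"; cases "even c"; cases "even d"; simp add: zero_f4_def)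
qed

lemma residue_eq_0E:
  assumes "residue x = 0"
  obtains y where "x = ht * y"
proof (cases x)
  case (Hz a b c d)
  have "even d" "even (a + b + c)"
    using assms by (auto simp: Hz zero_f4_def split: if_splits)
  then obtain e f where ef: "d = 2 * e" "a + b + c = 2 * f" by (meson evenE)
  then have "x = ht * Hz (f + e) (b + c - f) (e + c) (- c)"
    unfolding Hz by simp
  then show thesis by (rule that)
qed

lemma residue_eqE:
  assumes "residue x = residue y"
  obtains z where "x - y = ht * z"
proof -
  have "residue (x - y) + residue y = residue x" by (simp flip: residue_add)
  then have "residue (x - y) + residue y + residue y = 0" using assms by (simp add: f4_add_self)
  then have "residue (x - y) = 0" by (simp add: add.assoc f4_add_self)
  then show thesis using that by (rule residue_eq_0E)
qed

text \<open>The pair \<open>(x, y)\<close> stands for the quaternion \<open>x + y j\<close>.\<close>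

type_synonym quat = "complex \<times> complex"

definition qmul :: "quat \<Rightarrow> quat \<Rightarrow> quat" where
  "qmul x y = (fst x * fst y - snd x * cnj (snd y), fst x * snd y + snd x * cnj (fst y))"

lemma qmul_inner: "qmul x y \<bullet> qmul x y = (x \<bullet> x) * (y \<bullet> y)"
  by (cases x; cases y) (simp add: qmul_def inner_prod_def inner_complex_def power2_eq_square algebra_simps)

lemma qmul_assoc: "qmul (qmul x y) z = qmul x (qmul y z)"
  by (simp add: qmul_def algebra_simps)

lemma norm_qmul: "norm (qmul x y) = norm x * norm y"
  unfolding norm_eq_sqrt_inner qmul_inner by (rule real_sqrt_mult)

interpretation qmul: bounded_bilinear qmul
proof
  fix x y z :: quat and r :: real
  show "qmul (x + y) z = qmul x z + qmul y z" "qmul x (y + z) = qmul x y + qmul x z"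
    by (simp_all add: qmul_def algebra_simps)
  show "qmul (r *\<^sub>R x) y = r *\<^sub>R qmul x y" "qmul x (r *\<^sub>R y) = r *\<^sub>R qmul x y"
    by (simp_all add: qmul_def scaleR_conv_of_real algebra_simps)
  show "\<exists>K. \<forall>x y. norm (qmul x y) \<le> norm x * norm y * K"
    by (rule exI[of _ 1]) (simp add: norm_qmul)
qed

fun quat_of :: "hz \<Rightarrow> quat" where
  "quat_of (Hz a b c d) = (Complex (a + d / 2) (b + d / 2), Complex (c + d / 2) (d / 2))"

lemma quat_of_add: "quat_of (x + y) = quat_of x + quat_of y"
  by (cases x; cases y) (simp add: complex_eq_iff field_simps)

lemma quat_of_mult: "quat_of (x * y) = qmul (quat_of x) (quat_of y)"
  by (cases x; cases y) (simp add: qmul_def complex_eq_iff field_simps)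

lemma quat_of_inner: "quat_of x \<bullet> quat_of x = hnorm x"
  by (cases x) (simp add: inner_complex_def field_simps power2_eq_square)

section \<open>Lattices over the Hurwitz quaternions\<close>

text \<open>A fixed numbering of the index type allows lattice data to be given by functions and
  lists over natural numbers.\<close>

definition ix :: "'i::finite \<Rightarrow> nat" where
  "ix = (SOME f. bij_betw f UNIV {..<CARD('i)})"

lemma bij_ix: "bij_betw (ix :: 'i::finite \<Rightarrow> nat) UNIV {..<CARD('i)}"
proof -
  have "\<exists>f :: 'i \<Rightarrow> nat. bij_betw f UNIV {..<CARD('i)}"
    using ex_bij_betw_finite_nat[of "UNIV :: 'i set"] by (simp add: atLeast0LessThan)
  then show ?thesis unfolding ix_def by (rule someI_ex)
qed

lemma ix_less: "ix (i::'i::finite) < CARD('i)"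
  using bij_ix[where 'i='i] by (auto simp: bij_betw_def)

lemma sum_ix: "(\<Sum>i\<in>UNIV. g (ix (i::'i::finite))) = (\<Sum>n<CARD('i). g n)"
  by (rule sum.reindex_bij_betw[OF bij_ix])

text \<open>With the factor \<open>1 / sqrt 2\<close> the lattices below are even with minimal norm \<open>2\<close> or \<open>4\<close>.\<close>

definition emb :: "(nat \<Rightarrow> hz) \<Rightarrow> quat ^ 'i::finite" where
  "emb f = (\<chi> i. (1 / sqrt 2) *\<^sub>R quat_of (f (ix i)))"

definition lmul :: "quat \<Rightarrow> quat ^ 'i::finite \<Rightarrow> quat ^ 'i" where
  "lmul q v = (\<chi> i. qmul q (v $ i))"

text \<open>Scalars act from the left, so diagonal matrices act from the right in order to commute
  with them.\<close>

definition rmul :: "(nat \<Rightarrow> hz) \<Rightarrow> quat ^ 'i::finite \<Rightarrow> quat ^ 'i" where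
  "rmul d v = (\<chi> i. qmul (v $ i) (quat_of (d (ix i))))"

lemma quat_of_zero [simp]: "quat_of 0 = 0"
  by (simp add: zero_hz_def zero_prod_def complex_eq_iff)

lemma quat_of_diff: "quat_of (x - y) = quat_of x - quat_of y"
  using quat_of_add[of "x - y" y] by simp

lemma quat_of_sum: "quat_of (sum f S) = (\<Sum>k\<in>S. quat_of (f k))"
  by (induction S rule: infinite_finite_induct) (auto simp: quat_of_add)

lemma quat_of_of_int: "quat_of (of_int k) = (of_int k, 0)"
  by (simp add: of_int_hz complex_eq_iff)

lemma qmul_real_right: "qmul x (of_real r, 0) = r *\<^sub>R x"
  by (simp add: qmul_def scaleR_prod_def scaleR_conv_of_real mult.commute)

lemma qmul_one_left: "qmul (quat_of 1) x = x"
  by (simp add: qmul_def one_hz_def prod_eq_iff complex_eq_iff)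

lemma emb_cong: "(\<And>n. n < CARD('i) \<Longrightarrow> f n = g n) \<Longrightarrow> emb f = (emb g :: quat ^ 'i::finite)"
  by (simp add: emb_def vec_eq_iff ix_less)

lemma emb_add: "emb f + emb g = emb (\<lambda>n. f n + g n)"
  by (simp add: emb_def vec_eq_iff quat_of_add scaleR_add_right)

lemma emb_diff: "emb f - emb g = emb (\<lambda>n. f n - g n)"
  by (simp add: emb_def vec_eq_iff quat_of_diff scaleR_diff_right)

lemma emb_zero: "emb (\<lambda>n. 0) = 0"
  by (simp add: emb_def vec_eq_iff)

lemma emb_inner: "(emb f :: quat ^ 'i::finite) \<bullet> emb f = of_int (\<Sum>n<CARD('i). hnorm (f n)) / 2"
proof -
  have "(emb f :: quat ^ 'i) \<bullet> emb f = (\<Sum>i\<in>UNIV. (\<lambda>n. of_int (hnorm (f n)) / 2) (ix (i::'i)))"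
    unfolding inner_vec_def emb_def by (simp add: quat_of_inner)
  also have "\<dots> = (\<Sum>n<CARD('i). of_int (hnorm (f n)) / 2)" by (rule sum_ix)
  finally show ?thesis by (simp add: sum_divide_distrib)
qed

lemma lmul_emb: "lmul (quat_of x) (emb f) = emb (\<lambda>n. x * f n)"
  by (simp add: lmul_def emb_def vec_eq_iff quat_of_mult qmul.scaleR_right)

lemma rmul_emb: "rmul d (emb f) = emb (\<lambda>n. f n * d n)"
  by (simp add: rmul_def emb_def vec_eq_iff quat_of_mult qmul.scaleR_left)

lemma linear_lmul: "linear (lmul q)"
  by (rule linearI) (simp_all add: lmul_def vec_eq_iff qmul.add_right qmul.scaleR_right)

lemma linear_rmul: "linear (rmul d)"
  by (rule linearI) (simp_all add: rmul_def vec_eq_iff qmul.add_left qmul.scaleR_left)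

lemma lmul_inner: "lmul q x \<bullet> lmul q x = (q \<bullet> q) * (x \<bullet> x)"
  by (simp add: inner_vec_def lmul_def qmul_inner sum_distrib_left)

lemma rmul_inner:
  assumes "\<And>n. n < CARD('i) \<Longrightarrow> hnorm (d n) = 1"
  shows "rmul d x \<bullet> rmul d x = x \<bullet> (x :: quat ^ 'i::finite)"
  by (simp add: inner_vec_def rmul_def qmul_inner quat_of_inner assms ix_less)

lemma lmul_lmul: "lmul p (lmul q x) = lmul (qmul p q) x"
  by (simp add: lmul_def vec_eq_iff qmul_assoc)

lemma lmul_rmul: "rmul d (lmul q x) = lmul q (rmul d x)"
  by (simp add: lmul_def rmul_def vec_eq_iff qmul_assoc)

lemma lmul_add_left: "lmul (p + q) x = lmul p x + lmul q x"
  by (simp add: lmul_def vec_eq_iff qmul.add_left)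

lemma lmul_scaleR_left: "lmul (r *\<^sub>R p) x = r *\<^sub>R lmul p x"
  by (simp add: lmul_def vec_eq_iff qmul.scaleR_left)

text \<open>The last basis element is \<open>k = 2 h - 1 - i - j\<close>.\<close>

lemma quat_decomp:
  "q = Re (fst q) *\<^sub>R quat_of 1 + Im (fst q) *\<^sub>R quat_of hi + Re (snd q) *\<^sub>R quat_of (Hz 0 0 1 0)
    + Im (snd q) *\<^sub>R quat_of (Hz (- 1) (- 1) (- 1) 2)"
  by (simp add: one_hz_def prod_eq_iff complex_eq_iff)

declare quat_of.simps [simp del]

section \<open>Left modules generated by the rows of a matrix\<close>

definition comb :: "nat \<Rightarrow> (nat \<Rightarrow> nat \<Rightarrow> hz) \<Rightarrow> (nat \<Rightarrow> hz) \<Rightarrow> nat \<Rightarrow> hz" where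
  "comb m b a n = (\<Sum>k<m. a k * b k n)"

lemma comb_diff: "comb m b a n - comb m b a' n = comb m b (\<lambda>k. a k - a' k) n"
  by (simp add: comb_def sum_subtractf left_diff_distrib)

lemma comb_mult: "x * comb m b a n = comb m b (\<lambda>k. x * a k) n"
  by (simp add: comb_def sum_distrib_left mult.assoc)

lemma comb_comb: "comb m b (comb m M a) n = comb m (\<lambda>k. comb m b (M k)) a n"
proof -
  have "comb m b (comb m M a) n = (\<Sum>l<m. \<Sum>k<m. a k * (M k l * b l n))"
    by (simp add: comb_def sum_distrib_right mult.assoc)
  also have "\<dots> = (\<Sum>k<m. \<Sum>l<m. a k * (M k l * b l n))" by (rule sum.swap)
  finally show ?thesis by (simp add: comb_def sum_distrib_left)
qed

text \<open>The two conditions on the rows make the lattice even once norms are halved by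
  \<open>emb\<close>.\<close>

locale hurwitz_lattice =
  fixes ty :: "'i::finite itself" and m :: nat and b :: "nat \<Rightarrow> nat \<Rightarrow> hz" and \<mu> :: int
  assumes card: "CARD('i) = m"
    and gram_diag: "\<And>k. k < m \<Longrightarrow> 4 dvd (\<Sum>n<m. hnorm (b k n))"
    and gram: "\<And>k l. k < l \<Longrightarrow> l < m \<Longrightarrow> \<exists>g. (\<Sum>n<m. b k n * hcnj (b l n)) = 2 * ht * g"
begin

lemmas ixm_less = ix_less[where 'i = 'i, unfolded card]
lemmas embm_cong = emb_cong[where 'i = 'i, unfolded card]
lemmas embm_inner = emb_inner[where 'i = 'i, unfolded card]
lemmas rmulm_inner = rmul_inner[where 'i = 'i, unfolded card]

abbreviation "cmb \<equiv> comb m b"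
abbreviation emb' :: "(nat \<Rightarrow> hz) \<Rightarrow> quat ^ 'i" where "emb' \<equiv> emb"
abbreviation T :: "quat ^ 'i \<Rightarrow> quat ^ 'i" where "T \<equiv> lmul (quat_of ht)"

definition lat :: "(quat ^ 'i) set" where
  "lat = range (\<lambda>a. emb (cmb a))"

text \<open>The hypothesis \<open>frame\<close> of \<open>frame_lattice\<close> at a single
  vector.\<close>

definition good :: "quat ^ 'i \<Rightarrow> bool" where
  "good v \<longleftrightarrow> span {w \<in> lat. v - w \<in> T ` lat \<and> w \<bullet> w = of_int \<mu>} = UNIV"

lemma lat_subgroup: "additive_subgroup lat"
  unfolding additive_subgroup_def
proof safe
  have "emb' (cmb (\<lambda>_. 0)) = 0" by (simp add: comb_def[abs_def] emb_zero)
  then show "0 \<in> lat" unfolding lat_def by (metis rangeI)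
  fix x y assume "x \<in> lat" "y \<in> lat"
  then show "x - y \<in> lat" by (auto simp: lat_def emb_diff comb_diff)
qed

lemma lmul_lat: "x \<in> lat \<Longrightarrow> lmul (quat_of q) x \<in> lat"
  by (auto simp: lat_def lmul_emb comb_mult)

text \<open>Rows are added one at a time. By \<open>hnorm_add\<close> each new row contributes its
  own norm sum and the trace of a multiple of \<open>2 (1 + i)\<close>; multiples of
  \<open>1 + i\<close> have even trace.\<close>

lemma even_sum_hnorm: "4 dvd (\<Sum>n<m. hnorm (cmb a n))"
proof -
  have "4 dvd (\<Sum>n<m. hnorm (\<Sum>k<j. a k * b k n))" if "j \<le> m" for j
    using that
  proof (induction j)
    case 0
    then show ?case by simp
  next
    case (Suc j)
    have tr4: "4 dvd htrace (x * (2 * ht * g) * y)" for x g y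
    proof -
      have "x * (2 * ht * g) * y = 2 * (x * (ht * g) * y)"
        by (simp only: mult_2 distrib_left distrib_right mult.assoc)
      moreover have "htrace (2 * z) = 2 * htrace z" for z by (simp only: mult_2 htrace_add)
      moreover have "even (htrace z)" if "residue z = 0" for z :: hz
        using that by (cases z) (simp add: zero_f4_def split: if_splits)
      moreover have "residue (x * (ht * g) * y) = 0" by (simp add: residue_mult flip: zero_f4_def)
      ultimately obtain e where "htrace (x * (2 * ht * g) * y) = 2 * (2 * e)" by (metis evenE)
      then show ?thesis by simp
    qed
    have "(\<Sum>n<m. (\<Sum>k<j. a k * b k n) * hcnj (a j * b j n)) =
        (\<Sum>n<m. \<Sum>k<j. a k * (b k n * hcnj (b j n)) * hcnj (a j))"
      by (simp add: sum_distrib_right hcnj_mult mult.assoc)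
    also have "\<dots> = (\<Sum>k<j. \<Sum>n<m. a k * (b k n * hcnj (b j n)) * hcnj (a j))" by (rule sum.swap)
    also have "\<dots> = (\<Sum>k<j. a k * (\<Sum>n<m. b k n * hcnj (b j n)) * hcnj (a j))"
      by (simp add: sum_distrib_right sum_distrib_left)
    finally have "htrace (\<Sum>n<m. (\<Sum>k<j. a k * b k n) * hcnj (a j * b j n)) =
        (\<Sum>k<j. htrace (a k * (\<Sum>n<m. b k n * hcnj (b j n)) * hcnj (a j)))" by (simp add: htrace_sum)
    moreover have "4 dvd htrace (a k * (\<Sum>n<m. b k n * hcnj (b j n)) * hcnj (a j))" if "k < j" for k
      using gram[OF that] Suc.prems tr4 by fastforce
    ultimately have cross: "4 dvd htrace (\<Sum>n<m. (\<Sum>k<j. a k * b k n) * hcnj (a j * b j n))"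
      by (auto intro: dvd_sum)
    have "(\<Sum>n<m. hnorm (a j * b j n)) = hnorm (a j) * (\<Sum>n<m. hnorm (b j n))"
      by (simp add: hnorm_mult sum_distrib_left)
    then have diag: "4 dvd (\<Sum>n<m. hnorm (a j * b j n))"
      using gram_diag[of j] Suc.prems by simp
    have "(\<Sum>n<m. hnorm (\<Sum>k<Suc j. a k * b k n)) = (\<Sum>n<m. hnorm (\<Sum>k<j. a k * b k n)) +
        (\<Sum>n<m. hnorm (a j * b j n)) + htrace (\<Sum>n<m. (\<Sum>k<j. a k * b k n) * hcnj (a j * b j n))"
      by (simp add: hnorm_add sum.distrib htrace_sum)
    then show ?case using Suc cross diag by simp
  qed
  then show ?thesis by (simp add: comb_def)
qed

lemma good_linear_image:
  assumes F: "linear F" "\<And>x. F x \<bullet> F x = x \<bullet> x" "\<And>x. x \<in> lat \<Longrightarrow> F x \<in> lat"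
    "\<And>x. x \<in> lat \<Longrightarrow> F (T x) \<in> T ` lat" and v: "good v"
  shows "good (F v)"
proof -
  have "inj F"
    unfolding linear_injective_0[OF F(1)] using F(2) by (metis inner_eq_zero_iff)
  then have "surj F" using linear_injective_imp_surjective[OF F(1)] by blast
  have sub: "F ` {w \<in> lat. v - w \<in> T ` lat \<and> w \<bullet> w = of_int \<mu>} \<subseteq> {w \<in> lat. F v - w \<in> T ` lat \<and> w \<bullet> w = of_int \<mu>}"
  proof safe
    fix w u assume w: "w \<in> lat" "w \<bullet> w = of_int \<mu>" and u: "v - w = T u" "u \<in> lat"
    show "F w \<in> lat" "F w \<bullet> F w = of_int \<mu>" using w F by simp_all
    have "F v - F w = F (T u)" unfolding u(1)[symmetric] by (simp add: linear_diff[OF F(1)])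
    then show "F v - F w \<in> T ` lat" using F(4)[OF u(2)] by simp
  qed
  show ?thesis
    unfolding good_def
    using span_mono[OF sub] v \<open>surj F\<close> unfolding linear_span_image[OF F(1)] good_def
    by (simp add: top.extremum_unique)
qed

text \<open>Left multiplication by \<open>h\<close> does not commute with \<open>T\<close>, but
  \<open>h (1 + i)\<close> is \<open>1 + i\<close> times another unit. On residues it multiplies by
  the generator \<open>Fw\<close>, so it permits scaling of residue vectors.\<close>

lemma good_left_unit:
  assumes "good v"
  shows "good (lmul (quat_of (Hz 0 0 0 1)) v)"
proof (rule good_linear_image[OF linear_lmul _ _ _ assms])
  fix x :: "quat ^ 'i"
  show "lmul (quat_of (Hz 0 0 0 1)) x \<bullet> lmul (quat_of (Hz 0 0 0 1)) x = x \<bullet> x"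
    unfolding lmul_inner quat_of_inner by simp
  assume x: "x \<in> lat"
  show "lmul (quat_of (Hz 0 0 0 1)) x \<in> lat" using x by (rule lmul_lat)
  have "Hz 0 0 0 1 * ht = ht * Hz 1 1 1 (- 1)" by simp
  then have "lmul (quat_of (Hz 0 0 0 1)) (T x) = T (lmul (quat_of (Hz 1 1 1 (- 1))) x)"
    unfolding lmul_lmul by (metis quat_of_mult)
  then show "lmul (quat_of (Hz 0 0 0 1)) (T x) \<in> T ` lat" using lmul_lat[OF x] by blast
qed

text \<open>Since the fourth powers of the \<open>d n\<close> are \<open>1\<close>, three further applications undo \<open>rmul d\<close>.\<close>

lemma good_rmul:
  assumes M: "\<And>k n. k < m \<Longrightarrow> n < m \<Longrightarrow> comb m b (M k) n = b k n * d n"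
    and d: "\<And>n. n < m \<Longrightarrow> d n * d n * d n * d n = 1"
    and "good (emb (cmb (comb m M a)))"
  shows "good (emb (cmb a))"
proof -
  have R: "rmul d (emb' (cmb a)) = emb (cmb (comb m M a))" for a
    unfolding rmul_emb comb_comb
    by (rule embm_cong, unfold comb_def[of m _ a] sum_distrib_right, rule sum.cong)
      (simp_all add: mult.assoc M)
  have Nd: "hnorm (d n) = 1" if "n < m" for n
  proof -
    have "hnorm (d n * d n * d n * d n) = 1" unfolding d[OF that] by (simp add: one_hz_def)
    then have "(hnorm (d n))^4 = 1" by (simp add: hnorm_mult power4_eq_xxxx mult.assoc)
    then show ?thesis using hnorm_nonneg[of "d n"] power_eq_iff_eq_base[of 4 "hnorm (d n)" 1] by simp
  qed
  have good_R: "good (rmul d v)" if "good v" for v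
  proof (rule good_linear_image[OF linear_rmul _ _ _ that])
    show "rmul d x \<bullet> rmul d x = x \<bullet> (x :: quat ^ 'i)" for x by (rule rmulm_inner[OF Nd])
    show RL: "rmul d x \<in> lat" if "x \<in> lat" for x using that by (auto simp: lat_def R)
    show "rmul d (T x) \<in> T ` lat" if "x \<in> lat" for x
      unfolding lmul_rmul using RL[OF that] by blast
  qed
  have "rmul d (rmul d (rmul d (rmul d (emb' (cmb a))))) = emb (cmb a)"
    unfolding rmul_emb by (rule embm_cong) (use d in \<open>simp add: mult.assoc\<close>)
  moreover have "good (rmul d (rmul d (rmul d (rmul d (emb' (cmb a))))))"
    by (rule good_R, rule good_R, rule good_R) (simp add: R assms(3))
  ultimately show ?thesis by simp
qed

lemma good_cong:
  assumes "\<And>k. k < m \<Longrightarrow> residue (a k) = residue (a' k)"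
  shows "\<exists>x\<in>lat. emb (cmb a) - emb (cmb a') = T x"
proof -
  have "\<exists>z. a k - a' k = ht * z" if "k < m" for k
    using assms[OF that] by (metis residue_eqE)
  then obtain z where z: "\<And>k. k < m \<Longrightarrow> a k - a' k = ht * z k" by metis
  have "emb' (cmb a) - emb (cmb a') = emb (cmb (\<lambda>k. a k - a' k))"
    by (simp add: emb_diff comb_diff)
  also have "cmb (\<lambda>k. a k - a' k) = cmb (\<lambda>k. ht * z k)"
    by (auto simp: comb_def z)
  also have "emb' \<dots> = T (emb (cmb z))"
    by (simp add: lmul_emb comb_mult)
  finally show ?thesis unfolding lat_def by blast
qed

text \<open>Each of the \<open>m\<close> vectors \<open>w l\<close> is congruent to its multiples by \<open>i\<close>, \<open>j\<close> and \<open>k\<close> modulo \<open>T\<close>;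
  the column relations say that the \<open>w l\<close> form an orthogonal quaternionic basis.\<close>

lemma good_of_frame:
  assumes A: "\<And>l k. l < m \<Longrightarrow> k < m \<Longrightarrow> residue (A l k) = residue (a k)"
    and norm: "\<And>l. l < m \<Longrightarrow> (\<Sum>n<m. hnorm (cmb (A l) n)) = 2 * \<mu>"
    and orth: "\<And>n n'. n < m \<Longrightarrow> n' < m \<Longrightarrow>
      (\<Sum>l<m. hcnj (cmb (A l) n) * cmb (A l) n') = (if n = n' then of_int (2 * \<mu>) else 0)"
    and "\<mu> > 0"
  shows "good (emb (cmb a))"
proof -
  define W where "W = {w \<in> lat. emb (cmb a) - w \<in> T ` lat \<and> w \<bullet> w = of_int \<mu>}"
  define w where "w l = emb' (cmb (A l))" for l
  have unit: "lmul (quat_of u) (w l) \<in> W"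
    if l: "l < m" and u: "hnorm u = 1" "u = 1 + ht * c" for l u c
  proof -
    have "w l \<in> lat" unfolding w_def lat_def by blast
    obtain x where x: "x \<in> lat" "emb (cmb a) - w l = T x"
      using good_cong[of a "A l"] A[OF l] unfolding w_def by metis
    have "lmul (quat_of u) (w l) = w l + T (lmul (quat_of c) (w l))"
      unfolding u(2) quat_of_add quat_of_mult lmul_add_left lmul_lmul[symmetric]
      by (simp add: lmul_def[of "quat_of 1"] qmul_one_left)
    then have "emb (cmb a) - lmul (quat_of u) (w l) = T x - T (lmul (quat_of c) (w l))"
      unfolding x(2)[symmetric] by simp
    also have "\<dots> = T (x - lmul (quat_of c) (w l))"
      by (simp add: linear_diff[OF linear_lmul])
    finally have "emb (cmb a) - lmul (quat_of u) (w l) \<in> T ` lat"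
      using additive_subgroupD(2)[OF lat_subgroup x(1) lmul_lat[OF \<open>w l \<in> lat\<close>]] by blast
    moreover have "lmul (quat_of u) (w l) \<bullet> lmul (quat_of u) (w l) = of_int \<mu>"
      unfolding lmul_inner quat_of_inner u(1) w_def embm_inner norm[OF l] by simp
    ultimately show ?thesis
      unfolding W_def using lmul_lat[OF \<open>w l \<in> lat\<close>] by simp
  qed
  have span_w: "lmul q (w l) \<in> span W" if "l < m" for q l
  proof -
    have "lmul (quat_of 1) (w l) \<in> W" by (rule unit[OF that, of _ 0]) (simp_all add: one_hz_def)
    moreover have "lmul (quat_of hi) (w l) \<in> W"
      by (rule unit[OF that, of _ hi]) (simp_all add: one_hz_def)
    moreover have "lmul (quat_of (Hz 0 0 1 0)) (w l) \<in> W"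
      by (rule unit[OF that, of _ "Hz 0 1 1 (- 1)"]) (simp_all add: one_hz_def)
    moreover have "lmul (quat_of (Hz (- 1) (- 1) (- 1) 2)) (w l) \<in> W"
      by (rule unit[OF that, of _ "Hz (- 1) 0 0 1"]) (simp_all add: one_hz_def)
    ultimately show ?thesis
      by (subst quat_decomp) (simp add: lmul_add_left lmul_scaleR_left span_add span_scale span_base)
  qed
  have "x \<in> span W" for x :: "quat ^ 'i"
  proof -
    obtain X where X: "\<And>i. x $ i = X (ix i)"
    proof -
      have "inj (ix :: 'i \<Rightarrow> nat)" using bij_ix by (auto simp: bij_betw_def)
      then have "x $ i = (\<lambda>n. x $ inv ix n) (ix i)" for i by simp
      then show thesis by (rule that)
    qed
    \<comment> \<open>\<open>y l\<close> is the Hermitian product of \<open>x\<close> with the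
      \<open>l\<close>-th frame vector; column orthogonality then recovers a multiple of
      \<open>x\<close>.\<close>
    define y where "y l = (\<Sum>n<m. qmul (X n) (quat_of (hcnj (cmb (A l) n))))" for l
    have "(\<Sum>l<m. lmul (y l) (w l)) = (of_int (2 * \<mu>) / sqrt 2) *\<^sub>R x"
    proof (subst vec_eq_iff, rule allI)
      fix i :: 'i
      have "(\<Sum>l<m. lmul (y l) (w l)) $ i = (1 / sqrt 2) *\<^sub>R (\<Sum>l<m. qmul (y l) (quat_of (cmb (A l) (ix i))))"
        by (simp add: sum_component lmul_def w_def emb_def qmul.scaleR_right scaleR_right.sum)
      also have "(\<Sum>l<m. qmul (y l) (quat_of (cmb (A l) (ix i)))) =
          (\<Sum>l<m. \<Sum>n<m. qmul (X n) (quat_of (hcnj (cmb (A l) n) * cmb (A l) (ix i))))"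
        by (simp add: y_def qmul.sum_left qmul_assoc quat_of_mult)
      also have "\<dots> = (\<Sum>n<m. \<Sum>l<m. qmul (X n) (quat_of (hcnj (cmb (A l) n) * cmb (A l) (ix i))))"
        by (rule sum.swap)
      also have "\<dots> = (\<Sum>n<m. qmul (X n) (quat_of (\<Sum>l<m. hcnj (cmb (A l) n) * cmb (A l) (ix i))))"
        by (simp add: qmul.sum_right quat_of_sum)
      also have "\<dots> = (\<Sum>n<m. if n = ix i then qmul (X n) (quat_of (of_int (2 * \<mu>))) else 0)"
        by (intro sum.cong refl) (auto simp: orth ixm_less qmul.zero_right simp del: of_int_mult)
      also have "\<dots> = qmul (X (ix i)) (quat_of (of_int (2 * \<mu>)))"
        using ixm_less[of i] by (simp del: of_int_mult)
      also have "\<dots> = of_int (2 * \<mu>) *\<^sub>R X (ix i)"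
        using qmul_real_right[of _ "of_int (2 * \<mu>)"] unfolding quat_of_of_int
        by (simp only: of_real_of_int_eq)
      finally show "(\<Sum>l<m. lmul (y l) (w l)) $ i = ((of_int (2 * \<mu>) / sqrt 2) *\<^sub>R x) $ i"
        by (simp add: X)
    qed
    moreover have "(\<Sum>l<m. lmul (y l) (w l)) \<in> span W"
      by (intro span_sum span_w) auto
    ultimately have "(sqrt 2 / of_int (2 * \<mu>)) *\<^sub>R (of_int (2 * \<mu>) / sqrt 2) *\<^sub>R x \<in> span W"
      by (metis span_scale)
    then show ?thesis using \<open>\<mu> > 0\<close> by simp
  qed
  then show ?thesis unfolding good_def W_def by blast
qed

text \<open>Left multiplication by \<open>hw\<close> is the isometry of order three, and the Hurwitz
  integers are free over \<open>\<int>[hw]\<close> with basis \<open>1, i\<close>, which yields the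
  \<open>2 * m\<close> generators.\<close>

theorem hurwitz_lattice_coloring:
  assumes good: "\<And>a. \<exists>k<m. residue (a k) \<noteq> 0 \<Longrightarrow> good (emb (cmb a))"
    and min: "\<And>a. (\<Sum>n<m. hnorm (cmb a n)) \<noteq> 0 \<Longrightarrow> 2 * \<mu> \<le> (\<Sum>n<m. hnorm (cmb a n))"
    and \<mu>: "\<mu> = 2 \<and> m \<le> 6 \<or> \<mu> = 4 \<and> m = 6"
  shows "\<exists>c. unit_distance_coloring (UNIV :: (quat ^ 'i) set) (7 ^ (2 * m)) c"
proof -
  have dim: "DIM(quat ^ 'i) = 4 * m" by (simp add: card)
  have mu0: "\<mu> > 0" using \<mu> by auto
  have m0: "m > 0" using card by (metis zero_less_card_finite)
  have min': "of_int \<mu> \<le> x \<bullet> x" if "x \<in> lat" "x \<noteq> 0" for x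
  proof -
    obtain a where a: "x = emb (cmb a)" using \<open>x \<in> lat\<close> by (auto simp: lat_def)
    have x: "x \<bullet> x = of_int (\<Sum>n<m. hnorm (cmb a n)) / 2" unfolding a embm_inner ..
    have "x \<bullet> x \<noteq> 0" using \<open>x \<noteq> 0\<close> by simp
    then have "(\<Sum>n<m. hnorm (cmb a n)) \<noteq> 0" unfolding x by (metis div_0 of_int_0)
    then have "2 * \<mu> \<le> (\<Sum>n<m. hnorm (cmb a n))" by (rule min)
    then have "of_int (2 * \<mu>) \<le> (of_int (\<Sum>n<m. hnorm (cmb a n)) :: real)" by (rule of_int_le_iff[THEN iffD2])
    then show ?thesis unfolding x by simp
  qed
  have T2: "T (T x) = 2 *\<^sub>R lmul (quat_of hi) x" for x
  proof -
    have "qmul (quat_of ht) (quat_of ht) = 2 *\<^sub>R quat_of hi"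
      by (simp add: complex_eq_iff prod_eq_iff quat_of.simps qmul_def)
    then show ?thesis unfolding lmul_lmul by (simp add: lmul_scaleR_left)
  qed
  have hi2: "lmul (quat_of hi) (lmul (quat_of (- hi)) x) = x" for x :: "quat ^ 'i"
  proof -
    have "hi * (- hi) = 1" by (simp add: one_hz_def)
    then have "qmul (quat_of hi) (quat_of (- hi)) = quat_of 1" by (metis quat_of_mult)
    then show ?thesis unfolding lmul_lmul by (simp add: lmul_def qmul_one_left)
  qed
  have not_TL: "\<exists>k<m. residue (a k) \<noteq> 0" if "emb (cmb a) \<notin> T ` lat" for a
  proof (rule ccontr)
    assume "\<not> ?thesis"
    then have "residue (a k) = residue ((\<lambda>_. 0) k)" if "k < m" for k using that by simp
    from good_cong[OF this] obtain x where x: "x \<in> lat" "emb (cmb a) - emb (cmb (\<lambda>_. 0)) = T x" ..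
    have "emb' (cmb (\<lambda>_. 0)) = 0" by (simp add: comb_def[abs_def] emb_zero)
    then have "emb (cmb a) = T x" using x(2) by simp
    then show False using that x(1) by (metis image_eqI)
  qed
  have span: "span lat = UNIV"
  proof -
    \<comment> \<open>The minimal vectors of one class outside \<open>T L\<close> already span the
      space.\<close>
    have "good (emb (cmb (\<lambda>_. 1)))"
      by (rule good) (use m0 in \<open>auto simp: one_hz_def zero_f4_def\<close>)
    then have sp: "span {w \<in> lat. emb (cmb (\<lambda>_. 1)) - w \<in> T ` lat \<and> w \<bullet> w = of_int \<mu>} = UNIV"
      unfolding good_def .
    have "{w \<in> lat. emb (cmb (\<lambda>_. 1)) - w \<in> T ` lat \<and> w \<bullet> w = of_int \<mu>} \<subseteq> lat"
      by (rule Collect_restrict)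
    note sub = span_mono[OF this]
    show ?thesis using sub unfolding sp by (rule top.extremum_uniqueI)
  qed
  interpret frame_lattice lat T "of_int \<mu>"
  proof (rule frame_lattice.intro)
    show "real_of_int \<mu> = 2 \<or> real_of_int \<mu> = 4 \<and> DIM(quat ^ 'i) = 24" "DIM(quat ^ 'i) \<le> 24"
      unfolding dim using \<mu> by auto
    fix x :: "quat ^ 'i"
    show "T x \<bullet> T x = 2 * (x \<bullet> x)" unfolding lmul_inner quat_of_inner by simp
    assume x: "x \<in> lat"
    show "T x \<in> lat" using x by (rule lmul_lat)
    have "2 *\<^sub>R x = T (T (lmul (quat_of (- hi)) x))" unfolding T2 hi2 ..
    then show "\<exists>y\<in>lat. 2 *\<^sub>R x = T (T y)" using lmul_lat[OF x] by blast
    show "\<exists>y\<in>lat. T (T x) = 2 *\<^sub>R y" unfolding T2 using lmul_lat[OF x] by blast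
    obtain a where a: "x = emb (cmb a)" using x by (auto simp: lat_def)
    obtain k where "(\<Sum>n<m. hnorm (cmb a n)) = 4 * k" using even_sum_hnorm[of a] by (elim dvdE)
    then have "x \<bullet> x = 2 * of_int k" unfolding a embm_inner by simp
    then show "\<exists>k::int. x \<bullet> x = 2 * of_int k" ..
    show "span {w \<in> lat. x - w \<in> T ` lat \<and> w \<bullet> w = of_int \<mu>} = UNIV" if "x \<notin> T ` lat"
      using good[OF not_TL, of a] that unfolding a good_def by simp
  qed (fact lat_subgroup, fact span, fact linear_lmul, (rule min'; assumption))
  have om: "lmul (quat_of hw) (lmul (quat_of hw) x) + lmul (quat_of hw) x + x = 0" for x :: "quat ^ 'i"
  proof -
    have "hw * hw + hw + 1 = 0" by (simp add: one_hz_def zero_hz_def)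
    then have "quat_of (hw * hw + hw + 1) = 0" by simp
    then have "lmul (qmul (quat_of hw) (quat_of hw) + quat_of hw + quat_of 1) x = 0"
      unfolding quat_of_add quat_of_mult by (simp add: lmul_def vec_eq_iff qmul.zero_left)
    then show ?thesis
      unfolding lmul_add_left lmul_lmul by (simp add: lmul_def[of "quat_of 1"] qmul_one_left)
  qed
  define g where "g k = emb' (\<lambda>n. (if even k then 1 else hi) * b (k div 2) n)" for k
  show ?thesis
  proof (rule lattice_coloring[of lat "lmul (quat_of hw)" "2 * m" g "of_int \<mu>" "111/200 * of_int \<mu>"])
    show "norm (lmul (quat_of hw) x) = norm x" for x :: "quat ^ 'i"
      unfolding norm_eq_sqrt_inner lmul_inner quat_of_inner by simp
    show "lmul (quat_of hw) x \<in> lat" if "x \<in> lat" for x using that by (rule lmul_lat)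
    show "g k \<in> lat" if "k < 2 * m" for k
    proof -
      have "k div 2 < m" using that by simp
      then have "b (k div 2) n = cmb (\<lambda>l. if l = k div 2 then 1 else 0) n" for n
        by (simp add: comb_def if_distrib[of "\<lambda>x. x * _"] cong: if_cong)
      then have "emb' (b (k div 2)) \<in> lat" unfolding lat_def by (metis (no_types, lifting) ext rangeI)
      then show ?thesis unfolding g_def lmul_emb[symmetric] by (rule lmul_lat)
    qed
    fix l assume "l \<in> lat"
    then obtain a where a: "l = emb (cmb a)" by (auto simp: lat_def)
    \<comment> \<open>The coefficients come from \<open>hw = h - 1\<close> and
      \<open>hw * i = j - h\<close>.\<close>
    define f where "f k = (case a k of Hz p q r s \<Rightarrow> p + r + s)" for k
    define f' where "f' k = (case a k of Hz p q r s \<Rightarrow> r + s)" for k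
    define h where "h k = (case a k of Hz p q r s \<Rightarrow> q)" for k
    define h' where "h' k = (case a k of Hz p q r s \<Rightarrow> r)" for k
    have ak: "a k = of_int (f k) + of_int (f' k) * hw + (of_int (h k) + of_int (h' k) * hw) * hi" for k
      by (cases "a k") (simp add: f_def f'_def h_def h'_def of_int_hz)
    have ak_mult: "a k * y = of_int (f k) * y + of_int (f' k) * (hw * y) +
        (of_int (h k) * (hi * y) + of_int (h' k) * (hw * (hi * y)))" for k y
      by (subst ak) (simp only: distrib_right mult.assoc add.assoc)
    have of_int_emb: "of_int j *\<^sub>R emb' F = emb (\<lambda>n. of_int j * F n)" for j F
    proof -
      have "quat_of (of_int j * x) = of_int j *\<^sub>R quat_of x" for x
        by (cases x) (simp add: of_int_hz quat_of.simps complex_eq_iff algebra_simps)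
      then show ?thesis by (simp add: emb_def vec_eq_iff scaleR_left_commute)
    qed
    have emb_sum: "(\<Sum>k<j. emb' (F k)) = emb (\<lambda>n. \<Sum>k<j. F k n)" for F and j :: nat
      by (induction j) (simp_all add: emb_zero emb_add)
    have split: "(\<Sum>k<2 * j. F k) = (\<Sum>k<j. F (2 * k) + F (2 * k + 1))" for F :: "nat \<Rightarrow> quat ^ 'i" and j
      by (induction j) (simp_all add: add.assoc)
    have "l = (\<Sum>k<m. emb (\<lambda>n. a k * b k n))"
      unfolding a emb_sum comb_def ..
    also have "\<dots> = (\<Sum>k<m. (of_int (f k) *\<^sub>R g (2 * k) + of_int (f' k) *\<^sub>R lmul (quat_of hw) (g (2 * k)))
        + (of_int (h k) *\<^sub>R g (2 * k + 1) + of_int (h' k) *\<^sub>R lmul (quat_of hw) (g (2 * k + 1))))"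
      unfolding g_def lmul_emb of_int_emb emb_add
      by (intro sum.cong refl arg_cong[of _ _ emb] ext) (subst ak_mult, simp)
    finally have "l = (\<Sum>k<2 * m. of_int (if even k then f (k div 2) else h (k div 2)) *\<^sub>R g k +
        of_int (if even k then f' (k div 2) else h' (k div 2)) *\<^sub>R lmul (quat_of hw) (g k))"
      unfolding split by simp
    then show "\<exists>\<alpha> \<beta>. l = (\<Sum>k<2 * m. of_int (\<alpha> k) *\<^sub>R g k + of_int (\<beta> k) *\<^sub>R lmul (quat_of hw) (g k))"
      by (intro exI[of _ "\<lambda>k. if even k then f (k div 2) else h (k div 2)"]
          exI[of _ "\<lambda>k. if even k then f' (k div 2) else h' (k div 2)"])
  next
    show "\<exists>l\<in>lat. (x - l) \<bullet> (x - l) \<le> 111/200 * of_int \<mu>" for x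
      using covers_frame_lattice unfolding covers_def by blast
    show "real_of_int \<mu> > 0" "111/200 * real_of_int \<mu> < 9/16 * of_int \<mu>" using mu0 by simp_all
  qed (fact lat_subgroup, fact linear_lmul, fact om, (rule min'; assumption))
qed

end

section \<open>Certificates for frames\<close>

text \<open>The lexicographic order for \<open>F0 < F1 < Fw < Fv\<close> in a form suited to
  evaluation; \<open>lex f4_less\<close> supplies its well-foundedness.\<close>

fun lex_less :: "f4 list \<Rightarrow> f4 list \<Rightarrow> bool" where
  "lex_less (F0 # xs) (F0 # ys) = lex_less xs ys" |
  "lex_less (F1 # xs) (F1 # ys) = lex_less xs ys" |
  "lex_less (Fw # xs) (Fw # ys) = lex_less xs ys" |
  "lex_less (Fv # xs) (Fv # ys) = lex_less xs ys" |
  "lex_less (F0 # xs) (y # ys) = True" |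
  "lex_less (F1 # xs) (Fw # ys) = True" |
  "lex_less (F1 # xs) (Fv # ys) = True" |
  "lex_less (Fw # xs) (Fv # ys) = True" |
  "lex_less _ _ = False"

definition f4_less :: "(f4 \<times> f4) set" where
  "f4_less = {(F0, F1), (F0, Fw), (F0, Fv), (F1, Fw), (F1, Fv), (Fw, Fv)}"

lemma wf_lex_f4: "wf (lex f4_less)"
proof (rule wf_lex)
  define r :: "f4 \<Rightarrow> nat" where "r x = (case x of F0 \<Rightarrow> 0 | F1 \<Rightarrow> 1 | Fw \<Rightarrow> 2 | Fv \<Rightarrow> 3)" for x
  have "f4_less \<subseteq> inv_image less_than r" by (auto simp: f4_less_def r_def)
  then show "wf f4_less" by (rule wf_subset[OF wf_inv_image[OF wf_less_than]])
qed

lemma lex_less_lex: "lex_less xs ys \<Longrightarrow> length xs = length ys \<Longrightarrow> (xs, ys) \<in> lex f4_less"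
  by (induction xs ys rule: lex_less.induct) (auto simp: f4_less_def)

fun all_f4 :: "nat \<Rightarrow> f4 list list" where
  "all_f4 0 = [[]]" |
  "all_f4 (Suc n) = concat (map (\<lambda>x. map ((#) x) (all_f4 n)) [F0, F1, Fw, Fv])"

text \<open>Vectors with first nonzero entry \<open>F1\<close>: one representative of each line over
  the field with four elements.\<close>

fun monic_f4 :: "nat \<Rightarrow> f4 list list" where
  "monic_f4 0 = []" |
  "monic_f4 (Suc n) = map ((#) F1) (all_f4 n) @ map ((#) F0) (monic_f4 n)"

lemma set_all_f4: "xs \<in> set (all_f4 n) \<longleftrightarrow> length xs = n"
proof (induction n arbitrary: xs)
  case (Suc n)
  have "x = F0 \<or> x = F1 \<or> x = Fw \<or> x = Fv" for x by (cases x) auto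
  then show ?case using Suc by (cases xs) (auto simp: image_iff)
qed auto

fun is_monic :: "f4 list \<Rightarrow> bool" where
  "is_monic (F0 # xs) = is_monic xs" | "is_monic (F1 # xs) = True" | "is_monic _ = False"

lemma is_monic_in_monic_f4: "is_monic xs \<Longrightarrow> length xs = n \<Longrightarrow> xs \<in> set (monic_f4 n)"
  by (induction xs arbitrary: n rule: is_monic.induct) (auto simp: set_all_f4)

lemma monic_f4E:
  assumes "length xs = n" "\<exists>x\<in>set xs. x \<noteq> 0"
  obtains u where "u \<noteq> 0" "map ((*) u) xs \<in> set (monic_f4 n)"
proof -
  have "\<exists>u. u \<noteq> 0 \<and> map ((*) u) xs \<in> set (monic_f4 n)"
    using assms
  proof (induction xs arbitrary: n)
    case (Cons x xs)
    obtain k where k: "n = Suc k" "length xs = k" using Cons.prems by (cases n) auto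
    show ?case
    proof (cases "x = 0")
      case True
      then obtain u where "u \<noteq> 0" "map ((*) u) xs \<in> set (monic_f4 k)"
        using Cons.IH[OF k(2)] Cons.prems by auto
      moreover have "u * x = F0" using True by (cases u) (auto simp: zero_f4_def)
      ultimately show ?thesis using k by (intro exI[of _ u]) (simp add: image_iff)
    next
      case False
      then have "\<exists>u. u \<noteq> 0 \<and> u * x = F1" by (cases x) (auto simp: zero_f4_def intro: exI[of _ F1] exI[of _ Fw] exI[of _ Fv])
      then show ?thesis using k by (auto simp: set_all_f4)
    qed
  qed auto
  then show thesis using that by blast
qed

fun dot_f4 :: "f4 list \<Rightarrow> f4 list \<Rightarrow> f4" where
  "dot_f4 (x # xs) (y # ys) = x * y + dot_f4 xs ys" | "dot_f4 _ _ = F0"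

definition vec_cols :: "f4 list \<Rightarrow> f4 list list \<Rightarrow> f4 list" where
  "vec_cols xs C = map (dot_f4 xs) C"

text \<open>Columns are stored so that \<open>vec_cols\<close> multiplies a row vector by the
  reduced matrix.\<close>

definition residue_cols :: "nat \<Rightarrow> hz list list \<Rightarrow> f4 list list" where
  "residue_cols m M = map (\<lambda>l. map (\<lambda>k. residue (M ! k ! l)) [0..<m]) [0..<m]"

definition lcomb :: "nat \<Rightarrow> hz list list \<Rightarrow> hz list \<Rightarrow> nat \<Rightarrow> hz" where
  "lcomb m B a n = sum_list (map (\<lambda>k. a ! k * B ! k ! n) [0..<m])"

text \<open>In a pair \<open>(d, M)\<close>, the list \<open>d\<close> is the diagonal of an automorphism acting from the right, and \<open>M\<close> is the
  matrix of this automorphism with respect to the basis \<open>B\<close>. In a pair \<open>(x, A)\<close>, the rows of \<open>A\<close> are coefficient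
  vectors with residue \<open>x\<close>, one for each quaternionic line of a frame.\<close>

definition check_gen :: "nat \<Rightarrow> hz list list \<Rightarrow> hz list \<times> hz list list \<Rightarrow> bool" where
  "check_gen m B = (\<lambda>(d, M). list_all (\<lambda>n. d ! n * d ! n * d ! n * d ! n = 1 \<and>
     list_all (\<lambda>k. lcomb m B (M ! k) n = B ! k ! n * d ! n) [0..<m]) [0..<m])"

definition check_frame :: "nat \<Rightarrow> hz list list \<Rightarrow> int \<Rightarrow> f4 list \<times> hz list list \<Rightarrow> bool" where
  "check_frame m B \<mu> = (\<lambda>(x, A). length x = m \<and>
     list_all (\<lambda>l. list_all (\<lambda>k. residue (A ! l ! k) = x ! k) [0..<m]) [0..<m] \<and>
     (let W = map (\<lambda>l. map (lcomb m B (A ! l)) [0..<m]) [0..<m] in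
       list_all (\<lambda>l. sum_list (map (\<lambda>n. hnorm (W ! l ! n)) [0..<m]) = 2 * \<mu>) [0..<m] \<and>
       list_all (\<lambda>n. list_all (\<lambda>n'. sum_list (map (\<lambda>l. hcnj (W ! l ! n) * W ! l ! n') [0..<m]) =
         (if n = n' then Hz (2 * \<mu>) 0 0 0 else 0)) [0..<m]) [0..<m]))"

text \<open>Requiring a monic image keeps the descent within the enumerated representatives.\<close>

definition descends :: "f4 list \<Rightarrow> f4 list \<Rightarrow> bool" where
  "descends x y = (if lex_less y x then is_monic y else False)"

text \<open>Conditionals instead of disjunctions keep the simplifier from evaluating the remaining alternatives.\<close>

fun descent_step :: "f4 list \<Rightarrow> f4 list list list \<Rightarrow> bool" where
  "descent_step x [] = False" |
  "descent_step x (C # G) = (if descends x (vec_cols x C) then True else descent_step x G)"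

definition check_descent :: "f4 list list \<Rightarrow> f4 list list list \<Rightarrow> f4 list list \<Rightarrow> bool" where
  "check_descent R G X = list_all (\<lambda>x. if x \<in> set R then True else descent_step x G) X"

lemma descent_stepE:
  assumes "descent_step x G"
  obtains C where "C \<in> set G" "lex_less (vec_cols x C) x" "is_monic (vec_cols x C)"
  using assms
  by (induction x G rule: descent_step.induct) (auto simp: descends_def split: if_splits)

text \<open>\<open>half_div x\<close> is the quotient of \<open>x\<close> by \<open>2 (1 + i)\<close> if this is integral.\<close>

definition half_div :: "hz \<Rightarrow> hz" where
  "half_div x = (case Hz 1 (- 1) 0 0 * x of Hz a b c d \<Rightarrow> Hz (a div 4) (b div 4) (c div 4) (d div 4))"

definition check_gram :: "nat \<Rightarrow> hz list list \<Rightarrow> bool" where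
  "check_gram m B = list_all (\<lambda>l. 4 dvd sum_list (map (\<lambda>n. hnorm (B ! l ! n)) [0..<m]) \<and>
     list_all (\<lambda>k. let g = sum_list (map (\<lambda>n. B ! k ! n * hcnj (B ! l ! n)) [0..<m])
       in g = Hz 2 2 0 0 * half_div g) [0..<l]) [0..<m]"

section \<open>Soundness of the certificates\<close>

lemma sum_list_upt: "sum_list (map f [0..<m]) = (\<Sum>k<m. f k)"
  by (simp add: interv_sum_list_conv_sum_set_nat atLeast0LessThan)

lemma dot_f4_eq: "dot_f4 xs ys = sum_list (map2 (*) xs ys)"
  by (induction xs ys rule: dot_f4.induct) (auto simp: zero_f4_def)

lemma lcomb_eq: "lcomb m B a = comb m (\<lambda>k n. B ! k ! n) (\<lambda>k. a ! k)"
  by (simp add: lcomb_def comb_def sum_list_upt fun_eq_iff)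

lemma hurwitz_latticeI:
  assumes "CARD('i::finite) = m" "check_gram m B"
  shows "hurwitz_lattice TYPE('i) m (\<lambda>k n. B ! k ! n)"
proof
  show "CARD('i) = m" by fact
  show "4 dvd (\<Sum>n<m. hnorm (B ! k ! n))" if "k < m" for k
    using assms(2) that by (simp add: check_gram_def sum_list_upt list_all_iff)
  show "\<exists>g. (\<Sum>n<m. B ! k ! n * hcnj (B ! l ! n)) = 2 * ht * g" if "k < l" "l < m" for k l
  proof -
    have "(\<Sum>n<m. B ! k ! n * hcnj (B ! l ! n)) = Hz 2 2 0 0 * half_div (\<Sum>n<m. B ! k ! n * hcnj (B ! l ! n))"
      using assms(2) that by (simp add: check_gram_def sum_list_upt list_all_iff Let_def)
    moreover have "2 * ht = Hz 2 2 0 0" by (simp add: numeral_hz)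
    ultimately show ?thesis by metis
  qed
qed

text \<open>A power of \<open>h\<close> makes the residue vector monic. Generators then lower it
  lexicographically until it is one of the vectors with an explicit frame, and
  \<open>good_rmul\<close> carries goodness back along the descent.\<close>

lemma good_of_certificate:
  assumes lat: "hurwitz_lattice TYPE('i::finite) m (\<lambda>k n. B ! k ! n)" and "\<mu> > 0"
    and gens: "list_all (check_gen m B) G"
    and frames: "list_all (check_frame m B \<mu>) R"
    and descent: "check_descent (map fst R) (map (residue_cols m \<circ> snd) G) (monic_f4 m)"
    and a: "\<exists>k<m. residue (a k) \<noteq> 0"
  shows "hurwitz_lattice.good m (\<lambda>k n. B ! k ! n) \<mu> (emb (comb m (\<lambda>k n. B ! k ! n) a) :: quat ^ 'i)"
proof -
  interpret hurwitz_lattice "TYPE('i)" m "\<lambda>k n. B ! k ! n" \<mu> by (rule lat)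
  define rl where "rl a = map (\<lambda>k. residue (a k)) [0..<m]" for a :: "nat \<Rightarrow> hz"
  have len: "length (rl a) = m" for a by (simp add: rl_def)
  have frame: "good (emb (cmb a))" if "x = rl a" "(x, A) \<in> set R" for a x A
  proof (rule good_of_frame[of "\<lambda>l k. A ! l ! k"])
    have c: "check_frame m B \<mu> (x, A)" using frames that(2) by (simp add: list_all_iff)
    show "residue (A ! l ! k) = residue (a k)" if "l < m" "k < m" for l k
      using c that \<open>x = rl a\<close> by (auto simp: check_frame_def list_all_iff rl_def)
    show "(\<Sum>n<m. hnorm (cmb ((!) (A ! l)) n)) = 2 * \<mu>" if "l < m" for l
      using c that by (simp add: check_frame_def list_all_iff sum_list_upt lcomb_eq Let_def)
    show "(\<Sum>l<m. hcnj (cmb ((!) (A ! l)) n) * cmb ((!) (A ! l)) n') = (if n = n' then of_int (2 * \<mu>) else 0)"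
      if "n < m" "n' < m" for n n'
      using c that by (simp add: check_frame_def list_all_iff sum_list_upt lcomb_eq Let_def of_int_hz del: of_int_mult)
  qed fact
  have desc: "good (emb (cmb a))" if "good (emb (cmb a'))" and gen: "(d, M) \<in> set G"
    and a': "a' = comb m (\<lambda>k l. M ! k ! l) a" for d M a a'
  proof (rule good_rmul[of "\<lambda>k l. M ! k ! l" "(!) d"])
    have c: "check_gen m B (d, M)" using gens gen by (simp add: list_all_iff)
    show "comb m (\<lambda>k n. B ! k ! n) ((!) (M ! k)) n = B ! k ! n * d ! n" if "k < m" "n < m" for k n
      using c that by (simp add: check_gen_def list_all_iff lcomb_eq)
    show "d ! n * d ! n * d ! n * d ! n = 1" if "n < m" for n
      using c that by (simp add: check_gen_def list_all_iff)
    show "good (emb (cmb (comb m (\<lambda>k. (!) (M ! k)) a)))" using that(1) unfolding a' .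
  qed
  have rl_comb: "rl (comb m (\<lambda>k l. M ! k ! l) a) = vec_cols (rl a) (residue_cols m M)" for M a
  proof -
    have "sum_list (map2 (*) (rl a) (map (\<lambda>k. residue (M ! k ! l)) [0..<m])) = (\<Sum>k<m. residue (a k) * residue (M ! k ! l))" for l
      unfolding rl_def zip_map_map map_map by (simp add: zip_same_conv_map comp_def sum_list_upt)
    then show ?thesis
      by (simp add: rl_def[of "comb _ _ _"] vec_cols_def dot_f4_eq residue_cols_def comb_def residue_sum residue_mult comp_def)
  qed
  have monic: "good (emb (cmb a))" if "rl a \<in> set (monic_f4 m)" for a
    using that
  proof (induction "rl a" arbitrary: a rule: wf_induct_rule[OF wf_lex_f4])
    case 1
    show ?case
    proof (cases "rl a \<in> fst ` set R")
      case True
      then show ?thesis using frame by force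
    next
      case False
      then have "rl a \<notin> set (map fst R)" by simp
      then have "descent_step (rl a) (map (residue_cols m \<circ> snd) G)"
        using descent 1(2) unfolding check_descent_def list_all_iff by metis
      then obtain C where C: "C \<in> set (map (residue_cols m \<circ> snd) G)"
          "lex_less (vec_cols (rl a) C) (rl a)" "is_monic (vec_cols (rl a) C)"
        by (rule descent_stepE)
      then obtain d M where dM: "(d, M) \<in> set G" and lt: "lex_less (vec_cols (rl a) (residue_cols m M)) (rl a)"
          "is_monic (vec_cols (rl a) (residue_cols m M))"
        by auto
      define a' where "a' = comb m (\<lambda>k l. M ! k ! l) a"
      have "rl a' = vec_cols (rl a) (residue_cols m M)" unfolding a'_def by (rule rl_comb)
      then have "good (emb (cmb a'))"
        using lt lex_less_lex len is_monic_in_monic_f4 by (intro 1(1)) metis+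
      then show ?thesis using desc dM a'_def by blast
    qed
  qed
  \<comment> \<open>\<open>f\<close> multiplies by \<open>h\<close>, whose sixth power is 1; hence
    \<open>6 - j\<close> further applications undo the first \<open>j\<close>.\<close>
  define f where "f = lmul (quat_of (Hz 0 0 0 1)) \<circ> (id :: quat ^ 'i \<Rightarrow> _)"
  have good_f: "good ((f ^^ j) v)" if "good v" for j v
    by (induction j) (auto simp: f_def that intro: good_left_unit)
  have f_emb: "(f ^^ j) (emb (cmb a)) = emb (cmb (\<lambda>k. Hz 0 0 0 1 ^ j * a k))" for j
  proof (induction j)
    case (Suc j)
    then show ?case by (simp add: f_def lmul_emb comb_mult mult.assoc)
  qed simp
  have "\<exists>x\<in>set (rl a). x \<noteq> 0" using a by (auto simp: rl_def)
  then obtain u where u: "u \<noteq> 0" "map ((*) u) (rl a) \<in> set (monic_f4 m)"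
    using len monic_f4E by metis
  have "\<exists>j\<le>6. residue (Hz 0 0 0 1 ^ j) = u"
  proof -
    have "residue (Hz 0 0 0 1 ^ 0) = F1" "residue (Hz 0 0 0 1 ^ 1) = Fw" "residue (Hz 0 0 0 1 ^ 2) = Fv"
      by (simp_all add: one_hz_def power2_eq_square)
    then show ?thesis using u(1) by (cases u) (auto simp: zero_f4_def intro: exI[of _ 0] exI[of _ 1] exI[of _ 2])
  qed
  then obtain j where j: "j \<le> 6" "residue (Hz 0 0 0 1 ^ j) = u" by blast
  have "rl (\<lambda>k. Hz 0 0 0 1 ^ j * a k) = map ((*) u) (rl a)"
    unfolding rl_def by (simp add: residue_mult j(2))
  then have "good ((f ^^ j) (emb (cmb a)))"
    unfolding f_emb using u(2) by (intro monic) simp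
  then have "good ((f ^^ (6 - j)) ((f ^^ j) (emb (cmb a))))" by (rule good_f)
  also have "(f ^^ (6 - j)) ((f ^^ j) (emb (cmb a))) = (f ^^ 6) (emb (cmb a))"
    using j(1) by (metis comp_apply funpow_add le_add_diff_inverse2)
  also have "\<dots> = emb (cmb a)"
    unfolding f_emb by (simp add: eval_nat_numeral one_hz_def[symmetric])
  finally show ?thesis .
qed

section \<open>Bases, automorphisms and frames of the three quaternionic lattices\<close>

definition "D4_basis = [[Hz 2 0 0 0]]"
definition "D4_frames = [([F1], [[Hz 1 0 0 0]])]"

text \<open>The pairs of left multiples of \<open>1 + i\<close> whose difference is divisible by
  2.\<close>

definition "E8_basis = [[Hz 1 1 0 0, Hz 1 1 0 0], [Hz 0 0 0 0, Hz 2 0 0 0]]"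
definition "E8_gens =
  [([Hz 1 0 0 0, Hz 0 1 0 0], [[Hz 1 0 0 0, Hz (- 1) 0 0 0], [Hz 0 0 0 0, Hz 0 1 0 0]]),
   ([Hz 1 0 0 0, Hz 0 0 1 0], [[Hz 1 0 0 0, Hz (- 1) (- 1) 0 1], [Hz 0 0 0 0, Hz 0 0 1 0]])]"
definition "E8_frames =
  [([F1, F0], [[Hz 1 0 0 0, Hz 0 0 0 0], [Hz 1 0 0 0, Hz (- 1) (- 1) 0 0]]),
   ([F0, F1], [[Hz 0 0 0 0, Hz 1 0 0 0], [Hz 1 (- 1) 0 0, Hz (- 1) 0 0 0]])]"

text \<open>The rows refine the chain of the repetition code modulo \<open>T\<close>, \<open>T\<close> times the hexacode, \<open>2\<close> times the
  parity check code and \<open>2 T\<close>; the last entry of the first row is \<open>i + j + k\<close>. The diagonal matrices in \<open>leech_gens\<close>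
  were found by computer; modulo \<open>T\<close> they have twelve orbits on the lines of the lattice, represented in \<open>leech_frames\<close>.\<close>

definition leech_basis :: "hz list list" where
  "leech_basis =
    [[Hz 1 0 0 0, Hz 1 0 0 0, Hz 1 0 0 0, Hz 1 0 0 0, Hz 1 0 0 0, Hz (- 1) 0 0 2],
     [Hz 0 0 0 0, Hz 1 1 0 0, Hz 0 0 0 0, Hz 1 0 1 (- 2), Hz 1 0 1 (- 2), Hz 1 1 0 0],
     [Hz 0 0 0 0, Hz 0 0 0 0, Hz 1 1 0 0, Hz 1 1 0 0, Hz 1 0 1 (- 2), Hz 1 0 1 (- 2)],
     [Hz 0 0 0 0, Hz 0 0 0 0, Hz 0 0 0 0, Hz 2 0 0 0, Hz 0 0 0 0, Hz 2 0 0 0],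
     [Hz 0 0 0 0, Hz 0 0 0 0, Hz 0 0 0 0, Hz 0 0 0 0, Hz 2 0 0 0, Hz 2 0 0 0],
     [Hz 0 0 0 0, Hz 0 0 0 0, Hz 0 0 0 0, Hz 0 0 0 0, Hz 0 0 0 0, Hz 2 2 0 0]]"

definition leech_gens :: "(hz list \<times> hz list list) list" where
  "leech_gens =
    [([Hz 0 0 1 0, Hz 0 (- 1) 0 0, Hz 0 (- 1) 0 0, Hz (- 1) 0 0 0, Hz 0 0 1 0, Hz (- 1) 0 0 0],
      [[Hz 0 0 1 0, Hz 0 0 0 (- 1), Hz 0 0 0 (- 1), Hz 0 0 0 0, Hz 1 (- 1) 0 0, Hz 0 0 0 0],
       [Hz 0 0 0 0, Hz 0 (- 1) 0 0, Hz 0 0 0 0, Hz 0 0 0 1, Hz 1 1 1 (- 1), Hz (- 1) 1 0 (- 1)],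
       [Hz 0 0 0 0, Hz 0 0 0 0, Hz 0 (- 1) 0 0, Hz (- 1) 0 0 0, Hz 1 1 1 (- 1), Hz 0 (- 1) (- 1) 1],
       [Hz 0 0 0 0, Hz 0 0 0 0, Hz 0 0 0 0, Hz (- 1) 0 0 0, Hz 0 0 0 0, Hz 0 0 0 0],
       [Hz 0 0 0 0, Hz 0 0 0 0, Hz 0 0 0 0, Hz 0 0 0 0, Hz 0 0 1 0, Hz 0 1 0 (- 1)],
       [Hz 0 0 0 0, Hz 0 0 0 0, Hz 0 0 0 0, Hz 0 0 0 0, Hz 0 0 0 0, Hz (- 1) 0 0 0]]),
     ([Hz 0 0 1 0, Hz 0 0 (- 1) 0, Hz 0 1 0 0, Hz 0 (- 1) 0 0, Hz (- 1) (- 1) (- 1) 2, Hz (- 1) (- 1) (- 1) 2],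
      [[Hz 0 0 1 0, Hz 1 1 0 (- 2), Hz 1 1 0 (- 1), Hz 0 (- 2) (- 1) 1, Hz (- 1) (- 2) (- 3) 3, Hz 0 1 1 1],
       [Hz 0 0 0 0, Hz 1 1 1 (- 2), Hz 0 0 0 0, Hz 0 0 0 0, Hz 1 0 0 0, Hz (- 1) 0 (- 1) 1],
       [Hz 0 0 0 0, Hz 0 0 0 0, Hz 0 1 0 0, Hz 1 (- 1) 0 0, Hz 0 0 0 0, Hz 0 1 0 0],
       [Hz 0 0 0 0, Hz 0 0 0 0, Hz 0 0 0 0, Hz 0 (- 1) 0 0, Hz 0 0 0 0, Hz 0 0 (- 1) 1],
       [Hz 0 0 0 0, Hz 0 0 0 0, Hz 0 0 0 0, Hz 0 0 0 0, Hz (- 1) (- 1) (- 1) 2, Hz 0 0 0 0],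
       [Hz 0 0 0 0, Hz 0 0 0 0, Hz 0 0 0 0, Hz 0 0 0 0, Hz 0 0 0 0, Hz 0 0 (- 1) 0]]),
     ([Hz 1 0 0 0, Hz 0 1 0 0, Hz 1 1 1 (- 2), Hz 0 (- 1) 0 0, Hz (- 1) (- 1) (- 1) 2, Hz 1 0 0 0],
      [[Hz 1 0 0 0, Hz 0 1 0 0, Hz 0 1 1 (- 1), Hz (- 1) (- 1) (- 1) 1, Hz (- 1) 0 (- 1) 0, Hz 1 (- 1) 1 0],
       [Hz 0 0 0 0, Hz 0 1 0 0, Hz 0 0 0 0, Hz (- 1) 0 0 0, Hz 0 0 0 0, Hz 1 (- 1) 0 0],
       [Hz 0 0 0 0, Hz 0 0 0 0, Hz 0 0 1 0, Hz 0 (- 1) (- 1) 1, Hz 1 1 1 (- 1), Hz 0 1 1 (- 1)],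
       [Hz 0 0 0 0, Hz 0 0 0 0, Hz 0 0 0 0, Hz 0 (- 1) 0 0, Hz 0 0 0 0, Hz 1 0 0 0],
       [Hz 0 0 0 0, Hz 0 0 0 0, Hz 0 0 0 0, Hz 0 0 0 0, Hz (- 1) (- 1) (- 1) 2, Hz 1 0 1 (- 1)],
       [Hz 0 0 0 0, Hz 0 0 0 0, Hz 0 0 0 0, Hz 0 0 0 0, Hz 0 0 0 0, Hz 1 0 0 0]]),
     ([Hz 1 0 0 0, Hz 1 0 0 0, Hz (- 1) 0 0 0, Hz (- 1) 0 0 0, Hz (- 1) 0 0 0, Hz (- 1) 0 0 0],
      [[Hz 1 0 0 0, Hz 0 0 0 0, Hz (- 1) 1 0 0, Hz 0 0 0 0, Hz (- 1) 0 0 (- 1), Hz 1 0 1 (- 2)],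
       [Hz 0 0 0 0, Hz 1 0 0 0, Hz 0 0 0 0, Hz (- 1) 0 (- 1) 2, Hz (- 1) 0 (- 1) 2, Hz (- 1) 0 2 (- 2)],
       [Hz 0 0 0 0, Hz 0 0 0 0, Hz (- 1) 0 0 0, Hz 0 0 0 0, Hz 0 0 0 0, Hz 0 0 0 0],
       [Hz 0 0 0 0, Hz 0 0 0 0, Hz 0 0 0 0, Hz (- 1) 0 0 0, Hz 0 0 0 0, Hz 0 0 0 0],
       [Hz 0 0 0 0, Hz 0 0 0 0, Hz 0 0 0 0, Hz 0 0 0 0, Hz (- 1) 0 0 0, Hz 0 0 0 0],
       [Hz 0 0 0 0, Hz 0 0 0 0, Hz 0 0 0 0, Hz 0 0 0 0, Hz 0 0 0 0, Hz (- 1) 0 0 0]]),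
     ([Hz 0 0 1 0, Hz 0 0 (- 1) 0, Hz 1 1 1 (- 2), Hz 1 1 1 (- 2), Hz 1 0 0 0, Hz (- 1) 0 0 0],
      [[Hz 0 0 1 0, Hz 1 1 0 (- 2), Hz 1 1 1 (- 2), Hz 0 (- 1) (- 1) 1, Hz 1 (- 1) (- 2) 1, Hz (- 1) 0 1 1],
       [Hz 0 0 0 0, Hz 1 1 1 (- 2), Hz 0 0 0 0, Hz 0 0 (- 1) 0, Hz 1 0 0 (- 1), Hz (- 2) (- 1) (- 1) 3],
       [Hz 0 0 0 0, Hz 0 0 0 0, Hz 0 0 1 0, Hz 0 0 0 0, Hz 1 1 1 (- 2), Hz 0 0 (- 1) 1],
       [Hz 0 0 0 0, Hz 0 0 0 0, Hz 0 0 0 0, Hz 1 1 1 (- 2), Hz 0 0 0 0, Hz (- 1) 0 (- 1) 1],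
       [Hz 0 0 0 0, Hz 0 0 0 0, Hz 0 0 0 0, Hz 0 0 0 0, Hz 1 0 0 0, Hz (- 1) 1 0 0],
       [Hz 0 0 0 0, Hz 0 0 0 0, Hz 0 0 0 0, Hz 0 0 0 0, Hz 0 0 0 0, Hz (- 1) 0 0 0]]),
     ([Hz 1 0 0 0, Hz 1 0 0 0, Hz 1 0 0 0, Hz 1 0 0 0, Hz (- 1) 0 0 0, Hz (- 1) 0 0 0],
      [[Hz 1 0 0 0, Hz 0 0 0 0, Hz 0 0 0 0, Hz 0 0 0 0, Hz (- 1) 0 0 0, Hz 1 0 1 (- 2)],
       [Hz 0 0 0 0, Hz 1 0 0 0, Hz 0 0 0 0, Hz 0 0 0 0, Hz (- 1) 0 (- 1) 2, Hz (- 1) 0 1 (- 1)],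
       [Hz 0 0 0 0, Hz 0 0 0 0, Hz 1 0 0 0, Hz 0 0 0 0, Hz (- 1) 0 (- 1) 2, Hz 0 0 0 0],
       [Hz 0 0 0 0, Hz 0 0 0 0, Hz 0 0 0 0, Hz 1 0 0 0, Hz 0 0 0 0, Hz (- 1) 1 0 0],
       [Hz 0 0 0 0, Hz 0 0 0 0, Hz 0 0 0 0, Hz 0 0 0 0, Hz (- 1) 0 0 0, Hz 0 0 0 0],
       [Hz 0 0 0 0, Hz 0 0 0 0, Hz 0 0 0 0, Hz 0 0 0 0, Hz 0 0 0 0, Hz (- 1) 0 0 0]]),
     ([Hz 0 0 1 0, Hz 0 0 1 0, Hz 0 0 (- 1) 0, Hz 0 0 1 0, Hz 0 0 1 0, Hz 0 0 (- 1) 0],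
      [[Hz 0 0 1 0, Hz 0 0 0 0, Hz 1 1 0 (- 2), Hz 0 0 1 0, Hz 0 (- 1) (- 1) 1, Hz 1 0 0 (- 1)],
       [Hz 0 0 0 0, Hz (- 1) (- 1) (- 1) 2, Hz 0 0 0 0, Hz 0 1 1 (- 1), Hz 0 1 1 (- 1), Hz 1 0 0 (- 2)],
       [Hz 0 0 0 0, Hz 0 0 0 0, Hz 1 1 1 (- 2), Hz (- 1) (- 1) 0 2, Hz 1 1 0 (- 1), Hz 0 0 0 (- 1)],
       [Hz 0 0 0 0, Hz 0 0 0 0, Hz 0 0 0 0, Hz 0 0 1 0, Hz 0 0 0 0, Hz 1 1 0 (- 2)],
       [Hz 0 0 0 0, Hz 0 0 0 0, Hz 0 0 0 0, Hz 0 0 0 0, Hz 0 0 1 0, Hz 1 1 0 (- 2)],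
       [Hz 0 0 0 0, Hz 0 0 0 0, Hz 0 0 0 0, Hz 0 0 0 0, Hz 0 0 0 0, Hz 1 1 1 (- 2)]]),
     ([Hz 0 1 0 0, Hz 0 (- 1) 0 0, Hz (- 1) (- 1) (- 1) 2, Hz (- 1) (- 1) (- 1) 2, Hz 0 0 1 0, Hz 0 0 (- 1) 0],
      [[Hz 0 1 0 0, Hz (- 1) (- 1) 0 0, Hz (- 1) (- 1) (- 1) 1, Hz 1 0 1 (- 1), Hz 1 (- 1) 2 (- 1), Hz 2 2 0 (- 1)],
       [Hz 0 0 0 0, Hz 0 (- 1) 0 0, Hz 0 0 0 0, Hz 1 0 1 0, Hz 1 1 1 (- 1), Hz 0 2 0 (- 2)],
       [Hz 0 0 0 0, Hz 0 0 0 0, Hz 0 0 (- 1) 0, Hz 0 0 0 0, Hz 0 0 0 0, Hz (- 1) (- 1) (- 1) 1],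
       [Hz 0 0 0 0, Hz 0 0 0 0, Hz 0 0 0 0, Hz (- 1) (- 1) (- 1) 2, Hz 0 0 0 0, Hz 1 1 1 (- 2)],
       [Hz 0 0 0 0, Hz 0 0 0 0, Hz 0 0 0 0, Hz 0 0 0 0, Hz 0 0 1 0, Hz 1 1 0 (- 2)],
       [Hz 0 0 0 0, Hz 0 0 0 0, Hz 0 0 0 0, Hz 0 0 0 0, Hz 0 0 0 0, Hz 1 1 1 (- 2)]]),
     ([Hz 0 0 1 0, Hz 0 0 (- 1) 0, Hz 0 0 1 0, Hz 0 0 1 0, Hz 0 0 (- 1) 0, Hz 0 0 1 0],
      [[Hz 0 0 1 0, Hz 1 1 0 (- 2), Hz 0 0 0 0, Hz 0 (- 1) (- 1) 1, Hz 0 (- 1) (- 2) 1, Hz (- 2) (- 1) 0 3],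
       [Hz 0 0 0 0, Hz 1 1 1 (- 2), Hz 0 0 0 0, Hz 1 1 0 (- 1), Hz 0 (- 1) (- 1) 1, Hz (- 2) (- 1) (- 1) 3],
       [Hz 0 0 0 0, Hz 0 0 0 0, Hz (- 1) (- 1) (- 1) 2, Hz 0 0 0 0, Hz (- 1) (- 1) 0 1, Hz 1 1 1 (- 1)],
       [Hz 0 0 0 0, Hz 0 0 0 0, Hz 0 0 0 0, Hz 0 0 1 0, Hz 0 0 0 0, Hz 0 0 0 0],
       [Hz 0 0 0 0, Hz 0 0 0 0, Hz 0 0 0 0, Hz 0 0 0 0, Hz 0 0 (- 1) 0, Hz (- 1) (- 1) 0 2],
       [Hz 0 0 0 0, Hz 0 0 0 0, Hz 0 0 0 0, Hz 0 0 0 0, Hz 0 0 0 0, Hz (- 1) (- 1) (- 1) 2]]),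
     ([Hz 0 0 1 0, Hz 0 0 1 0, Hz 0 0 1 0, Hz 0 0 1 0, Hz 0 0 1 0, Hz 0 0 1 0],
      [[Hz 0 0 1 0, Hz 0 0 0 0, Hz 0 0 0 0, Hz 0 0 0 0, Hz 0 0 0 0, Hz (- 1) (- 1) (- 1) 1],
       [Hz 0 0 0 0, Hz (- 1) (- 1) (- 1) 2, Hz 0 0 0 0, Hz 0 1 1 (- 1), Hz 0 1 1 (- 1), Hz 0 (- 1) (- 1) 0],
       [Hz 0 0 0 0, Hz 0 0 0 0, Hz (- 1) (- 1) (- 1) 2, Hz 0 0 0 0, Hz 0 1 1 (- 1), Hz 0 0 0 0],
       [Hz 0 0 0 0, Hz 0 0 0 0, Hz 0 0 0 0, Hz 0 0 1 0, Hz 0 0 0 0, Hz 0 0 0 0],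
       [Hz 0 0 0 0, Hz 0 0 0 0, Hz 0 0 0 0, Hz 0 0 0 0, Hz 0 0 1 0, Hz 0 0 0 0],
       [Hz 0 0 0 0, Hz 0 0 0 0, Hz 0 0 0 0, Hz 0 0 0 0, Hz 0 0 0 0, Hz (- 1) (- 1) (- 1) 2]]),
     ([Hz 1 0 0 0, Hz 0 0 1 0, Hz (- 1) (- 1) (- 1) 2, Hz 1 0 0 0, Hz 0 0 (- 1) 0, Hz 1 1 1 (- 2)],
      [[Hz 1 0 0 0, Hz (- 1) 0 0 1, Hz (- 1) 0 (- 1) 1, Hz 1 1 1 (- 2), Hz (- 1) 0 0 (- 1), Hz 0 (- 2) (- 1) 1],
       [Hz 0 0 0 0, Hz (- 1) (- 1) (- 1) 2, Hz 0 0 0 0, Hz 0 0 1 (- 1), Hz (- 1) (- 1) 0 1, Hz 2 1 1 (- 2)],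
       [Hz 0 0 0 0, Hz 0 0 0 0, Hz 0 0 (- 1) 0, Hz 1 1 1 (- 1), Hz (- 1) (- 2) (- 1) 2, Hz 0 1 0 (- 1)],
       [Hz 0 0 0 0, Hz 0 0 0 0, Hz 0 0 0 0, Hz 1 0 0 0, Hz 0 0 0 0, Hz 0 1 1 (- 1)],
       [Hz 0 0 0 0, Hz 0 0 0 0, Hz 0 0 0 0, Hz 0 0 0 0, Hz 0 0 (- 1) 0, Hz 0 0 1 0],
       [Hz 0 0 0 0, Hz 0 0 0 0, Hz 0 0 0 0, Hz 0 0 0 0, Hz 0 0 0 0, Hz 0 0 1 0]]),
     ([Hz 0 1 0 0, Hz 0 1 0 0, Hz 0 1 0 0, Hz 0 1 0 0, Hz 0 1 0 0, Hz 0 1 0 0],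
      [[Hz 0 1 0 0, Hz 0 0 0 0, Hz 0 0 0 0, Hz 0 0 0 0, Hz 0 0 0 0, Hz 0 0 1 0],
       [Hz 0 0 0 0, Hz 0 1 0 0, Hz 0 0 0 0, Hz 0 0 (- 1) 0, Hz 0 0 (- 1) 0, Hz (- 1) (- 1) 0 2],
       [Hz 0 0 0 0, Hz 0 0 0 0, Hz 0 1 0 0, Hz 0 0 0 0, Hz 0 0 (- 1) 0, Hz 0 0 0 0],
       [Hz 0 0 0 0, Hz 0 0 0 0, Hz 0 0 0 0, Hz 0 1 0 0, Hz 0 0 0 0, Hz 0 0 0 0],
       [Hz 0 0 0 0, Hz 0 0 0 0, Hz 0 0 0 0, Hz 0 0 0 0, Hz 0 1 0 0, Hz 0 0 0 0],
       [Hz 0 0 0 0, Hz 0 0 0 0, Hz 0 0 0 0, Hz 0 0 0 0, Hz 0 0 0 0, Hz 0 1 0 0]])]"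

definition leech_frames :: "(f4 list \<times> hz list list) list" where
  "leech_frames =
    [([F1, F0, F0, F0, F0, F0],
      [[Hz (- 1) 0 0 2, Hz 1 0 1 (- 2), Hz 0 1 1 (- 2), Hz 2 0 0 0, Hz 2 0 0 (- 2), Hz (- 1) 0 (- 1) 2],
       [Hz 1 0 0 0, Hz (- 1) 0 (- 1) 2, Hz 0 0 0 0, Hz (- 2) 0 0 0, Hz (- 2) 0 0 0, Hz 3 (- 2) 1 (- 2)],
       [Hz 1 0 0 0, Hz (- 1) 1 0 0, Hz 0 1 1 (- 2), Hz 0 0 0 0, Hz 0 0 0 (- 2), Hz 1 (- 1) 0 0],
       [Hz 1 0 0 0, Hz (- 1) 1 0 0, Hz (- 1) 1 0 0, Hz 0 0 0 0, Hz 0 0 0 (- 2), Hz 1 (- 1) 0 0],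
       [Hz 1 0 0 0, Hz 0 0 0 0, Hz (- 1) 1 0 0, Hz 0 0 0 0, Hz 0 0 0 (- 2), Hz 0 0 0 0],
       [Hz 1 0 0 0, Hz 0 0 0 0, Hz 0 0 0 0, Hz 0 0 0 0, Hz 0 0 0 0, Hz 0 0 0 0]]),
     ([F0, F1, F0, F0, F0, F0],
      [[Hz 1 0 1 (- 2), Hz (- 1) 0 (- 2) 2, Hz 0 0 (- 2) 2, Hz (- 1) (- 1) 0 0, Hz (- 4) (- 2) (- 2) 4, Hz 2 0 2 (- 2)],
       [Hz 1 0 1 (- 2), Hz 1 0 0 0, Hz 0 0 (- 2) 2, Hz 0 0 0 0, Hz (- 3) (- 1) (- 2) 4, Hz (- 2) 0 0 0],
       [Hz 1 1 0 0, Hz (- 1) 0 0 0, Hz 0 0 0 0, Hz (- 1) (- 1) 0 0, Hz 1 0 1 (- 2), Hz 2 0 0 0],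
       [Hz 1 1 0 0, Hz (- 1) 0 0 0, Hz 0 0 0 0, Hz 1 0 1 (- 2), Hz (- 1) (- 1) 0 0, Hz 2 0 0 0],
       [Hz 0 0 0 0, Hz 1 0 0 0, Hz 0 0 0 0, Hz 0 0 0 0, Hz 0 0 0 0, Hz 0 0 0 0],
       [Hz 0 0 0 0, Hz 1 0 0 0, Hz 0 0 0 0, Hz (- 1) 0 (- 1) 2, Hz (- 1) 0 (- 1) 2, Hz 0 0 2 (- 2)]]),
     ([F0, F1, F1, F0, F0, F0],
      [[Hz (- 2) (- 1) (- 1) 2, Hz 1 0 2 (- 2), Hz 1 0 2 (- 2), Hz 1 1 0 0, Hz 3 2 1 (- 2), Hz (- 2) 0 (- 2) 2],
       [Hz (- 2) (- 1) (- 1) 2, Hz 1 0 0 0, Hz 1 0 0 0, Hz 0 0 0 0, Hz (- 1) 0 (- 1) 2, Hz 0 0 0 0],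
       [Hz 1 1 0 0, Hz (- 1) 0 0 0, Hz (- 1) 0 0 0, Hz 1 0 1 (- 2), Hz 0 (- 1) 1 (- 2), Hz 2 0 0 0],
       [Hz 1 1 0 0, Hz (- 1) 0 0 0, Hz (- 1) 0 0 0, Hz 0 0 0 0, Hz 0 (- 1) 1 (- 2), Hz 2 0 0 0],
       [Hz 0 0 0 0, Hz 1 0 0 0, Hz (- 1) 0 0 0, Hz (- 1) 0 (- 1) 2, Hz 0 0 0 0, Hz 0 0 2 (- 2)],
       [Hz 0 0 0 0, Hz 1 0 0 0, Hz (- 1) 0 0 0, Hz 1 1 0 0, Hz 0 0 0 0, Hz (- 2) 0 0 0]]),
     ([F0, F1, Fv, F0, F0, F0],
      [[Hz 1 0 1 (- 2), Hz (- 1) 0 (- 2) 2, Hz 0 0 (- 1) 1, Hz (- 1) (- 1) 0 0, Hz (- 4) (- 2) (- 2) 4, Hz 2 0 2 (- 2)],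
       [Hz 1 0 1 (- 2), Hz 1 0 0 0, Hz 0 0 (- 1) 1, Hz 0 0 0 0, Hz (- 1) 0 (- 1) 2, Hz (- 2) 0 0 0],
       [Hz 1 1 0 0, Hz (- 1) 0 0 0, Hz (- 2) 0 (- 1) 1, Hz 1 0 1 (- 2), Hz 0 (- 1) 1 (- 2), Hz 2 0 0 0],
       [Hz 1 1 0 0, Hz (- 1) 0 0 0, Hz 0 0 1 (- 1), Hz (- 1) (- 1) 0 0, Hz 1 0 1 (- 2), Hz 2 0 0 0],
       [Hz 0 0 0 0, Hz 1 0 0 0, Hz 0 0 1 (- 1), Hz (- 1) 0 (- 1) 2, Hz 0 0 0 0, Hz 0 0 2 (- 2)],
       [Hz 0 0 0 0, Hz 1 0 0 0, Hz 0 0 (- 1) 1, Hz 0 0 0 0, Hz (- 2) (- 1) (- 1) 2, Hz 0 0 0 0]]),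
     ([F0, F1, Fw, F0, F0, F0],
      [[Hz (- 2) (- 1) (- 1) 2, Hz 1 0 2 (- 2), Hz 1 0 1 (- 1), Hz 1 1 0 0, Hz 3 2 1 (- 2), Hz (- 2) 0 (- 2) 2],
       [Hz (- 2) (- 1) (- 1) 2, Hz 1 0 0 0, Hz 1 0 1 (- 1), Hz 0 0 0 0, Hz 1 1 0 0, Hz 0 0 0 0],
       [Hz 1 1 0 0, Hz (- 1) 0 0 0, Hz (- 1) 0 1 (- 1), Hz 0 0 0 0, Hz 2 0 2 (- 4), Hz 2 0 0 0],
       [Hz 1 1 0 0, Hz (- 1) 0 0 0, Hz (- 1) 0 (- 1) 1, Hz 1 0 1 (- 2), Hz (- 1) (- 1) 0 0, Hz 2 0 0 0],
       [Hz 0 0 0 0, Hz 1 0 0 0, Hz (- 1) 0 (- 1) 1, Hz 1 1 0 0, Hz 0 0 0 0, Hz (- 2) 0 0 0],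
       [Hz 0 0 0 0, Hz 1 0 0 0, Hz 1 0 1 (- 1), Hz (- 1) 0 (- 1) 2, Hz (- 1) 0 (- 1) 2, Hz 0 0 2 (- 2)]]),
     ([F0, F0, F1, F0, F0, F0],
      [[Hz 1 0 1 (- 2), Hz 0 0 (- 2) 2, Hz (- 1) 0 (- 2) 2, Hz 0 0 0 0, Hz (- 4) (- 2) (- 2) 4, Hz 0 0 2 (- 2)],
       [Hz 1 0 1 (- 2), Hz 0 0 (- 2) 2, Hz 1 0 0 0, Hz (- 4) (- 2) (- 2) 4, Hz (- 3) (- 1) (- 2) 4, Hz 2 0 4 (- 4)],
       [Hz 1 1 0 0, Hz 0 0 0 0, Hz (- 1) 0 0 0, Hz 0 0 0 0, Hz (- 1) (- 1) 0 0, Hz 2 0 2 (- 2)],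
       [Hz 1 1 0 0, Hz 0 0 0 0, Hz (- 1) 0 0 0, Hz 0 0 0 0, Hz 1 0 1 (- 2), Hz 0 0 0 0],
       [Hz 0 0 0 0, Hz 0 0 0 0, Hz 1 0 0 0, Hz 0 0 0 0, Hz 0 0 0 0, Hz 0 0 0 0],
       [Hz 0 0 0 0, Hz 0 0 0 0, Hz 1 0 0 0, Hz 0 0 0 0, Hz (- 1) 0 (- 1) 2, Hz 0 0 0 0]]),
     ([F0, F0, F0, F1, F0, F0],
      [[Hz (- 2) 0 0 2, Hz 1 0 1 (- 2), Hz 1 0 1 (- 2), Hz 1 0 0 0, Hz 2 0 0 0, Hz (- 1) 0 (- 1) 2],
       [Hz (- 2) 0 0 2, Hz 1 0 1 (- 2), Hz 1 0 1 (- 2), Hz 1 0 0 0, Hz 4 0 0 (- 2), Hz (- 2) 0 (- 2) 4],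
       [Hz 0 0 0 0, Hz 0 1 1 (- 2), Hz 0 1 1 (- 2), Hz 1 0 0 0, Hz 2 0 0 (- 2), Hz (- 1) 0 (- 1) 2],
       [Hz 0 0 0 0, Hz 0 1 1 (- 2), Hz 0 (- 1) (- 1) 2, Hz 1 0 0 (- 2), Hz 0 0 0 0, Hz (- 1) (- 1) (- 2) 4],
       [Hz 0 0 0 0, Hz 0 0 0 0, Hz 0 0 0 0, Hz 1 0 0 0, Hz 0 0 0 0, Hz (- 1) 1 0 0],
       [Hz 0 0 0 0, Hz 0 0 0 0, Hz 0 0 0 0, Hz 1 0 0 0, Hz 0 0 0 0, Hz 0 0 0 0]]),
     ([F0, F0, F0, F1, F1, F0],
      [[Hz 0 0 0 (- 2), Hz 0 (- 1) (- 1) 2, Hz 0 0 0 0, Hz (- 1) 0 0 2, Hz (- 1) 0 0 2, Hz 0 2 2 (- 4)],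
       [Hz 0 0 0 (- 2), Hz 0 (- 1) (- 1) 2, Hz 0 (- 2) (- 2) 4, Hz (- 1) 0 0 0, Hz (- 3) 0 0 4, Hz 0 1 1 (- 2)],
       [Hz 0 0 0 0, Hz (- 1) 0 (- 1) 2, Hz 0 0 0 0, Hz (- 1) 0 0 0, Hz (- 1) 0 0 0, Hz 1 (- 1) 0 0],
       [Hz 0 0 0 0, Hz (- 1) 0 (- 1) 2, Hz 0 0 0 0, Hz (- 1) 0 0 0, Hz (- 1) 0 0 0, Hz 2 (- 1) 1 (- 2)],
       [Hz 0 0 0 0, Hz 0 0 0 0, Hz 0 0 0 0, Hz 1 0 0 0, Hz (- 1) 0 0 0, Hz 0 0 0 0],
       [Hz 0 0 0 0, Hz 0 0 0 0, Hz 0 0 0 0, Hz 1 0 0 0, Hz 1 0 0 0, Hz (- 1) 1 0 0]]),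
     ([F0, F0, F0, F1, Fv, F0],
      [[Hz (- 2) 0 0 2, Hz 1 0 1 (- 2), Hz 1 0 1 (- 2), Hz 1 0 0 0, Hz 3 0 0 (- 1), Hz (- 2) 0 (- 2) 4],
       [Hz (- 2) 0 0 2, Hz 1 0 1 (- 2), Hz 1 0 1 (- 2), Hz 1 0 0 0, Hz 3 0 0 (- 1), Hz (- 1) 0 (- 1) 2],
       [Hz 0 0 0 0, Hz 0 1 1 (- 2), Hz 0 0 0 0, Hz 1 0 0 (- 2), Hz 1 0 0 (- 1), Hz (- 1) (- 1) (- 2) 4],
       [Hz 0 0 0 0, Hz 0 1 1 (- 2), Hz 0 0 0 0, Hz 1 0 0 0, Hz 1 0 0 (- 1), Hz (- 1) 0 (- 1) 2],
       [Hz 0 0 0 0, Hz 0 0 0 0, Hz 1 (- 1) 0 0, Hz (- 1) 0 0 0, Hz (- 1) 0 0 1, Hz 1 (- 1) 0 0],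
       [Hz 0 0 0 0, Hz 0 0 0 0, Hz 1 (- 1) 0 0, Hz (- 1) 0 0 0, Hz 1 0 0 1, Hz 0 0 0 0]]),
     ([F0, F0, F0, F1, Fw, F0],
      [[Hz 0 0 0 (- 2), Hz 0 (- 1) (- 1) 2, Hz 0 (- 1) (- 1) 2, Hz (- 1) 0 0 0, Hz (- 2) 0 0 3, Hz 0 1 1 (- 2)],
       [Hz 0 0 0 (- 2), Hz 0 (- 1) (- 1) 2, Hz 0 (- 1) (- 1) 2, Hz (- 1) 0 0 2, Hz (- 2) 0 0 3, Hz 0 2 2 (- 4)],
       [Hz 0 0 0 0, Hz (- 1) 0 (- 1) 2, Hz 0 0 0 0, Hz (- 1) 0 0 0, Hz (- 2) 0 0 1, Hz 2 (- 1) 1 (- 2)],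
       [Hz 0 0 0 0, Hz (- 1) 0 (- 1) 2, Hz 0 0 0 0, Hz (- 1) 0 0 0, Hz 0 0 0 (- 1), Hz 1 (- 1) 0 0],
       [Hz 0 0 0 0, Hz 0 0 0 0, Hz 1 (- 1) 0 0, Hz (- 1) 0 0 0, Hz 0 0 0 1, Hz 0 0 0 0],
       [Hz 0 0 0 0, Hz 0 0 0 0, Hz 1 (- 1) 0 0, Hz (- 1) 0 0 0, Hz 0 0 0 1, Hz 1 (- 1) 0 0]]),
     ([F0, F0, F0, F0, F1, F0],
      [[Hz 0 0 0 (- 2), Hz 0 0 0 0, Hz 0 (- 1) (- 1) 2, Hz 0 0 0 0, Hz (- 1) 0 0 2, Hz (- 1) 1 0 0],
       [Hz 0 0 0 (- 2), Hz 0 (- 2) (- 2) 4, Hz 0 (- 1) (- 1) 2, Hz (- 2) 0 0 2, Hz (- 3) 0 0 4, Hz 1 2 3 (- 6)],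
       [Hz 0 0 0 0, Hz 0 0 0 0, Hz (- 1) 0 (- 1) 2, Hz 0 0 0 0, Hz (- 1) 0 0 0, Hz 0 0 0 0],
       [Hz 0 0 0 0, Hz 0 0 0 0, Hz (- 1) 0 (- 1) 2, Hz 2 0 0 (- 2), Hz (- 1) 0 0 0, Hz (- 1) 0 (- 1) 2],
       [Hz 0 0 0 0, Hz 0 0 0 0, Hz 0 0 0 0, Hz 0 0 0 0, Hz 1 0 0 0, Hz (- 1) 1 0 0],
       [Hz 0 0 0 0, Hz 0 0 0 0, Hz 0 0 0 0, Hz 0 0 0 0, Hz 1 0 0 0, Hz 0 0 0 0]]),
     ([F0, F0, F0, F0, F0, F1],
      [[Hz 2 2 0 0, Hz (- 2) 0 0 0, Hz (- 2) 0 0 0, Hz 1 0 1 (- 2), Hz 1 (- 1) 2 (- 4), Hz 3 0 0 0],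
       [Hz 0 0 0 0, Hz 2 0 0 0, Hz 0 0 0 0, Hz (- 1) 0 (- 1) 2, Hz (- 1) 0 (- 1) 2, Hz (- 1) 0 2 (- 2)],
       [Hz 0 0 0 0, Hz 0 0 0 0, Hz 2 0 0 0, Hz (- 1) (- 1) 0 0, Hz (- 1) 0 (- 1) 2, Hz 1 0 0 0],
       [Hz 0 0 0 0, Hz 0 0 0 0, Hz 0 0 0 0, Hz 1 1 0 0, Hz 0 0 0 0, Hz (- 1) 0 0 0],
       [Hz 0 0 0 0, Hz 0 0 0 0, Hz 0 0 0 0, Hz 0 0 0 0, Hz 1 1 0 0, Hz (- 1) 0 0 0],
       [Hz 0 0 0 0, Hz 0 0 0 0, Hz 0 0 0 0, Hz 0 0 0 0, Hz 0 0 0 0, Hz 1 0 0 0]])]"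

section \<open>Evaluation of the certificates\<close>

lemma D4_cert: "check_gram 1 D4_basis" "list_all (check_frame 1 D4_basis 2) D4_frames"
  "check_descent (map fst D4_frames) (map (residue_cols 1 \<circ> snd) []) (monic_f4 1)"
  by code_simp+
lemma E8_cert: "check_gram 2 E8_basis" "list_all (check_gen 2 E8_basis) E8_gens" "list_all (check_frame 2 E8_basis 2) E8_frames"
  "check_descent (map fst E8_frames) (map (residue_cols 2 \<circ> snd) E8_gens) (monic_f4 2)"
  by code_simp+
lemma leech_gram: "check_gram 6 leech_basis"
  by code_simp
lemma leech_gens: "list_all (check_gen 6 leech_basis) leech_gens"
  by code_simp
lemma leech_frames: "list_all (check_frame 6 leech_basis 4) leech_frames"
  by code_simp
text \<open>The check runs over the 1365 lines of the six-dimensional space over the field with four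
  elements.\<close>

lemma leech_descent: "check_descent (map fst leech_frames) (map (residue_cols 6 \<circ> snd) leech_gens) (monic_f4 6)"
  by code_simp

section \<open>The minimal norm of the Leech lattice\<close>

text \<open>Modulo \<open>1 + i\<close> the lattice is the repetition code spanned by the first row.
  The Gram condition covers all products with the first three rows, also those of a row with
  itself.\<close>

definition "leech_residue_check = (
  list_all (\<lambda>n. residue (leech_basis ! 0 ! n) = F1) [0..<6] \<and>
  list_all (\<lambda>k. list_all (\<lambda>n. residue (leech_basis ! k ! n) = F0) [0..<6]) [1..<6] \<and>
  list_all (\<lambda>k. list_all (\<lambda>l.
    let g = sum_list (map (\<lambda>n. leech_basis ! l ! n * hcnj (leech_basis ! k ! n)) [0..<6])
    in g = Hz 2 2 0 0 * half_div g) [0..<6]) [0..<3])"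

text \<open>The second and the third basis vector divided by \<open>T\<close>.\<close>

definition "hexacode_rows =
  [[Hz 0 0 0 0, Hz 1 0 0 0, Hz 0 0 0 0, Hz 0 0 0 (- 1), Hz 0 0 0 (- 1), Hz 1 0 0 0],
   [Hz 0 0 0 0, Hz 0 0 0 0, Hz 1 0 0 0, Hz 1 0 0 0, Hz 0 0 0 (- 1), Hz 0 0 0 (- 1)]]"

text \<open>No two columns agree modulo \<open>1 + i\<close>, so no word of weight two with equal
  entries satisfies the check equations.\<close>

definition "hexacode_check = (
  list_all (\<lambda>k. list_all (\<lambda>n. leech_basis ! Suc k ! n = Hz 1 1 0 0 * hexacode_rows ! k ! n) [0..<6]) [0..<2] \<and>
  list_all (\<lambda>p. list_all (\<lambda>q. p = q \<or>
    list_ex (\<lambda>k. residue (hcnj (hexacode_rows ! k ! p)) \<noteq> residue (hcnj (hexacode_rows ! k ! q))) [0..<2]) [0..<6]) [0..<6])"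

lemma leech_checks: leech_residue_check hexacode_check
  by code_simp+

lemma ht_left_cancel: "ht * x = ht * y \<Longrightarrow> x = y"
proof -
  assume "ht * x = ht * y"
  then have "ht * (x - y) = 0" by (simp only: right_diff_distrib diff_self)
  then have "hnorm ht * hnorm (x - y) = 0" by (metis hnorm_mult hnorm_zero)
  then have "hnorm (x - y) = 0" by simp
  then show "x = y" by (simp add: hnorm_eq_0)
qed

abbreviation "leech \<equiv> \<lambda>k n. leech_basis ! k ! n"

text \<open>The ideal of \<open>1 + i\<close> is two-sided, so this factor can be moved past the
  coefficients \<open>a l\<close> to the left, where \<open>ht_left_cancel\<close> removes
  it.\<close>

lemma leech_herm:
  assumes "k < 3"
  shows "\<exists>g. (\<Sum>n<6. comb 6 leech a n * hcnj (leech k n)) = ht * (2 * g)"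
proof -
  have "\<exists>g. (\<Sum>n<6. leech l n * hcnj (leech k n)) = 2 * ht * g" if "l < 6" for l
  proof -
    have "(\<Sum>n<6. leech l n * hcnj (leech k n)) = Hz 2 2 0 0 * half_div (\<Sum>n<6. leech l n * hcnj (leech k n))"
      using leech_checks(1) that assms by (simp add: leech_residue_check_def list_all_iff sum_list_upt Let_def)
    moreover have "2 * ht = Hz 2 2 0 0" by (simp add: numeral_hz)
    ultimately show ?thesis by metis
  qed
  then obtain g where g: "\<And>l. l < 6 \<Longrightarrow> (\<Sum>n<6. leech l n * hcnj (leech k n)) = 2 * ht * g l" by metis
  have "\<exists>y. x * ht = ht * y" for x
    by (rule residue_eq_0E[of "x * ht"]) (auto simp: residue_mult simp flip: zero_f4_def)
  then obtain c where c: "\<And>x. x * ht = ht * c x" by metis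
  have "(\<Sum>n<6. comb 6 leech a n * hcnj (leech k n)) = (\<Sum>n<6. \<Sum>l<6. a l * (leech l n * hcnj (leech k n)))"
    by (simp only: comb_def sum_distrib_right mult.assoc)
  also have "\<dots> = (\<Sum>l<6. \<Sum>n<6. a l * (leech l n * hcnj (leech k n)))" by (rule sum.swap)
  also have "\<dots> = (\<Sum>l<6. a l * (2 * ht * g l))"
    by (intro sum.cong refl) (simp only: sum_distrib_left[symmetric] g lessThan_iff)
  also have "\<dots> = (\<Sum>l<6. ht * (2 * (c (a l) * g l)))"
  proof (intro sum.cong refl)
    fix l
    have "a l * (2 * ht * g l) = 2 * (a l * ht * g l)"
      by (simp only: mult_2 distrib_left distrib_right mult.assoc)
    also have "\<dots> = ht * (2 * (c (a l) * g l))"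
      unfolding c by (simp only: mult_2 distrib_left distrib_right mult.assoc)
    finally show "a l * (2 * ht * g l) = ht * (2 * (c (a l) * g l))" .
  qed
  also have "\<dots> = ht * (2 * (\<Sum>l<6. c (a l) * g l))" by (simp only: sum_distrib_left)
  finally show ?thesis by blast
qed

text \<open>A vector with norm sum \<open>4\<close> is a multiple of \<open>T\<close>, because otherwise all six coordinates have odd norm. The norm sum
  of its quotient by \<open>T\<close> is \<open>2\<close>, and the products with the first three basis vectors show that the residues of the quotient satisfy the
  check equations of the hexacode. These exclude one or two nonzero residues, and a single coordinate of norm
  \<open>2\<close> is excluded by the first basis vector, whose entries have odd norm.\<close>

lemma leech_min:
  assumes lat: "4 dvd (\<Sum>n<6. hnorm (comb 6 leech a n))" and nz: "(\<Sum>n<6. hnorm (comb 6 leech a n)) \<noteq> 0"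
  shows "8 \<le> (\<Sum>n<6. hnorm (comb 6 leech a n))"
proof (rule ccontr)
  assume "\<not> ?thesis"
  moreover have "0 \<le> (\<Sum>n<6. hnorm (comb 6 leech a n))" by (intro sum_nonneg hnorm_nonneg)
  moreover obtain j where "(\<Sum>n<6. hnorm (comb 6 leech a n)) = 4 * j" using lat by (elim dvdE)
  ultimately have S: "(\<Sum>n<6. hnorm (comb 6 leech a n)) = 4" using nz by simp
  have rb: "residue (leech k n) = (if k = 0 then F1 else F0)" if "k < 6" "n < 6" for k n
    using leech_checks(1) that by (simp add: leech_residue_check_def list_all_iff)
  have "residue (comb 6 leech a n) = residue (a 0)" if "n < 6" for n
  proof -
    have "residue (comb 6 leech a n) = (\<Sum>k<(6::nat). if k = 0 then residue (a 0) else 0)"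
      unfolding comb_def residue_sum residue_mult
      by (intro sum.cong refl) (auto simp: rb that simp flip: zero_f4_def one_f4_def)
    then show ?thesis by simp
  qed
  note residue_v = this
  have "residue (a 0) = 0"
  proof (rule ccontr)
    assume "residue (a 0) \<noteq> 0"
    then have "odd (hnorm (comb 6 leech a n))" if "n < 6" for n
      using residue_v[OF that] odd_hnorm_iff by simp
    then have "1 \<le> hnorm (comb 6 leech a n)" if "n < 6" for n
      using that hnorm_nonneg[of "comb 6 leech a n"] by (metis int_one_le_iff_zero_less le_less odd_pos even_zero)
    then have "(\<Sum>n<6::nat. 1) \<le> (\<Sum>n<6. hnorm (comb 6 leech a n))" by (intro sum_mono) auto
    then show False using S by simp
  qed
  then have "\<exists>y. comb 6 leech a n = ht * y" if "n < 6" for n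
    using residue_v[OF that] by (metis residue_eq_0E)
  then obtain v where v: "\<And>n. n < 6 \<Longrightarrow> comb 6 leech a n = ht * v n" by metis
  have "(\<Sum>n<6. hnorm (comb 6 leech a n)) = 2 * (\<Sum>n<6. hnorm (v n))"
    unfolding sum_distrib_left by (intro sum.cong refl) (simp add: v hnorm_mult)
  then have Sv: "(\<Sum>n<6. hnorm (v n)) = 2" using S by simp
  have "\<exists>g. (\<Sum>n<6. v n * hcnj (leech k n)) = 2 * g" if "k < 3" for k
  proof -
    obtain g where "(\<Sum>n<6. comb 6 leech a n * hcnj (leech k n)) = ht * (2 * g)" using leech_herm \<open>k < 3\<close> by blast
    moreover have "(\<Sum>n<6. comb 6 leech a n * hcnj (leech k n)) = ht * (\<Sum>n<6. v n * hcnj (leech k n))"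
      unfolding sum_distrib_left by (intro sum.cong refl) (simp add: v mult.assoc)
    ultimately show ?thesis using ht_left_cancel by metis
  qed
  then obtain g where g: "\<And>k. k < 3 \<Longrightarrow> (\<Sum>n<6. v n * hcnj (leech k n)) = 2 * g k" by metis
  have red2: "residue (2 * x) = 0" for x by (simp only: mult_2 residue_add f4_add_self)
  have "(\<Sum>n<6. residue (v n)) = residue (\<Sum>n<6. v n * hcnj (leech 0 n))"
  proof -
    have "residue (hcnj x) = F1" if "residue x = F1" for x
      using that by (cases x) (auto split: if_splits)
    then show ?thesis
      unfolding residue_sum residue_mult by (intro sum.cong refl) (simp add: rb flip: one_f4_def)
  qed
  then have r0: "(\<Sum>n<6. residue (v n)) = 0" using g[of 0] red2 by simp
  have rk: "(\<Sum>n<6. residue (v n) * residue (hcnj (hexacode_rows ! k ! n))) = 0" if "k < 2" for k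
  proof -
    define s where "s = (\<Sum>n<6. v n * hcnj (hexacode_rows ! k ! n))"
    have "leech (Suc k) n = ht * hexacode_rows ! k ! n" if "n < 6" for n
      using leech_checks(2) that \<open>k < 2\<close> by (simp add: hexacode_check_def list_all_iff)
    then have "s * hcnj ht = (\<Sum>n<6. v n * hcnj (leech (Suc k) n))"
      unfolding s_def sum_distrib_right by (intro sum.cong refl) (simp add: hcnj_mult mult.assoc)
    also have "\<dots> = 2 * g (Suc k)" using g[of "Suc k"] that by simp
    \<comment> \<open>Multiplying by \<open>ht\<close> from the right replaces
      \<open>hcnj ht\<close> by 2, which can be cancelled.\<close>
    finally have "s * (hcnj ht * ht) = 2 * (g (Suc k) * ht)" by (simp only: mult.assoc[symmetric])
    moreover have "hcnj ht * ht = 2" by (simp add: numeral_hz)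
    ultimately have "2 * (s - g (Suc k) * ht) = 0" by (simp add: mult_2 mult_2_right)
    then have "hnorm 2 * hnorm (s - g (Suc k) * ht) = 0" by (metis hnorm_mult hnorm_zero)
    then have "s = g (Suc k) * ht" by (simp add: hnorm_eq_0 numeral_hz)
    then have "residue s = 0" by (simp add: residue_mult flip: zero_f4_def)
    then show ?thesis unfolding s_def residue_sum residue_mult .
  qed
  define P where "P = {n. n < 6 \<and> residue (v n) \<noteq> 0}"
  have finP: "finite P" "P \<subseteq> {..<6}" by (auto simp: P_def)
  have sumP: "(\<Sum>n<6. residue (v n) * f n) = (\<Sum>n\<in>P. residue (v n) * f n)" for f
    by (rule sum.mono_neutral_right) (auto simp: P_def)
  have "int (card P) \<le> (\<Sum>n\<in>P. hnorm (v n))"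
  proof -
    have "1 \<le> hnorm (v n)" if "n \<in> P" for n
      using that odd_hnorm_iff[of "v n"] hnorm_nonneg[of "v n"] by (auto simp: P_def int_one_le_iff_zero_less order_less_le)
    then have "(\<Sum>n\<in>P. 1) \<le> (\<Sum>n\<in>P. hnorm (v n))" by (rule sum_mono)
    then show ?thesis by simp
  qed
  also have "\<dots> \<le> (\<Sum>n<6. hnorm (v n))" using finP by (intro sum_mono2) (auto intro: hnorm_nonneg)
  finally have "card P \<le> 2" using Sv by simp
  then consider "P = {}" | p where "P = {p}" | p q where "P = {p, q}" "p \<noteq> q"
    using finP(1) by (metis card_0_eq card_1_singletonE card_2_iff le_SucE le_zero_eq numeral_2_eq_2 One_nat_def)
  then show False
  proof cases
    case 1
    have "\<exists>p<6. hnorm (v p) \<noteq> 0" using Sv by (metis lessThan_iff sum.neutral zero_neq_numeral)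
    then obtain p where p: "p < 6" "hnorm (v p) \<noteq> 0" by blast
    have "even (hnorm (v p))" using p 1 odd_hnorm_iff by (auto simp: P_def)
    then have "2 \<le> hnorm (v p)" using p(2) hnorm_nonneg[of "v p"] by presburger
    moreover have split: "(\<Sum>n<6. hnorm (v n)) = hnorm (v p) + (\<Sum>n\<in>{..<6} - {p}. hnorm (v n))"
      using p(1) by (intro sum.remove) auto
    moreover have "0 \<le> (\<Sum>n\<in>{..<6} - {p}. hnorm (v n))" by (intro sum_nonneg hnorm_nonneg)
    ultimately have "hnorm (v p) = 2" "(\<Sum>n\<in>{..<6} - {p}. hnorm (v n)) = 0" using Sv by linarith+
    then have v0: "v n = 0" if "n < 6" "n \<noteq> p" for n
      using that sum_nonneg_eq_0_iff[of "{..<6} - {p}" "\<lambda>n. hnorm (v n)"] by (auto simp: hnorm_nonneg hnorm_eq_0)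
    have "(\<Sum>n<6. v n * hcnj (leech 0 n)) = v p * hcnj (leech 0 p) + (\<Sum>n\<in>{..<6} - {p}. v n * hcnj (leech 0 n))"
      using p(1) by (intro sum.remove) auto
    also have "(\<Sum>n\<in>{..<6} - {p}. v n * hcnj (leech 0 n)) = 0" using v0 by (intro sum.neutral) auto
    finally have "v p * hcnj (leech 0 p) = 2 * g 0" using g[of 0] by simp
    \<comment> \<open>Taking norms, 2 times an odd number would be a multiple of
      \<open>hnorm 2 = 4\<close>.\<close>
    then have "hnorm (v p) * hnorm (hcnj (leech 0 p)) = hnorm 2 * hnorm (g 0)" by (metis hnorm_mult)
    moreover have "hnorm (hcnj x) = hnorm x" for x by (cases x) (simp add: algebra_simps)
    ultimately have "even (hnorm (leech 0 p))" using \<open>hnorm (v p) = 2\<close> by (simp add: numeral_hz)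
    then show False using odd_hnorm_iff[of "leech 0 p"] rb[of 0 p] p(1) by (simp add: zero_f4_def)
  next
    case (2 p)
    then show False using sumP[of "\<lambda>_. 1"] r0 by (auto simp: P_def)
  next
    case (3 p q)
    have pq: "p < 6" "q < 6" "residue (v p) \<noteq> 0" using 3 by (auto simp: P_def)
    have eq: "residue (v p) = residue (v q)" using sumP[of "\<lambda>_. 1"] r0 3 by (simp add: f4_add_eq_0)
    have "residue (hcnj (hexacode_rows ! k ! p)) = residue (hcnj (hexacode_rows ! k ! q))" if "k < 2" for k
    proof -
      have "residue (v p) * (residue (hcnj (hexacode_rows ! k ! p)) + residue (hcnj (hexacode_rows ! k ! q))) = 0"
        using sumP[of "\<lambda>n. residue (hcnj (hexacode_rows ! k ! n))"] rk[OF that] 3 eq by (simp add: distrib_left)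
      then show ?thesis using f4_integral pq(3) f4_add_eq_0 by blast
    qed
    moreover have "\<exists>k\<in>{0..<2}. residue (hcnj (hexacode_rows ! k ! p)) \<noteq> residue (hcnj (hexacode_rows ! k ! q))"
      using leech_checks(2) pq(1,2) 3(2)
      unfolding hexacode_check_def list_all_iff list_ex_iff set_upt by (meson atLeastLessThan_iff zero_le)
    ultimately show False by (metis atLeastLessThan_iff)
  qed
qed

section \<open>The theorem\<close>

lemma certified_coloring:
  assumes card: "CARD('i::finite) = m"
    and gram: "check_gram m B" and gens: "list_all (check_gen m B) G"
    and frames: "list_all (check_frame m B \<mu>) R"
    and descent: "check_descent (map fst R) (map (residue_cols m \<circ> snd) G) (monic_f4 m)"
    and min: "\<And>a. 4 dvd (\<Sum>n<m. hnorm (comb m (\<lambda>k n. B ! k ! n) a n)) \<Longrightarrow>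
      (\<Sum>n<m. hnorm (comb m (\<lambda>k n. B ! k ! n) a n)) \<noteq> 0 \<Longrightarrow>
      2 * \<mu> \<le> (\<Sum>n<m. hnorm (comb m (\<lambda>k n. B ! k ! n) a n))"
    and \<mu>: "\<mu> = 2 \<and> m \<le> 6 \<or> \<mu> = 4 \<and> m = 6"
  shows "\<exists>c. unit_distance_coloring (UNIV :: (quat ^ 'i) set) (7 ^ (2 * m)) c"
proof -
  have lat: "hurwitz_lattice TYPE('i) m (\<lambda>k n. B ! k ! n)"
    by (rule hurwitz_latticeI[OF card gram])
  interpret hurwitz_lattice "TYPE('i)" m "\<lambda>k n. B ! k ! n" \<mu> by (rule lat)
  have "\<mu> > 0" using \<mu> by auto
  show ?thesis
    by (rule hurwitz_lattice_coloring[OF good_of_certificate[OF lat \<open>\<mu> > 0\<close> gens frames descent]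
          min[OF even_sum_hnorm] \<mu>])
qed

text \<open>For \<open>\<mu> = 2\<close> the minimal norm follows from divisibility by 4; only the
  Leech lattice needs \<open>leech_min\<close>.\<close>

lemma four_le_sum_hnorm:
  assumes "4 dvd (\<Sum>n<m. hnorm (f n))" "(\<Sum>n<m. hnorm (f n)) \<noteq> 0"
  shows "2 * 2 \<le> (\<Sum>n<m. hnorm (f n))"
proof -
  have "0 \<le> (\<Sum>n<m. hnorm (f n))" by (intro sum_nonneg hnorm_nonneg)
  then show ?thesis using zdvd_imp_le[OF assms(1)] assms(2) by simp
qed

lemma D4_coloring: "\<exists>c. unit_distance_coloring (UNIV :: (quat ^ 1) set) (7 ^ (2 * 1)) c"
  by (rule certified_coloring[OF _ D4_cert(1) _ D4_cert(2,3) four_le_sum_hnorm]) simp_all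

lemma E8_coloring: "\<exists>c. unit_distance_coloring (UNIV :: (quat ^ 2) set) (7 ^ (2 * 2)) c"
  by (rule certified_coloring[OF _ E8_cert four_le_sum_hnorm]) simp_all

lemma leech_coloring: "\<exists>c. unit_distance_coloring (UNIV :: (quat ^ 6) set) (7 ^ (2 * 6)) c"
  by (rule certified_coloring[OF _ leech_gram leech_gens leech_frames leech_descent])
    (use leech_min in simp_all)

theorem theorem1p3:
  assumes "CARD('n::finite) \<in> {2, 4, 6, 8, 24}"
  shows "chromatic_number (UNIV :: (real ^ 'n) set) \<le> 7 ^ (CARD('n) div 2)"
proof -
  have "chromatic_number (UNIV :: (real ^ 'n) set) \<le> enat (7 ^ (CARD('n) div 2))"
  proof -
    consider "CARD('n) = 2" | "CARD('n) = 4" | "CARD('n) = 6" | "CARD('n) = 8" | "CARD('n) = 24"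
      using assms by blast
    then show ?thesis
    proof cases
      case 1
      obtain c where "unit_distance_coloring (UNIV :: complex set) (7 ^ 1) c"
        using complex_coloring by blast
      from chromatic_number_le_DIM_eq[OF _ this, where 'a = "real ^ 'n"] 1 show ?thesis by simp
    next
      case 2
      obtain c where "unit_distance_coloring (UNIV :: (quat ^ 1) set) (7 ^ (2 * 1)) c"
        using D4_coloring by blast
      from chromatic_number_le_DIM_eq[OF _ this, where 'a = "real ^ 'n"] 2 show ?thesis by simp
    next
      case 3
      obtain c where "unit_distance_coloring (UNIV :: (complex \<times> complex \<times> complex) set) (7 ^ 3) c"
        using complex3_coloring by blast
      from chromatic_number_le_DIM_eq[OF _ this, where 'a = "real ^ 'n"] 3 show ?thesis by simp
    next
      case 4
      obtain c where "unit_distance_coloring (UNIV :: (quat ^ 2) set) (7 ^ (2 * 2)) c"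
        using E8_coloring by blast
      from chromatic_number_le_DIM_eq[OF _ this, where 'a = "real ^ 'n"] 4 show ?thesis by simp
    next
      case 5
      obtain c where "unit_distance_coloring (UNIV :: (quat ^ 6) set) (7 ^ (2 * 6)) c"
        using leech_coloring by blast
      from chromatic_number_le_DIM_eq[OF _ this, where 'a = "real ^ 'n"] 5 show ?thesis by simp
    qed
  qed
  also have "enat (7 ^ (CARD('n) div 2)) = 7 ^ (CARD('n) div 2)"
    by (metis of_nat_eq_enat of_nat_numeral of_nat_power)
  finally show ?thesis .
qed

end
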